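(* Let $f$ and $c_j$ ($j\in\mathcal{E}\cup\mathcal{I}$, with $\mathcal{E},\mathcal{I}$ finite disjoint index sets) be polynomials in $\mathbb{R}[x]=\mathbb{R}[x_1,\dots,x_n]$, and let $c_{eq}=(c_j)_{j\in\mathcal{E}}$, $c_{in}=(c_j)_{j\in\mathcal{I}}$. Suppose $\mathrm{Ideal}[c_{eq}]+\mathrm{QM}[c_{in}]$ is archimedean. If the LICQC, SCC and SOSC hold at every (global) minimizer of $$\min\ f(x)\quad\text{s.t.}\quad c_j(x)=0\ (j\in\mathcal{E}),\ c_j(x)\ge0\ (j\in\mathcal{I}),$$ then, when $k$ is sufficiently large, every minimizer of the $k$th order moment relaxation $$\begin{array}{rl}\min&\langle f,w\rangle\\ \text{s.t.}&\langle 1,w\rangle=1,\ \mathscr{V}_{c_j}^{(2k)}[w]=0\ (j\in\mathcal{E}),\ L_{c_j}^{(k)}[w]\succeq0\ (j\in\mathcal{I}),\\ &M_k[w]\succeq0,\ w\in\mathbb{R}^{\mathbb{N}^n_{2k}}\end{array}$$ has a flat truncation.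
   Context: Notation. $\mathbb{R}[x]_d$ is the space of polynomials of degree at most $d$; $\mathbb{N}^n_d=\{\alpha\in\mathbb{N}^n:|\alpha|\le d\}$. For $w\in\mathbb{R}^{\mathbb{N}^n_{2k}}$ and $p=\sum_\alpha p_\alpha x^\alpha$ with $\deg p\le2k$, $\langle p,w\rangle=\sum_\alpha p_\alpha w_\alpha$. Ideals and quadratic modules. $\Sigma[x]$ is the set of sums of squares of polynomials. For a tuple $h=(h_1,\dots,h_t)$, $\mathrm{Ideal}[h]=\sum_ih_i\mathbb{R}[x]$; for $g=(g_1,\dots,g_\ell)$, $\mathrm{QM}[g]=\Sigma[x]+\sum_ig_i\Sigma[x]$. $\mathrm{Ideal}[h]+\mathrm{QM}[g]$ is archimedean if it contains $R-\|x\|^2$ for some $R>0$. Localizing objects. For $w\in\mathbb{R}^{\mathbb{N}^n_{2k}}$ and a polynomial $q$ with $\deg q\le 2k$: $L_q^{(k)}[w]$ is the symmetric matrix with $\mathrm{vec}(p)^TL_q^{(k)}[w]\mathrm{vec}(p)=\langle qp^2,w\rangle$ for all $p$ with $2\deg p\le2k-\deg q$ ($\mathrm{vec}(p)$ is the coefficient vector); $M_k[w]=L_1^{(k)}[w]$; $\mathscr{V}_q^{(2k)}[w]$ is the vector with $\langle qp,w\rangle=(\mathscr{V}_q^{(2k)}[w])^T\mathrm{vec}(p)$ for all $p$ with $\deg p\le2k-\deg q$. Flat truncation. Let $d_K=\max_{j\in\mathcal{E}\cup\mathcal{I}}\lceil\deg(c_j)/2\rceil$ and $d_0=\max\{\lceil\deg(f)/2\rceil,d_K\}$;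 relaxation orders are $k\ge d_0$. $w\in\mathbb{R}^{\mathbb{N}^n_{2k}}$ has a flat truncation if there is an integer $t\in[d_0,k]$ with $\mathrm{rank}\,M_{t-d_K}[w|_{2t}]=\mathrm{rank}\,M_t[w|_{2t}]$, where $w|_{2t}$ is the restriction of $w$ to indices in $\mathbb{N}^n_{2t}$. Optimality conditions. For $\min F(x)$ s.t. $c_j(x)=0$ ($j\in\mathcal{E}$), $c_j(x)\ge0$ ($j\in\mathcal{I}$), and a minimizer $x^*$, let $J(x^* )=\{j\in\mathcal{E}\cup\mathcal{I}:c_j(x^* )=0\}$. LICQC: the gradients $\nabla c_j(x^* )$, $j\in J(x^* )$, are linearly independent; then there are (unique) multipliers $\lambda_j$ with $\nabla F(x^* )=\sum_{j\in\mathcal{E}\cup\mathcal{I}}\lambda_j\nabla c_j(x^* )$, and $\lambda_j\ge0$, $\lambda_jc_j(x^* )=0$ for $j\in\mathcal{I}$. SCC: $\lambda_j+c_j(x^* )>0$ for all $j\in\mathcal{I}$. SOSC: with $\mathscr{L}=F-\sum_{j}\lambda_jc_j$, $v^T\nabla^2\mathscr{L}(x^* )v>0$ for every nonzero $v\in\mathbb{R}^n$ with $v^T\nabla c_j(x^* )=0$ for all $j\in J(x^* )$. *)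

theory Defs
  imports
    "HOL-Analysis.Analysis"
    "HOL-Library.Poly_Mapping"
    "HOL-Library.Countable_Set"
    "HOL-Library.FuncSet"
    "Jordan_Normal_Form.DL_Rank"
begin

(* HOL-Analysis and Jordan_Normal_Form share some notation.  Points of R^n are of type
   real ^ 'n; the moment and localizing matrices, whose size depends on the relaxation
   order, are Jordan_Normal_Form matrices. *)

no_notation Matrix.vec_index (infixl \<open>$\<close> 100)
no_notation Matrix.scalar_prod (infix \<open>\<bullet>\<close> 70)
hide_const (open) Matrix.vec Matrix.mat Matrix.row Matrix.col Module.smult
hide_type (open) Matrix.vec Matrix.mat


section \<open>Polynomials in several variables\<close>

text \<open>The variables are indexed by the finite type \<open>'n\<close>.  Multiplication of
  polynomial mappings is convolution, so \<open>'n mpoly\<close> is the usual commutative ring.\<close>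

type_synonym 'n expo = "'n \<Rightarrow>\<^sub>0 nat"
type_synonym 'n mpoly = "'n expo \<Rightarrow>\<^sub>0 real"

definition Const :: "real \<Rightarrow> 'n mpoly" where
  "Const a = Poly_Mapping.single 0 a"

definition monomial :: "'n expo \<Rightarrow> 'n mpoly" where
  "monomial \<alpha> = Poly_Mapping.single \<alpha> 1"

definition Var :: "'n \<Rightarrow> 'n mpoly" where
  "Var i = monomial (Poly_Mapping.single i 1)"

definition eval_mpoly :: "'n::finite mpoly \<Rightarrow> real ^ 'n \<Rightarrow> real" where
  "eval_mpoly p x =
    (\<Sum>\<alpha>\<in>Poly_Mapping.keys p. Poly_Mapping.lookup p \<alpha> * (\<Prod>i\<in>UNIV. (x $ i) ^ Poly_Mapping.lookup \<alpha> i))"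

definition expo_deg :: "'n::finite expo \<Rightarrow> nat" where
  "expo_deg \<alpha> = (\<Sum>i\<in>UNIV. Poly_Mapping.lookup \<alpha> i)"

(* The zero polynomial has degree 0. *)
definition mdeg :: "'n::finite mpoly \<Rightarrow> nat" where
  "mdeg p = Max (insert 0 (expo_deg ` Poly_Mapping.keys p))"

definition half_deg :: "'n::finite mpoly \<Rightarrow> nat" where
  "half_deg p = nat \<lceil>real (mdeg p) / 2\<rceil>"

definition expos :: "nat \<Rightarrow> 'n::finite expo set" where
  "expos d = {\<alpha>. expo_deg \<alpha> \<le> d}"


section \<open>Ideals, quadratic modules, archimedeanness\<close>

definition SOS :: "'n mpoly set" where
  "SOS = {\<Sum>i<m. (p i)\<^sup>2 | (m::nat) p. True}"

definition Ideal :: "'j set \<Rightarrow> ('j \<Rightarrow> 'n mpoly) \<Rightarrow> 'n mpoly set" where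
  "Ideal E h = {\<Sum>j\<in>E. h j * p j | p. True}"

definition QM :: "'j set \<Rightarrow> ('j \<Rightarrow> 'n mpoly) \<Rightarrow> 'n mpoly set" where
  "QM I g = {s0 + (\<Sum>j\<in>I. g j * s j) | s0 s. s0 \<in> SOS \<and> (\<forall>j\<in>I. s j \<in> SOS)}"

definition archimedean :: "'j set \<Rightarrow> 'j set \<Rightarrow> ('j \<Rightarrow> 'n::finite mpoly) \<Rightarrow> bool" where
  "archimedean E I c \<longleftrightarrow>
    (\<exists>R>0. Const R - (\<Sum>i\<in>UNIV. (Var i)\<^sup>2) \<in> {a + b | a b. a \<in> Ideal E c \<and> b \<in> QM I c})"


section \<open>Moment and localizing matrices\<close>

text \<open>A truncated multi-sequence of degree \<open>d\<close>, i.e. a vector indexed by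
  \<open>expos d\<close>, is a function that is \<open>undefined\<close> outside \<open>expos d\<close>; restriction to a
  smaller degree is \<^const>\<open>restrict\<close>.\<close>

definition tms :: "nat \<Rightarrow> ('n::finite expo \<Rightarrow> real) set" where
  "tms d = (expos d \<rightarrow>\<^sub>E UNIV)"

definition riesz :: "'n mpoly \<Rightarrow> ('n expo \<Rightarrow> real) \<Rightarrow> real" where
  "riesz p w = (\<Sum>\<alpha>\<in>Poly_Mapping.keys p. Poly_Mapping.lookup p \<alpha> * w \<alpha>)"

text \<open>Rows and columns are numbered through the enumeration \<^const>\<open>from_nat_into\<close> of a
  finite set of exponents.  Neither rank nor positive semidefiniteness depends on its choice.\<close>

definition coeff_vec :: "'n expo set \<Rightarrow> 'n mpoly \<Rightarrow> real Matrix.vec" where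
  "coeff_vec A p = Matrix.vec (card A) (\<lambda>i. Poly_Mapping.lookup p (from_nat_into A i))"

(* the exponents of polynomials p with 2 deg p <= 2k - deg q *)
definition loc_expos :: "nat \<Rightarrow> 'n::finite mpoly \<Rightarrow> 'n expo set" where
  "loc_expos k q = {\<alpha>. 2 * expo_deg \<alpha> + mdeg q \<le> 2 * k}"

(* The matrix is characterised by loc_mat_symmetric and loc_mat_quadratic_form below. *)
definition loc_mat :: "nat \<Rightarrow> 'n::finite mpoly \<Rightarrow> ('n expo \<Rightarrow> real) \<Rightarrow> real Matrix.mat" where
  "loc_mat k q w = (let A = loc_expos k q in
    Matrix.mat (card A) (card A)
      (\<lambda>(i, j). riesz (q * monomial (from_nat_into A i + from_nat_into A j)) w))"

definition moment_mat :: "nat \<Rightarrow> ('n::finite expo \<Rightarrow> real) \<Rightarrow> real Matrix.mat" where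
  "moment_mat k w = loc_mat k 1 w"

(* the exponents of polynomials p with deg p <= d - deg q *)
definition loc_vec_expos :: "nat \<Rightarrow> 'n::finite mpoly \<Rightarrow> 'n expo set" where
  "loc_vec_expos d q = {\<alpha>. expo_deg \<alpha> + mdeg q \<le> d}"

(* The vector is characterised by loc_vec_linear_form below; the superscript 2k is d. *)
definition loc_vec :: "nat \<Rightarrow> 'n::finite mpoly \<Rightarrow> ('n expo \<Rightarrow> real) \<Rightarrow> real Matrix.vec" where
  "loc_vec d q w = (let A = loc_vec_expos d q in
    Matrix.vec (card A) (\<lambda>i. riesz (q * monomial (from_nat_into A i)) w))"

definition psd :: "real Matrix.mat \<Rightarrow> bool" where
  "psd A \<longleftrightarrow> transpose_mat A = A \<and>
    (\<forall>v \<in> carrier_vec (dim_row A). Matrix.scalar_prod v (mult_mat_vec A v) \<ge> 0)"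

definition mat_rank :: "real Matrix.mat \<Rightarrow> nat" where
  "mat_rank A = vec_space.rank (dim_row A) A"


section \<open>Moment relaxation and flat truncation\<close>

(* The inserted 0 only covers the case without constraints. *)
definition d_K :: "'j set \<Rightarrow> 'j set \<Rightarrow> ('j \<Rightarrow> 'n::finite mpoly) \<Rightarrow> nat" where
  "d_K E I c = Max (insert 0 ((\<lambda>j. half_deg (c j)) ` (E \<union> I)))"

definition d_0 :: "'n::finite mpoly \<Rightarrow> 'j set \<Rightarrow> 'j set \<Rightarrow> ('j \<Rightarrow> 'n mpoly) \<Rightarrow> nat" where
  "d_0 f E I c = max (half_deg f) (d_K E I c)"

definition moment_feasible ::
    "nat \<Rightarrow> 'j set \<Rightarrow> 'j set \<Rightarrow> ('j \<Rightarrow> 'n::finite mpoly) \<Rightarrow> ('n expo \<Rightarrow> real) \<Rightarrow> bool" where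
  "moment_feasible k E I c w \<longleftrightarrow>
    w \<in> tms (2 * k) \<and> riesz 1 w = 1 \<and>
    (\<forall>j\<in>E. loc_vec (2 * k) (c j) w = 0\<^sub>v (card (loc_vec_expos (2 * k) (c j)))) \<and>
    (\<forall>j\<in>I. psd (loc_mat k (c j) w)) \<and>
    psd (moment_mat k w)"

definition moment_minimizer ::
    "nat \<Rightarrow> 'n::finite mpoly \<Rightarrow> 'j set \<Rightarrow> 'j set \<Rightarrow> ('j \<Rightarrow> 'n mpoly) \<Rightarrow> ('n expo \<Rightarrow> real) \<Rightarrow> bool"
  where
  "moment_minimizer k f E I c w \<longleftrightarrow> is_arg_min (riesz f) (moment_feasible k E I c) w"

definition flat_truncation ::
    "nat \<Rightarrow> 'n::finite mpoly \<Rightarrow> 'j set \<Rightarrow> 'j set \<Rightarrow> ('j \<Rightarrow> 'n mpoly) \<Rightarrow> ('n expo \<Rightarrow> real) \<Rightarrow> bool"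
  where
  "flat_truncation k f E I c w \<longleftrightarrow>
    (\<exists>t \<in> {d_0 f E I c..k}.
      mat_rank (moment_mat (t - d_K E I c) (restrict w (expos (2 * t)))) =
      mat_rank (moment_mat t (restrict w (expos (2 * t)))))"


section \<open>Optimality conditions\<close>

definition feasible :: "'j set \<Rightarrow> 'j set \<Rightarrow> ('j \<Rightarrow> 'n::finite mpoly) \<Rightarrow> real ^ 'n \<Rightarrow> bool" where
  "feasible E I c x \<longleftrightarrow>
    (\<forall>j\<in>E. eval_mpoly (c j) x = 0) \<and> (\<forall>j\<in>I. eval_mpoly (c j) x \<ge> 0)"

definition minimizer ::
    "'n::finite mpoly \<Rightarrow> 'j set \<Rightarrow> 'j set \<Rightarrow> ('j \<Rightarrow> 'n mpoly) \<Rightarrow> real ^ 'n \<Rightarrow> bool" where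
  "minimizer f E I c x \<longleftrightarrow> is_arg_min (eval_mpoly f) (feasible E I c) x"

definition gradient :: "(real ^ 'n::finite \<Rightarrow> real) \<Rightarrow> real ^ 'n \<Rightarrow> real ^ 'n" where
  "gradient F x = (THE D. GDERIV F x :> D)"

definition hessian :: "(real ^ 'n::finite \<Rightarrow> real) \<Rightarrow> real ^ 'n \<Rightarrow> real ^ 'n ^ 'n" where
  "hessian F x = jacobian (gradient F) (at x)"

definition active ::
    "'j set \<Rightarrow> 'j set \<Rightarrow> ('j \<Rightarrow> 'n::finite mpoly) \<Rightarrow> real ^ 'n \<Rightarrow> 'j set" where
  "active E I c x = {j \<in> E \<union> I. eval_mpoly (c j) x = 0}"

(* Independence of the gradients as an indexed family: injectivity excludes repetitions. *)
definition LICQC ::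
    "'j set \<Rightarrow> 'j set \<Rightarrow> ('j \<Rightarrow> 'n::finite mpoly) \<Rightarrow> real ^ 'n \<Rightarrow> bool" where
  "LICQC E I c x \<longleftrightarrow>
    inj_on (\<lambda>j. gradient (eval_mpoly (c j)) x) (active E I c x) \<and>
    independent ((\<lambda>j. gradient (eval_mpoly (c j)) x) ` active E I c x)"

definition multipliers ::
    "'n::finite mpoly \<Rightarrow> 'j set \<Rightarrow> 'j set \<Rightarrow> ('j \<Rightarrow> 'n mpoly) \<Rightarrow> real ^ 'n \<Rightarrow> ('j \<Rightarrow> real) \<Rightarrow> bool"
  where
  "multipliers f E I c x \<mu> \<longleftrightarrow>
    gradient (eval_mpoly f) x = (\<Sum>j\<in>E \<union> I. \<mu> j *\<^sub>R gradient (eval_mpoly (c j)) x) \<and>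
    (\<forall>j\<in>I. \<mu> j \<ge> 0 \<and> \<mu> j * eval_mpoly (c j) x = 0)"

text \<open>At a minimizer satisfying LICQC the multipliers exist and are unique on
  \<open>E \<union> I\<close>, so the quantifier over \<open>\<mu>\<close> in the next two definitions refers to
  these multipliers.\<close>

definition SCC ::
    "'n::finite mpoly \<Rightarrow> 'j set \<Rightarrow> 'j set \<Rightarrow> ('j \<Rightarrow> 'n mpoly) \<Rightarrow> real ^ 'n \<Rightarrow> bool" where
  "SCC f E I c x \<longleftrightarrow>
    (\<forall>\<mu>. multipliers f E I c x \<mu> \<longrightarrow> (\<forall>j\<in>I. \<mu> j + eval_mpoly (c j) x > 0))"

definition lagrangian ::
    "'n::finite mpoly \<Rightarrow> 'j set \<Rightarrow> 'j set \<Rightarrow> ('j \<Rightarrow> 'n mpoly) \<Rightarrow> ('j \<Rightarrow> real) \<Rightarrow> real ^ 'n \<Rightarrow> real"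
  where
  "lagrangian f E I c \<mu> y = eval_mpoly f y - (\<Sum>j\<in>E \<union> I. \<mu> j * eval_mpoly (c j) y)"

definition SOSC ::
    "'n::finite mpoly \<Rightarrow> 'j set \<Rightarrow> 'j set \<Rightarrow> ('j \<Rightarrow> 'n mpoly) \<Rightarrow> real ^ 'n \<Rightarrow> bool" where
  "SOSC f E I c x \<longleftrightarrow>
    (\<forall>\<mu>. multipliers f E I c x \<mu> \<longrightarrow>
      (\<forall>v. v \<noteq> 0 \<longrightarrow>
        (\<forall>j \<in> active E I c x. v \<bullet> gradient (eval_mpoly (c j)) x = 0) \<longrightarrow>
        v \<bullet> (hessian (lagrangian f E I c \<mu>) x *v v) > 0))"

section \<open>The defining properties of the localizing objects\<close>

lemma finite_expos: "finite (expos d :: 'n::finite expo set)"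
proof -
  have "Poly_Mapping.lookup ` (expos d :: 'n expo set) \<subseteq> (UNIV \<rightarrow>\<^sub>E {..d})"
  proof safe
    fix \<alpha> :: "'n expo" and i
    assume "\<alpha> \<in> expos d"
    then have "(\<Sum>i\<in>UNIV. Poly_Mapping.lookup \<alpha> i) \<le> d"
      by (simp add: expos_def expo_deg_def)
    moreover have "Poly_Mapping.lookup \<alpha> i \<le> (\<Sum>i\<in>UNIV. Poly_Mapping.lookup \<alpha> i)"
      by (rule member_le_sum) auto
    ultimately show "Poly_Mapping.lookup \<alpha> i \<le> d" by linarith
  qed auto
  moreover have "finite ((UNIV :: 'n set) \<rightarrow>\<^sub>E {..d})" by (intro finite_PiE) auto
  ultimately have "finite (Poly_Mapping.lookup ` (expos d :: 'n expo set))"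
    by (rule finite_subset)
  then show ?thesis
    by (rule finite_imageD) (simp add: inj_on_def poly_mapping.lookup_inject)
qed

lemma finite_loc_expos: "finite (loc_expos k q)"
  by (rule finite_subset[OF _ finite_expos[of k]]) (auto simp: loc_expos_def expos_def)

lemma finite_loc_vec_expos: "finite (loc_vec_expos d q)"
  by (rule finite_subset[OF _ finite_expos[of d]]) (auto simp: loc_vec_expos_def expos_def)

lemma expo_deg_le_mdeg: "\<alpha> \<in> Poly_Mapping.keys p \<Longrightarrow> expo_deg \<alpha> \<le> mdeg p"
  unfolding mdeg_def by (intro Max_ge) auto

lemma riesz_superset:
  assumes "finite A" "Poly_Mapping.keys p \<subseteq> A"
  shows "riesz p w = (\<Sum>\<alpha>\<in>A. Poly_Mapping.lookup p \<alpha> * w \<alpha>)"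
  unfolding riesz_def using assms
  by (intro sum.mono_neutral_left) (auto simp: in_keys_iff)

lemma riesz_add: "riesz (p + q) w = riesz p w + riesz q w"
proof -
  let ?A = "Poly_Mapping.keys p \<union> Poly_Mapping.keys q"
  have "Poly_Mapping.keys (p + q) \<subseteq> ?A" by (rule Poly_Mapping.keys_add)
  then show ?thesis
    by (simp add: riesz_superset[of ?A] lookup_add algebra_simps sum.distrib)
qed

lemma riesz_sum: "riesz (\<Sum>i\<in>S. p i) w = (\<Sum>i\<in>S. riesz (p i) w)"
proof (induction S rule: infinite_finite_induct)
  case (insert x F)
  then show ?case by (simp add: riesz_add)
qed (simp_all add: riesz_def)

lemma riesz_Const_mult: "riesz (Const a * p) w = a * riesz p w"
proof -
  have l: "Poly_Mapping.lookup (Const a * p) \<alpha> = a * Poly_Mapping.lookup p \<alpha>" for \<alpha>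
    by (simp add: Const_def mult_map_scale_conv_mult[symmetric] map.rep_eq when_def)
  then have "Poly_Mapping.keys (Const a * p) \<subseteq> Poly_Mapping.keys p"
    by (auto simp: in_keys_iff)
  then show ?thesis
    by (simp add: riesz_superset[of "Poly_Mapping.keys p"] l sum_distrib_left mult.assoc)
qed

lemma mpoly_expand:
  assumes "finite A" "Poly_Mapping.keys p \<subseteq> A"
  shows "p = (\<Sum>\<alpha>\<in>A. Const (Poly_Mapping.lookup p \<alpha>) * monomial \<alpha>)"
proof (rule poly_mapping_eqI)
  fix \<beta>
  have "Poly_Mapping.lookup (\<Sum>\<alpha>\<in>A. Const (Poly_Mapping.lookup p \<alpha>) * monomial \<alpha>) \<beta> =
      (\<Sum>\<alpha>\<in>A. if \<alpha> = \<beta> then Poly_Mapping.lookup p \<alpha> else 0)"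
    unfolding Const_def monomial_def
    by (simp add: mult_single lookup_sum lookup_single when_def)
  also have "\<dots> = Poly_Mapping.lookup p \<beta>"
    using assms by (auto simp: in_keys_iff)
  finally show "Poly_Mapping.lookup p \<beta> =
    Poly_Mapping.lookup (\<Sum>\<alpha>\<in>A. Const (Poly_Mapping.lookup p \<alpha>) * monomial \<alpha>) \<beta>" by simp
qed

lemma riesz_mult_expand:
  assumes "finite A" "Poly_Mapping.keys p \<subseteq> A"
  shows "riesz (q * p) w = (\<Sum>\<alpha>\<in>A. Poly_Mapping.lookup p \<alpha> * riesz (q * monomial \<alpha>) w)"
proof -
  have "q * p = (\<Sum>\<alpha>\<in>A. Const (Poly_Mapping.lookup p \<alpha>) * (q * monomial \<alpha>))"
    by (subst mpoly_expand[OF assms]) (simp add: sum_distrib_left algebra_simps)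
  then show ?thesis by (simp add: riesz_sum riesz_Const_mult)
qed

lemma sum_from_nat_into:
  assumes "finite A"
  shows "(\<Sum>i = 0..<card A. h (from_nat_into A i)) = (\<Sum>\<alpha>\<in>A. h \<alpha>)"
  using sum.reindex_bij_betw[OF bij_betw_from_nat_into_finite[OF assms], of h]
  by (simp add: atLeast0LessThan)

lemma loc_mat_symmetric: "transpose_mat (loc_mat k q w) = loc_mat k q w"
  by (rule eq_matI) (auto simp: loc_mat_def Let_def add.commute)

lemma loc_mat_quadratic_form:
  assumes "2 * mdeg p + mdeg q \<le> 2 * k"
  shows "Matrix.scalar_prod (coeff_vec (loc_expos k q) p)
      (mult_mat_vec (loc_mat k q w) (coeff_vec (loc_expos k q) p)) = riesz (q * p\<^sup>2) w"
proof -
  let ?A = "loc_expos k q"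
  have fin: "finite ?A" by (rule finite_loc_expos)
  have sub: "Poly_Mapping.keys p \<subseteq> ?A"
    using assms expo_deg_le_mdeg[of _ p] by (fastforce simp: loc_expos_def)
  have "Matrix.scalar_prod (coeff_vec ?A p) (mult_mat_vec (loc_mat k q w) (coeff_vec ?A p)) =
      (\<Sum>i = 0..<card ?A. Poly_Mapping.lookup p (from_nat_into ?A i) *
        (\<Sum>j = 0..<card ?A. riesz (q * monomial (from_nat_into ?A i + from_nat_into ?A j)) w *
          Poly_Mapping.lookup p (from_nat_into ?A j)))"
    by (simp add: Matrix.scalar_prod_def loc_mat_def coeff_vec_def Let_def)
  also have "\<dots> = (\<Sum>\<alpha>\<in>?A. Poly_Mapping.lookup p \<alpha> *
        (\<Sum>\<beta>\<in>?A. riesz (q * monomial (\<alpha> + \<beta>)) w * Poly_Mapping.lookup p \<beta>))"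
    by (simp only: sum_from_nat_into[OF fin, of "\<lambda>\<beta>. riesz (q * monomial (\<alpha> + \<beta>)) w *
          Poly_Mapping.lookup p \<beta>" for \<alpha>]
        sum_from_nat_into[OF fin, of "\<lambda>\<alpha>. Poly_Mapping.lookup p \<alpha> *
          (\<Sum>\<beta>\<in>?A. riesz (q * monomial (\<alpha> + \<beta>)) w * Poly_Mapping.lookup p \<beta>)"])
  also have "\<dots> = (\<Sum>\<alpha>\<in>?A. Poly_Mapping.lookup p \<alpha> * riesz ((q * p) * monomial \<alpha>) w)"
  proof (rule sum.cong[OF refl])
    fix \<alpha>
    have "(q * p) * monomial \<alpha> = (q * monomial \<alpha>) * p" by (simp add: algebra_simps)
    then have "riesz ((q * p) * monomial \<alpha>) w =
        (\<Sum>\<beta>\<in>?A. Poly_Mapping.lookup p \<beta> * riesz (q * monomial \<alpha> * monomial \<beta>) w)"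
      by (simp only: riesz_mult_expand[OF fin sub])
    moreover have "q * monomial \<alpha> * monomial \<beta> = q * monomial (\<alpha> + \<beta>)" for \<beta>
      by (simp add: monomial_def mult_single mult.assoc)
    ultimately show "Poly_Mapping.lookup p \<alpha> *
        (\<Sum>\<beta>\<in>?A. riesz (q * monomial (\<alpha> + \<beta>)) w * Poly_Mapping.lookup p \<beta>) =
      Poly_Mapping.lookup p \<alpha> * riesz ((q * p) * monomial \<alpha>) w"
      by (simp add: mult.commute)
  qed
  also have "\<dots> = riesz ((q * p) * p) w" by (rule riesz_mult_expand[OF fin sub, symmetric])
  finally show ?thesis by (simp add: power2_eq_square mult.assoc)
qed

lemma loc_vec_linear_form:
  assumes "mdeg p + mdeg q \<le> d"
  shows "Matrix.scalar_prod (loc_vec d q w) (coeff_vec (loc_vec_expos d q) p) = riesz (q * p) w"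
proof -
  let ?A = "loc_vec_expos d q"
  have fin: "finite ?A" by (rule finite_loc_vec_expos)
  have sub: "Poly_Mapping.keys p \<subseteq> ?A"
    using assms expo_deg_le_mdeg[of _ p] by (fastforce simp: loc_vec_expos_def)
  have "Matrix.scalar_prod (loc_vec d q w) (coeff_vec ?A p) =
      (\<Sum>i = 0..<card ?A. Poly_Mapping.lookup p (from_nat_into ?A i) *
        riesz (q * monomial (from_nat_into ?A i)) w)"
    by (simp add: Matrix.scalar_prod_def loc_vec_def coeff_vec_def Let_def mult.commute)
  also have "\<dots> = (\<Sum>\<alpha>\<in>?A. Poly_Mapping.lookup p \<alpha> * riesz (q * monomial \<alpha>) w)"
    by (rule sum_from_nat_into[OF fin])
  also have "\<dots> = riesz (q * p) w" by (rule riesz_mult_expand[OF fin sub, symmetric])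
  finally show ?thesis .
qed

end

theory Submission
  imports Defs
begin

text \<open>
  Let \<open>M\<close> be the module generated by the constraints and \<open>S\<close> the set of minimizers, which is finite by the
  second order conditions.  For large \<open>m\<close> the polynomial
  \<open>G = f - f\<^sub>m\<^sub>i\<^sub>n - \<Sum> c\<^sub>j A\<^sub>j (1 - c\<^sub>j / \<gamma>)\<^bsup>2m\<^esup> + \<Sum> (m c\<^sub>j\<^sup>2 - A\<^sub>j c\<^sub>j)\<close> (first sum over \<open>I\<close>, second over \<open>E\<close>),
  where the \<open>A\<^sub>j\<close> interpolate the multipliers on \<open>S\<close>, is positive on a cube containing the feasible
  set except for nondegenerate zeros at \<open>S\<close>, and \<open>f - f\<^sub>m\<^sub>i\<^sub>n - G \<in> M\<close>.  Writing such a \<open>G\<close> as a sum of squares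
  weighted by polynomials that are positive on the cube, and expanding the weights in Bernstein
  polynomials, gives \<open>G \<in> M\<close>.  If \<open>p\<close> vanishes on \<open>S\<close>, then \<open>G - \<epsilon> p\<^sup>2\<close> has the same properties for small \<open>\<epsilon>\<close>, so
  \<open>f - f\<^sub>m\<^sub>i\<^sub>n - \<epsilon> p\<^sup>2 \<in> M\<close> and every minimizer \<open>w\<close> of a high order relaxation satisfies \<open>\<langle>p\<^sup>2, w\<rangle> = 0\<close>.
  Applied to \<open>p = x\<^sup>\<alpha> - \<Sum> s\<^sup>\<alpha> L\<^sub>s\<close> with Lagrange polynomials \<open>L\<^sub>s\<close>, this expresses all columns of a moment matrix
  through those of bounded degree.\<close>

section \<open>Evaluation\<close>

text \<open>Since f - f_min vanishes on S, certificates for strictly positive polynomials do not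
  apply to it, and S may lie on the boundary of the feasible set, where the Hessian of f need not be
  positive definite. Passing to G removes the boundary: S lies in the interior of the cube, and G
  grows quadratically in every direction there. To certify G itself, only the ball polynomial R -
  |x|^2 is used as a constraint. The quadratic module of this one polynomial is closed under
  products, which Bernstein expansions require. The exponent 2m is even so that the multiplier of
  c_j is a sum of squares. The power is 1 where c_j = 0, decays where 0 < c_j < \<gamma> and blows
  up where c_j < 0, so it reproduces the Lagrange multiplier on active constraints and penalises
  violated ones. The certificate is exact, not a limit of certificates with growing degrees. A
  single one, for the sum of all p^2 with |\<alpha>| bounded by a fixed t, serves all relaxations of
  high order, so the order from which the conclusion holds does not depend on w.\<close>

lemma Const_0 [simp]: "Const 0 = 0"
  by (simp add: Const_def)

lemma Const_1 [simp]: "Const 1 = 1"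
  by (simp add: Const_def)

lemma Const_add: "Const (a + b) = Const a + Const b"
  by (simp add: Const_def single_add)

lemma Const_mult: "Const (a * b) = Const a * Const b"
  by (simp add: Const_def mult_single)

lemma Const_uminus: "Const (- a) = - Const a"
  by (simp add: Const_def single_uminus)

lemma Const_diff: "Const (a - b) = Const a - Const b"
  by (simp add: Const_def single_diff)

lemma Const_sum: "Const (sum a A) = (\<Sum>i\<in>A. Const (a i))"
  by (induction A rule: infinite_finite_induct) (auto simp: Const_add)

lemma Const_power: "Const (a ^ n) = Const a ^ n"
  by (induction n) (auto simp: Const_mult)

lemma monomial_0 [simp]: "monomial 0 = 1"
  by (simp add: monomial_def)

lemma monomial_add: "monomial (\<alpha> + \<beta>) = monomial \<alpha> * monomial \<beta>"
  by (simp add: monomial_def mult_single)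

lemma monomial_sum: "monomial (\<Sum>i\<in>A. \<alpha> i) = (\<Prod>i\<in>A. monomial (\<alpha> i))"
  by (induction A rule: infinite_finite_induct) (auto simp: monomial_add)

lemma monomial_eq_prod_Var:
  fixes \<alpha> :: "'n::finite expo"
  shows "monomial \<alpha> = (\<Prod>i\<in>UNIV. Var i ^ Poly_Mapping.lookup \<alpha> i)"
proof -
  have "\<alpha> = (\<Sum>i\<in>UNIV. Poly_Mapping.single i (Poly_Mapping.lookup \<alpha> i))"
    by (rule poly_mapping_eqI) (simp add: lookup_sum lookup_single when_def)
  moreover have "monomial (Poly_Mapping.single i m) = Var i ^ m" for i :: 'n and m
  proof (induction m)
    case (Suc m)
    have "Poly_Mapping.single i (Suc m) = Poly_Mapping.single i 1 + Poly_Mapping.single i m"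
      by (simp flip: single_add)
    then show ?case using Suc by (simp add: monomial_add Var_def)
  qed simp
  ultimately show ?thesis by (metis (no_types, lifting) monomial_sum prod.cong)
qed

text \<open>Constants and variables generate the ring, so continuity, expansion at a point,
  differentiability and the change to cube coordinates need to be checked on generators
  only.\<close>

lemma mpoly_induct [case_names Const Var add mult]:
  fixes P :: "'n::finite mpoly \<Rightarrow> bool"
  assumes C: "\<And>a. P (Const a)" and V: "\<And>i. P (Var i)"
    and add: "\<And>p q. P p \<Longrightarrow> P q \<Longrightarrow> P (p + q)" and mult: "\<And>p q. P p \<Longrightarrow> P q \<Longrightarrow> P (p * q)"
  shows "P p"
proof -
  have one: "P 1" and zero: "P 0" using C[of 1] C[of 0] by auto
  have pow: "P (p ^ m)" if "P p" for p m
    using that one by (induction m) (auto intro: mult)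
  have mon: "P (monomial \<alpha>)" for \<alpha>
  proof -
    have "P (\<Prod>i\<in>A. Var i ^ Poly_Mapping.lookup \<alpha> i)" for A :: "'n set"
      by (induction A rule: infinite_finite_induct) (auto intro: mult pow V one)
    then show ?thesis by (simp add: monomial_eq_prod_Var)
  qed
  have "P (\<Sum>\<alpha>\<in>A. Const (a \<alpha>) * monomial \<alpha>)" for A a
    by (induction A rule: infinite_finite_induct) (auto intro: mult add mon zero C)
  then show ?thesis by (subst mpoly_expand[OF finite_keys order_refl, of p])
qed

definition mon_val :: "'n::finite expo \<Rightarrow> real ^ 'n \<Rightarrow> real" where
  "mon_val \<alpha> x = (\<Prod>i\<in>UNIV. (x $ i) ^ Poly_Mapping.lookup \<alpha> i)"

lemma mon_val_add: "mon_val (\<alpha> + \<beta>) x = mon_val \<alpha> x * mon_val \<beta> x"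
  by (simp add: mon_val_def lookup_add power_add prod.distrib)

text \<open>Evaluation is integration against a point mass; its linearity is inherited from
  \<open>riesz\<close>, and only multiplicativity needs an argument of its own.\<close>

lemma eval_eq_riesz: "eval_mpoly p x = riesz p (\<lambda>\<alpha>. mon_val \<alpha> x)"
  by (simp add: eval_mpoly_def riesz_def mon_val_def)

lemma eval_add [simp]: "eval_mpoly (p + q) x = eval_mpoly p x + eval_mpoly q x"
  by (simp add: eval_eq_riesz riesz_add)

lemma eval_monomial [simp]: "eval_mpoly (monomial \<alpha>) x = mon_val \<alpha> x"
  by (simp add: eval_eq_riesz riesz_def monomial_def)

lemma eval_Const_mult: "eval_mpoly (Const a * p) x = a * eval_mpoly p x"
  by (simp add: eval_eq_riesz riesz_Const_mult)

lemma eval_monomial_mult: "eval_mpoly (monomial \<alpha> * p) x = mon_val \<alpha> x * eval_mpoly p x"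
proof -
  have "eval_mpoly (monomial \<alpha> * p) x = (\<Sum>\<beta>\<in>Poly_Mapping.keys p. Poly_Mapping.lookup p \<beta> * mon_val (\<alpha> + \<beta>) x)"
    using riesz_mult_expand[of "Poly_Mapping.keys p" p "monomial \<alpha>"]
    by (simp add: eval_eq_riesz riesz_def monomial_def mult_single)
  then show ?thesis
    by (simp add: mon_val_add eval_eq_riesz riesz_def sum_distrib_left mult_ac)
qed

lemma eval_mult [simp]: "eval_mpoly (p * q) x = eval_mpoly p x * eval_mpoly q x"
proof -
  have "eval_mpoly (p * q) x = (\<Sum>\<beta>\<in>Poly_Mapping.keys q. Poly_Mapping.lookup q \<beta> * eval_mpoly (monomial \<beta> * p) x)"
    using riesz_mult_expand[of "Poly_Mapping.keys q" q p]
    by (simp add: eval_eq_riesz mult.commute[of p "monomial \<beta>" for \<beta>])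
  then show ?thesis
    unfolding eval_monomial_mult by (simp add: eval_eq_riesz[of q] riesz_def sum_distrib_left mult_ac)
qed

lemma eval_0 [simp]: "eval_mpoly 0 x = 0"
  by (simp add: eval_mpoly_def)

lemma eval_1 [simp]: "eval_mpoly 1 x = 1"
  using eval_monomial[of 0 x] by (simp add: mon_val_def)

lemma eval_Const [simp]: "eval_mpoly (Const a) x = a"
  using eval_Const_mult[of a 1 x] by simp

lemma eval_Var [simp]: "eval_mpoly (Var i) x = x $ i"
proof -
  have "x $ j ^ Poly_Mapping.lookup (Poly_Mapping.single i 1) j = (if j = i then x $ i else 1)" for j
    by (auto simp: lookup_single when_def)
  then show ?thesis by (simp add: Var_def mon_val_def)
qed

lemma eval_uminus [simp]: "eval_mpoly (- p) x = - eval_mpoly p x"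
  using eval_add[of p "- p" x] by simp

lemma eval_diff [simp]: "eval_mpoly (p - q) x = eval_mpoly p x - eval_mpoly q x"
  using eval_add[of p "- q" x] by simp

lemma eval_sum [simp]: "eval_mpoly (sum p A) x = (\<Sum>i\<in>A. eval_mpoly (p i) x)"
  by (induction A rule: infinite_finite_induct) auto

lemma eval_prod [simp]: "eval_mpoly (prod p A) x = (\<Prod>i\<in>A. eval_mpoly (p i) x)"
  by (induction A rule: infinite_finite_induct) auto

lemma eval_power [simp]: "eval_mpoly (p ^ m) x = eval_mpoly p x ^ m"
  by (induction m) auto

lemma continuous_on_eval [continuous_intros]: "continuous_on A (eval_mpoly p)"
proof (induction p rule: mpoly_induct)
  case (Const a)
  show ?case by (simp cong: continuous_on_cong)
next
  case (Var i)
  then show ?case by (simp cong: continuous_on_cong add: continuous_on_component)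
next
  case (add p q)
  then show ?case by (simp cong: continuous_on_cong add: continuous_on_add)
next
  case (mult p q)
  then show ?case by (simp cong: continuous_on_cong add: continuous_on_mult)
qed

lemma tendsto_eval [tendsto_intros]:
  assumes "(g \<longlongrightarrow> a) F"
  shows "((\<lambda>y. eval_mpoly p (g y)) \<longlongrightarrow> eval_mpoly p a) F"
  using continuous_on_tendsto_compose[OF continuous_on_eval[of UNIV p] assms] by simp

section \<open>Expansion at a point\<close>

definition shifted :: "real ^ 'n \<Rightarrow> 'n::finite \<Rightarrow> 'n mpoly" where
  "shifted s i = Var i - Const (s $ i)"

lemma eval_shifted [simp]: "eval_mpoly (shifted s i) x = x $ i - s $ i"
  by (simp add: shifted_def)

text \<open>Hadamard's lemma for polynomials; the cofactors are again polynomials, so the expansion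
  can be iterated.\<close>

lemma expansion1:
  fixes p :: "'n::finite mpoly"
  shows "\<exists>g. p = Const (eval_mpoly p s) + (\<Sum>i\<in>UNIV. shifted s i * g i)"
proof (induction p rule: mpoly_induct)
  case (Const a)
  show ?case by (rule exI[of _ "\<lambda>_. 0"]) simp
next
  case (Var i)
  have "(\<Sum>j\<in>UNIV. shifted s j * (if j = i then 1 else 0)) = shifted s i"
    by (simp add: if_distrib cong: if_cong)
  then show ?case
    by (intro exI[of _ "\<lambda>j. if j = i then 1 else 0"]) (simp add: shifted_def[of s i])
next
  case (add p q)
  then obtain g h where g: "p = Const (eval_mpoly p s) + (\<Sum>i\<in>UNIV. shifted s i * g i)"
    and h: "q = Const (eval_mpoly q s) + (\<Sum>i\<in>UNIV. shifted s i * h i)" by blast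
  have "p + q = (Const (eval_mpoly p s) + (\<Sum>i\<in>UNIV. shifted s i * g i))
      + (Const (eval_mpoly q s) + (\<Sum>i\<in>UNIV. shifted s i * h i))"
    by (rule arg_cong2[where f = "(+)", OF g h])
  also have "\<dots> = Const (eval_mpoly (p + q) s) + (\<Sum>i\<in>UNIV. shifted s i * (g i + h i))"
    by (simp add: Const_add distrib_left sum.distrib ac_simps)
  finally show ?case by (rule exI[of _ "\<lambda>i. g i + h i"])
next
  case (mult p q)
  then obtain g h where g: "p = Const (eval_mpoly p s) + (\<Sum>i\<in>UNIV. shifted s i * g i)"
    and h: "q = Const (eval_mpoly q s) + (\<Sum>i\<in>UNIV. shifted s i * h i)" by blast
  let ?a = "Const (eval_mpoly p s)" let ?b = "Const (eval_mpoly q s)"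
  have gp: "(\<Sum>i\<in>UNIV. shifted s i * g i) = p - ?a"
    unfolding eq_diff_eq by (subst add.commute) (rule g[symmetric])
  have hq: "(\<Sum>i\<in>UNIV. shifted s i * h i) = q - ?b"
    unfolding eq_diff_eq by (subst add.commute) (rule h[symmetric])
  \<comment> \<open>From \<open>p q - p(s) q(s) = (p - p(s)) q + p(s) (q - q(s))\<close>.\<close>
  have "(\<Sum>i\<in>UNIV. shifted s i * (g i * q + ?a * h i))
      = (\<Sum>i\<in>UNIV. shifted s i * g i) * q + ?a * (\<Sum>i\<in>UNIV. shifted s i * h i)"
    by (simp add: sum_distrib_left sum_distrib_right sum.distrib algebra_simps)
  also have "\<dots> = (p - ?a) * q + ?a * (q - ?b)"
    by (simp only: gp hq)
  also have "\<dots> = p * q - Const (eval_mpoly (p * q) s)"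
    by (simp add: Const_mult algebra_simps)
  finally have "p * q = Const (eval_mpoly (p * q) s)
      + (\<Sum>i\<in>UNIV. shifted s i * (g i * q + ?a * h i))" by (simp add: algebra_simps)
  then show ?case by (rule exI[of _ "\<lambda>i. g i * q + ?a * h i"])
qed

text \<open>Restricting to the line through \<open>s\<close> in direction \<open>v\<close> turns Taylor coefficients at
  \<open>s\<close> into coefficients of a univariate polynomial.\<close>

definition line :: "real ^ 'n \<Rightarrow> real ^ 'n \<Rightarrow> 'n::finite mpoly \<Rightarrow> real poly" where
  "line s v p = (\<Sum>\<alpha>\<in>Poly_Mapping.keys p. [:Poly_Mapping.lookup p \<alpha>:] *
     (\<Prod>i\<in>UNIV. [:s $ i, v $ i:] ^ Poly_Mapping.lookup \<alpha> i))"

lemma poly_line: "poly (line s v p) t = eval_mpoly p (s + t *\<^sub>R v)"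
  by (simp add: line_def eval_mpoly_def poly_sum poly_prod poly_power)

lemma line_eqI: "(\<And>t. poly (line s v p) t = poly q t) \<Longrightarrow> line s v p = q"
  by (metis poly_eq_poly_eq_iff ext)

lemma line_add [simp]: "line s v (p + q) = line s v p + line s v q"
  by (rule line_eqI) (simp add: poly_line)

lemma line_diff [simp]: "line s v (p - q) = line s v p - line s v q"
  by (rule line_eqI) (simp add: poly_line)

lemma line_mult [simp]: "line s v (p * q) = line s v p * line s v q"
  by (rule line_eqI) (simp add: poly_line)

lemma line_sum [simp]: "line s v (sum p A) = (\<Sum>i\<in>A. line s v (p i))"
  by (rule line_eqI) (simp add: poly_line poly_sum)

lemma line_Const [simp]: "line s v (Const a) = [:a:]"
  by (rule line_eqI) (simp add: poly_line)

lemma line_shifted [simp]: "line s v (shifted s i) = [:0, v $ i:]"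
  by (rule line_eqI) (simp add: poly_line)

lemma coeff_line_0: "coeff (line s v p) 0 = eval_mpoly p s"
  using poly_line[of s v p 0] by (simp add: poly_0_coeff_0)

section \<open>Taylor coefficients of first and second order along a direction\<close>

definition lin :: "'n::finite mpoly \<Rightarrow> real ^ 'n \<Rightarrow> real ^ 'n \<Rightarrow> real" where
  "lin p s v = coeff (line s v p) 1"

text \<open>The coefficient of t^2, hence half the Hessian form. Coefficients of univariate
  polynomials obey the product rules below without any differentiation.\<close>

definition quad :: "'n::finite mpoly \<Rightarrow> real ^ 'n \<Rightarrow> real ^ 'n \<Rightarrow> real" where
  "quad p s v = coeff (line s v p) 2"

lemma coeff_mult_1: "coeff (p * q) 1 = coeff p 0 * coeff q 1 + coeff p 1 * coeff q 0"
  for p q :: "'a::comm_semiring_0 poly"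
  by (simp add: coeff_mult)

lemma coeff_mult_2: "coeff (p * q) 2 = coeff p 0 * coeff q 2 + coeff p 1 * coeff q 1 + coeff p 2 * coeff q 0"
  for p q :: "'a::comm_semiring_0 poly"
  by (simp add: coeff_mult numeral_2_eq_2)

lemma lin_add: "lin (p + q) s v = lin p s v + lin q s v"
  and lin_diff: "lin (p - q) s v = lin p s v - lin q s v"
  and lin_sum: "lin (sum r A) s v = (\<Sum>i\<in>A. lin (r i) s v)"
  and lin_Const [simp]: "lin (Const a) s v = 0"
  and lin_mult: "lin (p * q) s v = eval_mpoly p s * lin q s v + lin p s v * eval_mpoly q s"
  by (simp_all only: lin_def line_add line_diff line_sum line_mult line_Const coeff_mult_1 coeff_line_0
      coeff_add coeff_diff coeff_sum) simp

lemma quad_add: "quad (p + q) s v = quad p s v + quad q s v"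
  and quad_diff: "quad (p - q) s v = quad p s v - quad q s v"
  and quad_sum: "quad (sum r A) s v = (\<Sum>i\<in>A. quad (r i) s v)"
  and quad_Const [simp]: "quad (Const a) s v = 0"
  and quad_mult: "quad (p * q) s v =
    eval_mpoly p s * quad q s v + lin p s v * lin q s v + quad p s v * eval_mpoly q s"
  by (simp_all only: quad_def lin_def line_add line_diff line_sum line_mult line_Const coeff_mult_2 coeff_line_0
      coeff_add coeff_diff coeff_sum) (simp add: numeral_2_eq_2)

lemma lin_power:
  assumes "eval_mpoly p s = 1"
  shows "lin (p ^ m) s v = real m * lin p s v"
proof (induction m)
  case 0
  show ?case using lin_Const[of 1 s v] by simp
qed (use assms in \<open>simp add: lin_mult algebra_simps\<close>)

text \<open>\<open>expansion1\<close> is applied to p, to its cofactors and to theirs; the values of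
  the cofactors at s give \<open>g\<close> and \<open>H\<close>, where \<open>H\<close> need not be
  symmetric. The cubic remainder keeps polynomial cofactors \<open>K\<close>, since an algebraic
  certificate cannot use a mere estimate of it.\<close>

lemma expansion3:
  fixes p :: "'n::finite mpoly"
  obtains g H K where
    "p = Const (eval_mpoly p s) + (\<Sum>i\<in>UNIV. shifted s i * Const (g i))
      + (\<Sum>i\<in>UNIV. \<Sum>j\<in>UNIV. shifted s i * shifted s j * Const (H i j))
      + (\<Sum>i\<in>UNIV. \<Sum>j\<in>UNIV. \<Sum>k\<in>UNIV. shifted s i * shifted s j * shifted s k * K i j k)"
    and "\<And>v. lin p s v = (\<Sum>i\<in>UNIV. g i * v $ i)"
    and "\<And>v. quad p s v = (\<Sum>i\<in>UNIV. \<Sum>j\<in>UNIV. H i j * v $ i * v $ j)"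
proof -
  obtain G where G: "\<And>q. q = Const (eval_mpoly q s) + (\<Sum>i\<in>UNIV. shifted s i * G q i)"
    using expansion1[of _ s] by metis
  define g where "g i = eval_mpoly (G p i) s" for i
  define H where "H i j = eval_mpoly (G (G p i) j) s" for i j
  define K where "K i j = G (G (G p i) j)" for i j
  have e1: "p = Const (eval_mpoly p s) + (\<Sum>i\<in>UNIV. shifted s i * G p i)"
    by (rule G)
  have e2: "G p i = Const (g i) + (\<Sum>j\<in>UNIV. shifted s j * G (G p i) j)" for i
    unfolding g_def by (rule G)
  have e3: "G (G p i) j = Const (H i j) + (\<Sum>k\<in>UNIV. shifted s k * K i j k)" for i j
    unfolding H_def K_def by (rule G)
  have "(\<Sum>i\<in>UNIV. shifted s i * G p i) = (\<Sum>i\<in>UNIV. shifted s i * Const (g i))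
      + (\<Sum>i\<in>UNIV. \<Sum>j\<in>UNIV. shifted s i * shifted s j * G (G p i) j)"
    by (subst e2) (simp add: distrib_left sum.distrib sum_distrib_left mult.assoc)
  also have "(\<Sum>i\<in>UNIV. \<Sum>j\<in>UNIV. shifted s i * shifted s j * G (G p i) j) =
     (\<Sum>i\<in>UNIV. \<Sum>j\<in>UNIV. shifted s i * shifted s j * Const (H i j))
      + (\<Sum>i\<in>UNIV. \<Sum>j\<in>UNIV. \<Sum>k\<in>UNIV. shifted s i * shifted s j * shifted s k * K i j k)"
    by (subst e3) (simp add: distrib_left sum.distrib sum_distrib_left mult.assoc)
  finally have fin: "(\<Sum>i\<in>UNIV. shifted s i * G p i) = (\<Sum>i\<in>UNIV. shifted s i * Const (g i))
      + ((\<Sum>i\<in>UNIV. \<Sum>j\<in>UNIV. shifted s i * shifted s j * Const (H i j))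
      + (\<Sum>i\<in>UNIV. \<Sum>j\<in>UNIV. \<Sum>k\<in>UNIV. shifted s i * shifted s j * shifted s k * K i j k))" .
  have *: "p = Const (eval_mpoly p s) + (\<Sum>i\<in>UNIV. shifted s i * Const (g i))
      + (\<Sum>i\<in>UNIV. \<Sum>j\<in>UNIV. shifted s i * shifted s j * Const (H i j))
      + (\<Sum>i\<in>UNIV. \<Sum>j\<in>UNIV. \<Sum>k\<in>UNIV. shifted s i * shifted s j * shifted s k * K i j k)"
    by (rule trans[OF e1]) (simp only: fin add.assoc)
  have ls: "lin (shifted s i) s v = v $ i" "quad (shifted s i) s v = 0" for v i
    by (simp_all add: lin_def quad_def numeral_2_eq_2)
  show ?thesis
  proof (rule that[OF *])
    fix v
    show "lin p s v = (\<Sum>i\<in>UNIV. g i * v $ i)"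
      by (subst *) (simp add: lin_add lin_sum lin_mult ls mult.commute)
    show "quad p s v = (\<Sum>i\<in>UNIV. \<Sum>j\<in>UNIV. H i j * v $ i * v $ j)"
      by (subst *) (simp add: quad_add quad_sum quad_mult lin_mult ls mult_ac)
  qed
qed

section \<open>Positivity on a cube\<close>

lemma compact_pos_bounded_below:
  fixes u :: "'a::topological_space \<Rightarrow> real"
  assumes "compact Z" "continuous_on Z u" "\<And>x. x \<in> Z \<Longrightarrow> u x > 0"
  obtains \<eta> where "\<eta> > 0" "\<And>x. x \<in> Z \<Longrightarrow> u x \<ge> \<eta>"
proof (cases "Z = {}")
  case False
  from continuous_attains_inf[OF assms(1) False assms(2)] show ?thesis
    using assms(3) that by metis
qed (use that[of 1] in auto)

lemma compact_bounded_above: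
  fixes u :: "'a::topological_space \<Rightarrow> real"
  assumes "compact Z" "continuous_on Z u"
  obtains C where "C > 0" "\<And>x. x \<in> Z \<Longrightarrow> u x < C"
proof (cases "Z = {}")
  case False
  from continuous_attains_sup[OF assms(1) False assms(2)] obtain y where "\<And>x. x \<in> Z \<Longrightarrow> u x \<le> u y"
    by blast
  then show ?thesis by (intro that[of "\<bar>u y\<bar> + 1"]) fastforce+
qed (use that[of 1] in auto)

definition cube :: "real \<Rightarrow> (real ^ 'n) set" where
  "cube \<rho> = {x. \<forall>i. \<bar>x $ i\<bar> \<le> \<rho>}"

lemma compact_cube: "compact (cube \<rho> :: (real ^ 'n::finite) set)"
proof -
  have "cube \<rho> = cbox (\<chi> i. - \<rho>) (\<chi> i. \<rho> :: real ^ 'n)"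
    by (auto simp: cube_def mem_box_cart abs_le_iff minus_le_iff)
  then show ?thesis by (simp only: compact_cbox)
qed

section \<open>Bernstein form of powers in one variable\<close>

definition bern_coeff :: "nat \<Rightarrow> nat \<Rightarrow> nat \<Rightarrow> real" where
  "bern_coeff N j k = real (j choose k) / real (N choose k)"

lemma Const_prod: "Const (prod a A) = (\<Prod>i\<in>A. Const (a i))"
  by (induction A rule: infinite_finite_induct) (auto simp: Const_mult)

text \<open>Homogenisation: t^k is multiplied by \<open>(t + u)^(N - k) = 1\<close> and expanded by
  the binomial theorem. The coefficients match because
  \<open>C(N, m + k) C(m + k, k) = C(N, k) C(N - k, m)\<close>.\<close>

lemma power_as_bernstein:
  fixes t u :: "'n::finite mpoly"
  assumes "t + u = 1" "k \<le> N"
  shows "t ^ k = (\<Sum>j\<le>N. Const (bern_coeff N j k) * (Const (real (N choose j)) * t ^ j * u ^ (N - j)))"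
proof -
  let ?g = "\<lambda>j. Const (bern_coeff N j k) * (Const (real (N choose j)) * t ^ j * u ^ (N - j))"
  have C: "Const (real m) = (of_nat m :: 'n mpoly)" for m
    by (induction m) (auto simp: Const_add)
  have "t ^ k = t ^ k * (t + u) ^ (N - k)" using assms by simp
  also have "\<dots> = (\<Sum>m\<le>N - k. t ^ k * (of_nat ((N - k) choose m) * t ^ m * u ^ (N - k - m)))"
    by (simp add: binomial_ring sum_distrib_left)
  also have "\<dots> = (\<Sum>m\<le>N - k. ?g (m + k))"
  proof (rule sum.cong[OF refl])
    fix m assume "m \<in> {..N - k}"
    then have m: "m + k \<le> N" using assms by auto
    have "(N choose (m + k)) * ((m + k) choose k) = (N choose k) * ((N - k) choose m)"
      using choose_mult[of k "m + k" N] m by simp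
    then have "real (N choose (m + k)) * real ((m + k) choose k) = real (N choose k) * real ((N - k) choose m)"
      by (metis of_nat_mult)
    moreover have "real (N choose k) \<noteq> 0" using assms by simp
    ultimately have "bern_coeff N (m + k) k * real (N choose (m + k)) = real ((N - k) choose m)"
      by (simp add: bern_coeff_def field_simps)
    then have "Const (bern_coeff N (m + k) k) * Const (real (N choose (m + k))) = (of_nat ((N - k) choose m) :: 'n mpoly)"
      by (simp flip: Const_mult C)
    then have "?g (m + k) = of_nat ((N - k) choose m) * t ^ (m + k) * u ^ (N - (m + k))"
      by (simp add: mult.assoc[symmetric])
    also have "\<dots> = t ^ k * (of_nat ((N - k) choose m) * t ^ m * u ^ (N - k - m))"
      by (simp add: power_add mult_ac diff_diff_left add.commute)
    finally show "t ^ k * (of_nat ((N - k) choose m) * t ^ m * u ^ (N - k - m)) = ?g (m + k)" by simp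
  qed
  also have "\<dots> = (\<Sum>j\<in>{k..N}. ?g j)"
    by (rule sum.reindex_bij_witness[of _ "\<lambda>j. j - k" "\<lambda>m. m + k"]) (use assms in auto)
  \<comment> \<open>For j < k the coefficient is zero because j choose k is zero.\<close>
  also have "\<dots> = (\<Sum>j\<le>N. ?g j)"
    by (rule sum.mono_neutral_left) (auto simp: bern_coeff_def not_le binomial_eq_0)
  finally show ?thesis .
qed

text \<open>\<open>bern_coeff N j k\<close> is the product over i < k of (j - i) / (N - i), each
  factor close to j / N. The condition 2k \<le> N keeps N - i at least N / 2 and the factors in
  [-1, 1], also those with j < i; a product then moves by at most the sum of the changes of its
  factors.\<close>

lemma bern_coeff_bounds:
  assumes "2 * k \<le> N" "j \<le> N" "N > 0"
  shows "\<bar>bern_coeff N j k\<bar> \<le> 1"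
    and "\<bar>bern_coeff N j k - (real j / real N) ^ k\<bar> \<le> real k * (2 * real k / real N)"
proof -
  let ?r = "\<lambda>i. (real j - real i) / (real N - real i)"
  have "real (m choose k) = (\<Prod>i<k. real m - real i) / fact k" for m
    using gbinomial_prod_rev[of "real m" k] by (simp add: binomial_gbinomial atLeast0LessThan)
  then have eq: "bern_coeff N j k = (\<Prod>i<k. ?r i)"
    by (simp add: bern_coeff_def prod_dividef)
  have b: "\<bar>?r i\<bar> \<le> 1" if "i < k" for i
    using that assms by (auto simp: abs_le_iff divide_simps)
  show "\<bar>bern_coeff N j k\<bar> \<le> 1"
    unfolding eq abs_prod using b by (intro prod_le_1) auto
  have d: "\<bar>?r i - real j / real N\<bar> \<le> 2 * real k / real N" if "i < k" for i
  proof -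
    have p: "real N - real i > 0" "real N > 0" using that assms by auto
    have "?r i - real j / real N = - (real i * (real N - real j)) / (real N * (real N - real i))"
      using p by (simp add: field_simps)
    then have "\<bar>?r i - real j / real N\<bar> = (real i * (real N - real j)) / (real N * (real N - real i))"
      using p assms by (simp add: abs_mult)
    also have "\<dots> \<le> (real k * real N) / (real N * (real N / 2))"
      using p assms that by (intro frac_le mult_mono) auto
    finally show ?thesis using p by (simp add: mult.commute)
  qed
  have "(real j / real N) ^ k = (\<Prod>i<k. real j / real N)" by simp
  then have "\<bar>bern_coeff N j k - (real j / real N) ^ k\<bar> = norm ((\<Prod>i<k. ?r i) - (\<Prod>i<k. real j / real N))"
    using eq by simp
  also have "\<dots> \<le> (\<Sum>i<k. norm (?r i - real j / real N))"
    by (rule norm_prod_diff) (use b assms in auto)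
  also have "\<dots> \<le> (\<Sum>i<k. 2 * real k / real N)" by (intro sum_mono) (use d in auto)
  finally show "\<bar>bern_coeff N j k - (real j / real N) ^ k\<bar> \<le> real k * (2 * real k / real N)" by simp
qed

text \<open>Linear combinations of power products, built one term at a time so that the Bernstein
  approximation below can be proved by adding a term.\<close>

inductive_set power_span :: "('n \<Rightarrow> 'n mpoly) \<Rightarrow> 'n::finite mpoly set" for t where
  zero: "0 \<in> power_span t"
| step: "q \<in> power_span t \<Longrightarrow> Const b * (\<Prod>i\<in>UNIV. t i ^ \<alpha> i) + q \<in> power_span t"

lemma power_span_add: "p \<in> power_span t \<Longrightarrow> q \<in> power_span t \<Longrightarrow> p + q \<in> power_span t"
  by (induction p rule: power_span.induct) (auto simp: add.assoc intro: power_span.step)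

lemma power_span_mult_monomial:
  "p \<in> power_span t \<Longrightarrow> Const b * (\<Prod>i\<in>UNIV. t i ^ \<alpha> i) * p \<in> power_span t"
proof (induction p rule: power_span.induct)
  case (step q c \<beta>)
  have "Const b * (\<Prod>i\<in>UNIV. t i ^ \<alpha> i) * (Const c * (\<Prod>i\<in>UNIV. t i ^ \<beta> i) + q) =
     Const (b * c) * (\<Prod>i\<in>UNIV. t i ^ (\<alpha> i + \<beta> i)) + Const b * (\<Prod>i\<in>UNIV. t i ^ \<alpha> i) * q"
    by (simp add: Const_mult power_add prod.distrib algebra_simps)
  then show ?case by (simp only: power_span.step[OF step.IH])
qed (simp add: power_span.zero)

lemma power_span_mult: "p \<in> power_span t \<Longrightarrow> q \<in> power_span t \<Longrightarrow> p * q \<in> power_span t"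
  by (induction p rule: power_span.induct)
    (auto simp: power_span.zero distrib_right intro!: power_span_add power_span_mult_monomial)

lemma power_span_UNIV:
  fixes t :: "'n::finite \<Rightarrow> 'n mpoly"
  assumes "\<And>i. Var i = Const a + Const b * t i"
  shows "p \<in> power_span t"
proof (induction p rule: mpoly_induct)
  case (Const c)
  show ?case using power_span.step[OF power_span.zero, where b = c and \<alpha> = "\<lambda>_. 0"] by simp
next
  case (Var i)
  have c: "Const a \<in> power_span t"
    using power_span.step[OF power_span.zero, where b = a and \<alpha> = "\<lambda>_. 0"] by simp
  have "(\<Prod>j\<in>UNIV. t j ^ (if j = i then 1 else 0)) = t i"
    by (simp add: if_distrib[of "\<lambda>m. t _ ^ m"] cong: if_cong)
  then have "Const b * t i + Const a \<in> power_span t"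
    using power_span.step[OF c, where b = b and \<alpha> = "\<lambda>j. if j = i then 1 else 0"] by simp
  then show ?case by (simp add: assms[of i] add.commute)
qed (auto intro: power_span_add power_span_mult)

text \<open>The closure properties from which positivity on the cube yields membership. Closure
  under products is essential, as Bernstein polynomials are products of the box generators.\<close>

locale cube_preordering =
  fixes T :: "'n::finite mpoly set" and \<rho> :: real
  assumes rho_pos: "\<rho> > 0"
    and T_add: "p \<in> T \<Longrightarrow> q \<in> T \<Longrightarrow> p + q \<in> T"
    and T_mult: "p \<in> T \<Longrightarrow> q \<in> T \<Longrightarrow> p * q \<in> T"
    and T_square: "p\<^sup>2 \<in> T"
    and T_upper: "Const \<rho> - Var i \<in> T"
    and T_lower: "Const \<rho> + Var i \<in> T"
begin

lemma T_Const: "a \<ge> 0 \<Longrightarrow> Const a \<in> T"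
  using T_square[of "Const (sqrt a)"] by (simp flip: Const_power)

lemma T_0: "0 \<in> T" and T_1: "1 \<in> T"
  using T_Const[of 0] T_Const[of 1] by auto

lemma T_sum: "(\<And>i. i \<in> A \<Longrightarrow> p i \<in> T) \<Longrightarrow> sum p A \<in> T"
  by (induction A rule: infinite_finite_induct) (auto intro: T_add T_0)

lemma T_prod: "(\<And>i. i \<in> A \<Longrightarrow> p i \<in> T) \<Longrightarrow> prod p A \<in> T"
  by (induction A rule: infinite_finite_induct) (auto intro: T_mult T_1)

lemma T_power: "p \<in> T \<Longrightarrow> p ^ m \<in> T"
  by (induction m) (auto intro: T_mult T_1)

text \<open>\<open>up\<close> and \<open>dn\<close> are the barycentric coordinates of
  [-\<rho>, \<rho>] in each variable: they lie in T and add up to 1, as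
  \<open>power_as_bernstein\<close> demands.\<close>

definition up :: "'n \<Rightarrow> 'n mpoly" where "up i = Const (1 / (2 * \<rho>)) * (Const \<rho> + Var i)"
definition dn :: "'n \<Rightarrow> 'n mpoly" where "dn i = Const (1 / (2 * \<rho>)) * (Const \<rho> - Var i)"

lemma up_in_T: "up i \<in> T" and dn_in_T: "dn i \<in> T"
  unfolding up_def dn_def using rho_pos by (auto intro!: T_mult T_Const T_upper T_lower)

lemma up_dn: "up i + dn i = 1"
proof -
  have "up i + dn i = Const (1 / (2 * \<rho>) * (\<rho> + \<rho>))"
    by (simp only: up_def dn_def Const_mult Const_add distrib_left right_diff_distrib) simp
  also have "1 / (2 * \<rho>) * (\<rho> + \<rho>) = 1" using rho_pos by simp
  finally show ?thesis by simp
qed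

lemma Var_up: "Var i = Const (- \<rho>) + Const (2 * \<rho>) * up i"
proof -
  have "Const (2 * \<rho>) * up i = Const (2 * \<rho> * (1 / (2 * \<rho>))) * (Const \<rho> + Var i)"
    by (simp only: up_def Const_mult mult.assoc)
  then show ?thesis using rho_pos by (simp add: Const_uminus)
qed

definition bern :: "nat \<Rightarrow> ('n \<Rightarrow> nat) \<Rightarrow> 'n mpoly" where
  "bern N J = (\<Prod>i\<in>UNIV. Const (real (N choose J i)) * up i ^ J i * dn i ^ (N - J i))"

definition node :: "nat \<Rightarrow> ('n \<Rightarrow> nat) \<Rightarrow> real ^ 'n" where
  "node N J = (\<chi> i. 2 * \<rho> * (real (J i) / real N) - \<rho>)"

abbreviation idx :: "nat \<Rightarrow> ('n \<Rightarrow> nat) set" where "idx N \<equiv> (UNIV \<rightarrow>\<^sub>E {..N})"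

lemma bern_in_T: "bern N J \<in> T"
  unfolding bern_def by (intro T_prod T_mult T_power up_in_T dn_in_T T_Const) auto

lemma node_in_cube: "J \<in> idx N \<Longrightarrow> N > 0 \<Longrightarrow> node N J \<in> cube \<rho>"
proof -
  assume J: "J \<in> idx N" and N: "N > 0"
  have "0 \<le> real (J i) / real N" "real (J i) / real N \<le> 1" for i
    using J N by (auto simp: PiE_def Pi_def)
  then have "0 \<le> \<rho> * (real (J i) / real N)" "\<rho> * (real (J i) / real N) \<le> \<rho> * 1" for i
    using rho_pos mult_left_mono[of "real (J i) / real N" 1 \<rho>] by simp_all
  then have "\<bar>2 * (\<rho> * (real (J i) / real N)) - \<rho>\<bar> \<le> \<rho>" for i
    by (smt (verit, best) mult_1_right)
  then show ?thesis by (simp add: cube_def node_def mult.assoc)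
qed

lemma eval_up_node: "eval_mpoly (up i) (node N J) = real (J i) / real N"
  using rho_pos by (simp add: up_def node_def)

lemma prod_powers_bernstein:
  assumes "\<And>i. \<alpha> i \<le> N"
  shows "(\<Prod>i\<in>UNIV. up i ^ \<alpha> i) = (\<Sum>J\<in>idx N. Const (\<Prod>i\<in>UNIV. bern_coeff N (J i) (\<alpha> i)) * bern N J)"
proof -
  have "(\<Prod>i\<in>UNIV. up i ^ \<alpha> i) = (\<Prod>i\<in>UNIV. \<Sum>j\<le>N. Const (bern_coeff N j (\<alpha> i)) * (Const (real (N choose j)) * up i ^ j * dn i ^ (N - j)))"
    by (intro prod.cong refl power_as_bernstein up_dn assms)
  also have "\<dots> = (\<Sum>J\<in>idx N. \<Prod>i\<in>UNIV. Const (bern_coeff N (J i) (\<alpha> i)) * (Const (real (N choose J i)) * up i ^ J i * dn i ^ (N - J i)))"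
    by (rule prod_sum_PiE) auto
  also have "\<dots> = (\<Sum>J\<in>idx N. (\<Prod>i\<in>UNIV. Const (bern_coeff N (J i) (\<alpha> i))) * bern N J)"
    by (simp only: prod.distrib bern_def)
  finally show ?thesis by (simp only: Const_prod)
qed

text \<open>The Bernstein coefficients of a single power product differ from its node values by O(1
  / N), and errors add up over the terms of p. The family \<open>b\<close> is chosen before
  \<epsilon>, so that it can be extended term by term.\<close>

lemma bernstein_approx:
  "\<exists>b. \<forall>\<epsilon>>0. \<exists>N0. \<forall>N\<ge>N0. p = (\<Sum>J\<in>idx N. Const (b N J) * bern N J) \<and>
     (\<forall>J\<in>idx N. \<bar>b N J - eval_mpoly p (node N J)\<bar> < \<epsilon>)"
proof -
  have "p \<in> power_span up" by (rule power_span_UNIV) (rule Var_up)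
  then show ?thesis
  proof (induction p rule: power_span.induct)
    case zero
    show ?case by (rule exI[of _ "\<lambda>N J. 0"]) auto
  next
    case (step q c \<alpha>)
    then obtain b where b: "\<And>\<epsilon>. \<epsilon> > 0 \<Longrightarrow> \<exists>N0. \<forall>N\<ge>N0. q = (\<Sum>J\<in>idx N. Const (b N J) * bern N J) \<and>
     (\<forall>J\<in>idx N. \<bar>b N J - eval_mpoly q (node N J)\<bar> < \<epsilon>)" by blast
    define d where "d N J = (\<Prod>i\<in>UNIV. bern_coeff N (J i) (\<alpha> i))" for N J
    define S where "S = (\<Sum>i\<in>UNIV. real (\<alpha> i) * (2 * real (\<alpha> i)))"
    have S0: "S \<ge> 0" unfolding S_def by (intro sum_nonneg) auto
    let ?m = "\<Prod>i\<in>UNIV. up i ^ \<alpha> i"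
    have d: "\<bar>d N J - eval_mpoly ?m (node N J)\<bar> \<le> S / real N"
      if N: "N > 0" "\<And>i. 2 * \<alpha> i \<le> N" and J: "J \<in> idx N" for N J
    proof -
      have Ji: "J i \<le> N" for i using J by (auto simp: PiE_def Pi_def)
      have "\<bar>d N J - eval_mpoly ?m (node N J)\<bar> = norm ((\<Prod>i\<in>UNIV. bern_coeff N (J i) (\<alpha> i)) - (\<Prod>i\<in>UNIV. (real (J i) / real N) ^ \<alpha> i))"
        by (simp add: d_def eval_up_node)
      also have "\<dots> \<le> (\<Sum>i\<in>UNIV. norm (bern_coeff N (J i) (\<alpha> i) - (real (J i) / real N) ^ \<alpha> i))"
        using bern_coeff_bounds(1)[OF N(2) Ji N(1)] Ji N by (intro norm_prod_diff) (auto simp: power_le_one)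
      also have "\<dots> \<le> (\<Sum>i\<in>UNIV. real (\<alpha> i) * (2 * real (\<alpha> i) / real N))"
        using bern_coeff_bounds(2)[OF N(2) Ji N(1)] by (intro sum_mono) auto
      also have "\<dots> = S / real N" by (simp add: S_def sum_divide_distrib)
      finally show ?thesis .
    qed
    define b' where "b' N J = c * d N J + b N J" for N J
    show ?case
    proof (intro exI[of _ b'] allI impI)
      fix \<epsilon> :: real assume e: "\<epsilon> > 0"
      obtain N1 where N1': "\<forall>N\<ge>N1. q = (\<Sum>J\<in>idx N. Const (b N J) * bern N J) \<and>
          (\<forall>J\<in>idx N. \<bar>b N J - eval_mpoly q (node N J)\<bar> < \<epsilon> / 2)"
        using b[OF half_gt_zero[OF e]] by (elim exE)
      have N1: "q = (\<Sum>J\<in>idx N. Const (b N J) * bern N J)" if "N \<ge> N1" for N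
        by (rule N1'[rule_format, OF that, THEN conjunct1])
      have N1b: "\<bar>b N J - eval_mpoly q (node N J)\<bar> < \<epsilon> / 2" if "N \<ge> N1" "J \<in> idx N" for N J
        by (rule N1'[rule_format, OF that(1), THEN conjunct2, rule_format, OF that(2)])
      obtain N2 :: nat where N2: "real N2 > 2 * \<bar>c\<bar> * S / \<epsilon>" using reals_Archimedean2 by blast
      \<comment> \<open>\<open>N1\<close> controls the error of q, \<open>N2\<close> that of the new
        term, and the maximum ensures \<open>2 * \<alpha> i \<le> N\<close> for
        \<open>bern_coeff_bounds\<close>; the summand 1 makes N positive.\<close>
      define N0 where "N0 = N1 + N2 + Max (range \<alpha>) * 2 + 1"
      show "\<exists>N0. \<forall>N\<ge>N0. Const c * ?m + q = (\<Sum>J\<in>idx N. Const (b' N J) * bern N J) \<and>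
        (\<forall>J\<in>idx N. \<bar>b' N J - eval_mpoly (Const c * ?m + q) (node N J)\<bar> < \<epsilon>)"
      proof (intro exI[of _ N0] allI impI conjI ballI)
        fix N assume N: "N \<ge> N0"
        have "\<alpha> i \<le> Max (range \<alpha>)" for i by (intro Max_ge) auto
        then have "2 * \<alpha> i \<le> N" for i using N unfolding N0_def
          by (metis add_leD1 add_leD2 le_trans mult.commute mult_le_mono1)
        then have N': "N > 0" "\<And>i. 2 * \<alpha> i \<le> N" "N \<ge> N1" "N \<ge> N2"
          using N by (auto simp: N0_def)
        have le: "\<alpha> i \<le> N" for i using N'(2)[of i] by linarith
        have "Const c * ?m + q = Const c * (\<Sum>J\<in>idx N. Const (d N J) * bern N J) + (\<Sum>J\<in>idx N. Const (b N J) * bern N J)"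
          by (rule arg_cong2[where f = "(+)"], simp only: prod_powers_bernstein[OF le] d_def, rule N1[OF N'(3)])
        then show "Const c * ?m + q = (\<Sum>J\<in>idx N. Const (b' N J) * bern N J)"
          by (simp add: b'_def Const_add Const_mult sum_distrib_left sum.distrib distrib_right mult.assoc)
        fix J assume J: "J \<in> idx N"
        have Np: "real N > 0" using N' by simp
        have "real N > 2 * \<bar>c\<bar> * S / \<epsilon>" using N2 N' by linarith
        then have "2 * \<bar>c\<bar> * S < \<epsilon> * real N" using e by (simp add: divide_simps mult.commute)
        then have l: "\<bar>c\<bar> * (S / real N) < \<epsilon> / 2" using Np by (simp add: divide_simps)
        have "\<bar>b' N J - eval_mpoly (Const c * ?m + q) (node N J)\<bar> =
           \<bar>c * (d N J - eval_mpoly ?m (node N J)) + (b N J - eval_mpoly q (node N J))\<bar>"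
          by (simp only: b'_def eval_add eval_Const_mult right_diff_distrib)
        also have "\<dots> \<le> \<bar>c\<bar> * \<bar>d N J - eval_mpoly ?m (node N J)\<bar> + \<bar>b N J - eval_mpoly q (node N J)\<bar>"
          by (rule order_trans[OF abs_triangle_ineq]) (simp add: abs_mult)
        also have "\<dots> < \<epsilon> / 2 + \<epsilon> / 2"
          using mult_left_mono[OF d[OF N'(1,2) J], of "\<bar>c\<bar>"] l N1b[OF N'(3) J] by linarith
        finally show "\<bar>b' N J - eval_mpoly (Const c * ?m + q) (node N J)\<bar> < \<epsilon>" by simp
      qed
    qed
  qed
qed

text \<open>On the compact cube p has a positive lower bound \<eta>; once the Bernstein coefficients
  are within \<eta> of the node values they are nonnegative, and the Bernstein polynomials lie in
  T.\<close>

lemma pos_on_cube_in_T: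
  assumes "\<And>x. x \<in> cube \<rho> \<Longrightarrow> eval_mpoly p x > 0"
  shows "p \<in> T"
proof -
  obtain \<eta> where eta: "\<eta> > 0" "\<And>x. x \<in> cube \<rho> \<Longrightarrow> eval_mpoly p x \<ge> \<eta>"
    using compact_pos_bounded_below[OF compact_cube continuous_on_eval assms] by blast
  obtain b where b: "\<And>\<epsilon>. \<epsilon> > 0 \<Longrightarrow> \<exists>N0. \<forall>N\<ge>N0. p = (\<Sum>J\<in>idx N. Const (b N J) * bern N J) \<and>
     (\<forall>J\<in>idx N. \<bar>b N J - eval_mpoly p (node N J)\<bar> < \<epsilon>)" using bernstein_approx[of p] by blast
  obtain N0 where N0: "\<forall>N\<ge>N0. p = (\<Sum>J\<in>idx N. Const (b N J) * bern N J) \<and>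
     (\<forall>J\<in>idx N. \<bar>b N J - eval_mpoly p (node N J)\<bar> < \<eta>)"
    using b[OF eta(1)] by (elim exE)
  define N where "N = N0 + 1"
  have N: "N \<ge> N0" by (simp add: N_def)
  note p = N0[rule_format, OF N, THEN conjunct1]
  note a = N0[rule_format, OF N, THEN conjunct2, rule_format]
  have "b N J \<ge> 0" if "J \<in> idx N" for J
    using a[OF that] eta(2)[OF node_in_cube[OF that]] by (simp add: N_def)
  then have "(\<Sum>J\<in>idx N. Const (b N J) * bern N J) \<in> T"
    by (intro T_sum T_mult T_Const bern_in_T)
  then show ?thesis by (subst p)
qed

text \<open>With \<open>Q = \<Sum> h\<^sub>k\<^sup>2\<close>, \<open>z = 1 - Q / C\<close> and \<open>D = (1 + z + \<dots> + z\<^bsup>N-1\<^esup>) / C\<close> we have \<open>z\<^sup>N + D Q = 1\<close>, so the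
  coefficients \<open>P\<^sub>k\<close> may be replaced by \<open>z\<^sup>N P\<^sub>k + D p\<close>.  For large \<open>N\<close> these are positive.\<close>

lemma weighted_squares_positive:
  assumes fin: "finite A" and p: "p = (\<Sum>k\<in>A. (h k)\<^sup>2 * P k)"
    and nonneg: "\<And>x. x \<in> cube \<rho> \<Longrightarrow> eval_mpoly p x \<ge> 0"
    and zeros: "\<And>x k. x \<in> cube \<rho> \<Longrightarrow> eval_mpoly p x = 0 \<Longrightarrow> k \<in> A \<Longrightarrow> eval_mpoly (P k) x > 0"
  obtains W where "p = (\<Sum>k\<in>A. (h k)\<^sup>2 * W k)"
    and "\<And>x k. x \<in> cube \<rho> \<Longrightarrow> k \<in> A \<Longrightarrow> eval_mpoly (W k) x > 0"
proof -
  define Q where "Q = (\<Sum>k\<in>A. (h k)\<^sup>2)"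
  obtain C where C: "C > 0" "\<And>x. x \<in> cube \<rho> \<Longrightarrow> eval_mpoly Q x < C"
    using compact_bounded_above[OF compact_cube continuous_on_eval] by blast
  define z where "z = 1 - Const (1 / C) * Q"
  define D where "D N = Const (1 / C) * (\<Sum>i<N. z ^ i)" for N
  have DQ: "D N * Q = 1 - z ^ N" for N
  proof -
    have "D N * Q = (1 - z) * (\<Sum>i<N. z ^ i)" by (simp add: D_def z_def mult_ac)
    then show ?thesis by (simp add: one_diff_power_eq)
  qed
  have Qnn: "eval_mpoly Q x \<ge> 0" for x unfolding Q_def by (auto intro: sum_nonneg)
  have z: "0 < eval_mpoly z x" "eval_mpoly z x \<le> 1" if "x \<in> cube \<rho>" for x
    using C(1) C(2)[OF that] Qnn[of x] by (auto simp: z_def)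
  \<comment> \<open>With \<open>Suc N\<close> the sum in D contains the term 1, whence the bound 1 /
    C, uniform in N.\<close>
  have D: "eval_mpoly (D (Suc N)) x \<ge> 1 / C" if "x \<in> cube \<rho>" for x N
  proof -
    have "eval_mpoly (D (Suc N)) x = 1 / C * (\<Sum>i<Suc N. eval_mpoly z x ^ i)"
      by (simp add: D_def)
    also have "(\<Sum>i<Suc N. eval_mpoly z x ^ i) \<ge> 1"
      unfolding sum.lessThan_Suc_shift using z[OF that] by (auto intro: sum_nonneg)
    then have "1 / C * (\<Sum>i<Suc N. eval_mpoly z x ^ i) \<ge> 1 / C * 1"
      using C(1) by (intro mult_left_mono) auto
    finally show ?thesis by simp
  qed
  \<comment> \<open>Outside Z all \<open>P k\<close> are already positive. On Z the polynomial p is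
    positive, hence so is Q, and z stays below 1 - \<zeta> / C; the unwanted term
    \<open>z^N P k\<close> dies out there while \<open>D p\<close> does not.\<close>
  define Z where "Z = (\<Union>k\<in>A. {x \<in> cube \<rho>. eval_mpoly (P k) x \<le> 0})"
  have "closed {x. eval_mpoly (P k) x \<le> 0}" for k
    by (intro closed_Collect_le continuous_intros)
  then have cZ: "compact Z"
    unfolding Z_def Collect_conj_eq Collect_mem_eq
    by (intro compact_UN fin compact_Int_closed compact_cube)
  have pZ: "eval_mpoly p x > 0" if "x \<in> Z" for x
    using that zeros nonneg unfolding Z_def by (smt (verit) UN_E mem_Collect_eq)
  have QZ: "eval_mpoly Q x > 0" if "x \<in> Z" for x
  proof -
    have "eval_mpoly Q x \<noteq> 0"
    proof
      assume "eval_mpoly Q x = 0"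
      then have "\<forall>k\<in>A. eval_mpoly (h k) x ^ 2 = 0"
        using fin by (simp add: Q_def sum_nonneg_eq_0_iff)
      then show False using pZ[OF that] by (simp add: p)
    qed
    then show ?thesis using Qnn[of x] by linarith
  qed
  obtain \<eta> where eta: "\<eta> > 0" "\<And>x. x \<in> Z \<Longrightarrow> eval_mpoly p x \<ge> \<eta>"
    using compact_pos_bounded_below[OF cZ continuous_on_eval pZ] by blast
  obtain \<zeta> where zeta: "\<zeta> > 0" "\<And>x. x \<in> Z \<Longrightarrow> eval_mpoly Q x \<ge> \<zeta>"
    using compact_pos_bounded_below[OF cZ continuous_on_eval QZ] by blast
  obtain M where M: "M > 0" "\<And>x. x \<in> Z \<Longrightarrow> (\<Sum>k\<in>A. \<bar>eval_mpoly (P k) x\<bar>) < M"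
    by (rule compact_bounded_above[OF cZ, of "\<lambda>x. \<Sum>k\<in>A. \<bar>eval_mpoly (P k) x\<bar>"])
       (auto intro!: continuous_on_sum continuous_on_rabs continuous_on_eval)
  \<comment> \<open>The maximum with 0 covers an empty Z, for which \<zeta> is arbitrary.\<close>
  define \<theta> where "\<theta> = max 0 (1 - \<zeta> / C)"
  have th: "0 \<le> \<theta>" "\<theta> < 1" using zeta C by (auto simp: \<theta>_def)
  have "(\<lambda>N. \<theta> ^ N * M) \<longlonglongrightarrow> 0 * M" by (intro tendsto_intros LIMSEQ_realpow_zero th)
  then have "eventually (\<lambda>N. \<theta> ^ N * M < \<eta> / C) sequentially"
    using eta C by (intro order_tendstoD) auto
  then have "eventually (\<lambda>N. \<theta> ^ Suc N * M < \<eta> / C) sequentially"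
    by (rule eventually_compose_filterlim) (rule filterlim_Suc)
  then obtain N where N: "\<theta> ^ Suc N * M < \<eta> / C" by (auto simp: eventually_sequentially)
  define W where "W k = z ^ Suc N * P k + D (Suc N) * p" for k
  have W: "eval_mpoly (W k) x > 0" if x: "x \<in> cube \<rho>" and k: "k \<in> A" for x k
  proof -
    have Dp: "eval_mpoly (D (Suc N)) x * eval_mpoly p x \<ge> 1 / C * eval_mpoly p x"
      using D[OF x] nonneg[OF x] by (rule mult_right_mono)
    show ?thesis
    proof (cases "x \<in> Z")
      case False
      then have "eval_mpoly (P k) x > 0" using x k by (force simp: Z_def)
      then have "eval_mpoly z x ^ Suc N * eval_mpoly (P k) x > 0" using z(1)[OF x] by simp
      moreover have "1 / C * eval_mpoly p x \<ge> 0" using C(1) nonneg[OF x] by simp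
      ultimately show ?thesis using Dp unfolding W_def eval_add eval_mult eval_power by linarith
    next
      case True
      have "eval_mpoly z x \<le> 1 - \<zeta> / C"
        using zeta(2)[OF True] C(1) by (simp add: z_def divide_right_mono)
      then have "eval_mpoly z x ^ Suc N \<le> \<theta> ^ Suc N"
        using z(1)[OF x] by (intro power_mono) (auto simp: \<theta>_def)
      moreover have "\<bar>eval_mpoly (P k) x\<bar> \<le> M"
        using member_le_sum[of k A "\<lambda>k. \<bar>eval_mpoly (P k) x\<bar>"] M(2)[OF True] k fin by simp
      ultimately have "\<bar>eval_mpoly z x ^ Suc N * eval_mpoly (P k) x\<bar> \<le> \<theta> ^ Suc N * M"
        unfolding abs_mult using z(1)[OF x] M(1) th by (intro mult_mono) auto
      also have "\<dots> < \<eta> / C" by (rule N)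
      also have "\<dots> \<le> 1 / C * eval_mpoly p x"
        using eta(2)[OF True] C(1) by (simp add: divide_right_mono)
      finally show ?thesis using Dp unfolding W_def eval_add eval_mult eval_power by linarith
    qed
  qed
  have "(\<Sum>k\<in>A. (h k)\<^sup>2 * W k) = z ^ Suc N * (\<Sum>k\<in>A. (h k)\<^sup>2 * P k) + (D (Suc N) * Q) * p"
    unfolding W_def Q_def by (simp only: distrib_left sum.distrib sum_distrib_left sum_distrib_right mult_ac)
  also have "\<dots> = p" unfolding DQ p[symmetric] by (simp only: left_diff_distrib mult_1) simp
  finally show ?thesis using W by (intro that[of W]) auto
qed

lemma weighted_squares_in_T:
  assumes "finite A" and p: "p = (\<Sum>k\<in>A. (h k)\<^sup>2 * P k)"
    and "\<And>x. x \<in> cube \<rho> \<Longrightarrow> eval_mpoly p x \<ge> 0"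
    and "\<And>x k. x \<in> cube \<rho> \<Longrightarrow> eval_mpoly p x = 0 \<Longrightarrow> k \<in> A \<Longrightarrow> eval_mpoly (P k) x > 0"
  shows "p \<in> T"
proof -
  obtain W where W: "p = (\<Sum>k\<in>A. (h k)\<^sup>2 * W k)"
      "\<And>x k. x \<in> cube \<rho> \<Longrightarrow> k \<in> A \<Longrightarrow> eval_mpoly (W k) x > 0"
    using weighted_squares_positive[OF assms] by blast
  have "(\<Sum>k\<in>A. (h k)\<^sup>2 * W k) \<in> T"
    by (intro T_sum T_mult T_square pos_on_cube_in_T W(2))
  then show ?thesis by (simp only: W(1)[symmetric])
qed

end

section \<open>Polynomials with finitely many nondegenerate zeros\<close>

text \<open>Cholesky factorisation by induction on the index set: the square belonging to the new
  index a is completed, and the Schur complement \<open>w'\<close> on B is again positive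
  definite.\<close>

lemma positive_definite_sum_squares:
  fixes w :: "'i \<Rightarrow> 'i \<Rightarrow> real"
  assumes "finite A" "\<And>i j. w i j = w j i"
    and "\<And>y. (\<exists>i\<in>A. y i \<noteq> 0) \<Longrightarrow> (\<Sum>i\<in>A. \<Sum>j\<in>A. w i j * y i * y j) > 0"
  shows "\<exists>l. \<forall>i\<in>A. \<forall>j\<in>A. w i j = (\<Sum>k\<in>A. l k i * l k j)"
  using assms
proof (induction A arbitrary: w rule: finite_induct)
  case (insert a B)
  have split: "(\<Sum>i\<in>insert a B. \<Sum>j\<in>insert a B. w i j * y i * y j) =
      w a a * y a * y a + 2 * y a * (\<Sum>j\<in>B. w a j * y j) + (\<Sum>i\<in>B. \<Sum>j\<in>B. w i j * y i * y j)" for y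
  proof -
    have "(\<Sum>i\<in>insert a B. \<Sum>j\<in>insert a B. w i j * y i * y j) =
      w a a * y a * y a + (\<Sum>j\<in>B. w a j * y a * y j) + (\<Sum>i\<in>B. w i a * y i * y a)
        + (\<Sum>i\<in>B. \<Sum>j\<in>B. w i j * y i * y j)"
      using insert.hyps by (simp add: sum.distrib)
    moreover have "(\<Sum>i\<in>B. w i a * y i * y a) = (\<Sum>j\<in>B. w a j * y a * y j)"
      by (rule sum.cong) (use insert.prems(1) in auto)
    moreover have "(\<Sum>j\<in>B. w a j * y a * y j) = y a * (\<Sum>j\<in>B. w a j * y j)"
      by (simp add: sum_distrib_left mult_ac)
    ultimately show ?thesis by simp
  qed
  have aa: "w a a > 0"
  proof -
    have "(\<Sum>j\<in>B. w a j * (if j = a then 1 else 0)) = 0" "(\<Sum>i\<in>B. \<Sum>j\<in>B. w i j * (if i = a then 1 else 0) * (if j = a then 1 else 0)) = 0"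
      using insert.hyps by (auto intro!: sum.neutral)
    then show ?thesis
      using insert.prems(2)[of "\<lambda>i. if i = a then 1 else 0"] split[of "\<lambda>i. if i = a then 1 else 0"] by simp
  qed
  define w' where "w' i j = w i j - w a i * w a j / w a a" for i j
  have "\<exists>l. \<forall>i\<in>B. \<forall>j\<in>B. w' i j = (\<Sum>k\<in>B. l k i * l k j)"
  proof (rule insert.IH)
    show "w' i j = w' j i" for i j using insert.prems(1)[of i j] by (simp add: w'_def)
    fix y :: "'i \<Rightarrow> real" assume y: "\<exists>i\<in>B. y i \<noteq> 0"
    define b where "b = (\<Sum>j\<in>B. w a j * y j)"
    \<comment> \<open>This value at a minimises the form for fixed y on B; the minimum is the form
      of the Schur complement.\<close>
    define z where "z = y(a := - b / w a a)"
    have zB: "z j = y j" if "j \<in> B" for j using that insert.hyps by (auto simp: z_def)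
    have "(\<Sum>i\<in>insert a B. \<Sum>j\<in>insert a B. w i j * z i * z j) > 0"
      by (rule insert.prems(2)) (use y zB in force)
    also have "(\<Sum>i\<in>insert a B. \<Sum>j\<in>insert a B. w i j * z i * z j) =
        w a a * z a * z a + 2 * z a * b + (\<Sum>i\<in>B. \<Sum>j\<in>B. w i j * y i * y j)"
      unfolding split b_def using zB by simp
    also have "w a a * z a * z a + 2 * z a * b = - (b * b / w a a)"
      using aa by (simp add: z_def field_simps)
    also have "b * b / w a a = (\<Sum>i\<in>B. \<Sum>j\<in>B. w a i * w a j / w a a * y i * y j)"
      unfolding b_def by (simp add: sum_product sum_divide_distrib mult_ac)
    finally show "(\<Sum>i\<in>B. \<Sum>j\<in>B. w' i j * y i * y j) > 0"
      by (simp add: w'_def left_diff_distrib sum_subtractf)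
  qed
  then obtain l where l: "\<And>i j. i \<in> B \<Longrightarrow> j \<in> B \<Longrightarrow> w' i j = (\<Sum>k\<in>B. l k i * l k j)" by blast
  define l' where "l' k i = (if k = a then w a i / sqrt (w a a) else if i = a then 0 else l k i)" for k i
  have B: "k \<in> B \<Longrightarrow> k \<noteq> a" for k using insert.hyps by auto
  have "w i j = (\<Sum>k\<in>insert a B. l' k i * l' k j)" if ij: "i \<in> insert a B" "j \<in> insert a B" for i j
  proof -
    have sq: "sqrt (w a a) * sqrt (w a a) = w a a" using aa by simp
    have "(\<Sum>k\<in>insert a B. l' k i * l' k j) = w a i * w a j / w a a + (\<Sum>k\<in>B. l' k i * l' k j)"
      using insert.hyps sq by (simp add: l'_def)
    also have "\<dots> = w i j"
    proof (cases "i = a \<or> j = a")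
      case True
      then have "(\<Sum>k\<in>B. l' k i * l' k j) = 0" using B by (auto intro!: sum.neutral simp: l'_def)
      then show ?thesis using True aa insert.prems(1)[of i a] by auto
    next
      case False
      then have "(\<Sum>k\<in>B. l' k i * l' k j) = w' i j"
        using ij by (subst l) (auto simp: l'_def B intro!: sum.cong)
      then show ?thesis by (simp add: w'_def)
    qed
    finally show ?thesis by simp
  qed
  then show ?case by blast
qed simp

text \<open>Nondegeneracy is stated as local quadratic growth rather than through the Hessian, since
  growth passes to small perturbations by plain estimates. Each zero is interior, so it has a
  neighbourhood inside the cube.\<close>

definition nondegenerate :: "real \<Rightarrow> 'n::finite mpoly \<Rightarrow> (real ^ 'n) set \<Rightarrow> bool" where
  "nondegenerate \<rho> G S \<longleftrightarrow> finite S \<and> (\<forall>x \<in> cube \<rho> - S. eval_mpoly G x > 0) \<and>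
    (\<forall>s\<in>S. s \<in> interior (cube \<rho>) \<and> eval_mpoly G s = 0 \<and>
      (\<exists>\<epsilon>>0. \<forall>\<^sub>F x in nhds s. eval_mpoly G x \<ge> \<epsilon> * (norm (x - s))\<^sup>2))"

lemma nondegenerate_nonneg: "nondegenerate \<rho> G S \<Longrightarrow> x \<in> cube \<rho> \<Longrightarrow> eval_mpoly G x \<ge> 0"
  by (cases "x \<in> S") (auto simp: nondegenerate_def less_imp_le)

text \<open>With P = t (b + t Q), dividing by t from the right and from the left forces b = 0; then
  Q is at least c near 0, and by continuity also at 0.\<close>

lemma eventually_quadratic_growth_poly:
  fixes P :: "real poly"
  assumes "poly P 0 = 0" and "\<forall>\<^sub>F t in nhds 0. poly P t \<ge> c * t\<^sup>2"
  shows "coeff P 1 = 0" "coeff P 2 \<ge> c"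
proof -
  obtain b Q where P: "P = pCons 0 (pCons b Q)"
    using assms(1) by (metis pCons_cases poly_pCons add.right_neutral mult_zero_left)
  have l: "((\<lambda>t. b + t * poly Q t) \<longlongrightarrow> b + 0 * poly Q 0) (at 0 within A)" for A
    by (intro tendsto_intros tendsto_poly)
  have ev: "\<forall>\<^sub>F t in at 0 within A. t * (b + t * poly Q t) \<ge> c * t * t" for A
    using assms(2) unfolding eventually_at_filter by eventually_elim (auto simp: P power2_eq_square mult.assoc)
  have lc: "((\<lambda>t. c * t) \<longlongrightarrow> c * 0) (at 0 within A)" for A
    by (intro tendsto_intros)
  have "b \<ge> 0"
  proof -
    have "\<forall>\<^sub>F t in at_right 0. b + t * poly Q t \<ge> c * t"
      using ev[of "{0<..}"] eventually_at_right_less[of 0]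
      by eventually_elim (metis mult.commute mult.assoc mult_le_cancel_left_pos)
    then show ?thesis using tendsto_le[OF _ l lc, of "{0<..}"] by simp
  qed
  moreover have "b \<le> 0"
  proof -
    have "\<forall>\<^sub>F t in at_left 0. t < (0::real)"
      by (auto simp: eventually_at_filter)
    then have "\<forall>\<^sub>F t in at_left 0. b + t * poly Q t \<le> c * t"
      using ev[of "{..<0}"]
      by eventually_elim (metis mult.commute mult.assoc mult_le_cancel_left_neg)
    then show ?thesis using tendsto_le[OF _ lc l, of "{..<0}"] by simp
  qed
  ultimately have b: "b = 0" by simp
  then show "coeff P 1 = 0" by (simp add: P)
  have "\<forall>\<^sub>F t in at 0. poly Q t \<ge> c"
    using ev[of UNIV] eventually_neq_at_within[of 0 0 UNIV]
  proof eventually_elim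
    case (elim t)
    then have "(t * t) * poly Q t \<ge> (t * t) * c" "t * t > 0"
      by (auto simp: b mult_ac zero_less_mult_iff)
    then show ?case by (simp add: mult_le_cancel_left_pos)
  qed
  moreover have "(poly Q \<longlongrightarrow> poly Q 0) (at 0)" by (intro tendsto_poly tendsto_intros)
  ultimately have "c \<le> poly Q 0" by (intro tendsto_lowerbound[of "poly Q" _ "at 0"]) auto
  then show "coeff P 2 \<ge> c" by (simp add: P poly_0_coeff_0 numeral_2_eq_2)
qed

lemma quadratic_growth_lin_quad:
  assumes "eval_mpoly G s = 0" and "\<forall>\<^sub>F x in nhds s. eval_mpoly G x \<ge> \<epsilon> * (norm (x - s))\<^sup>2"
  shows "lin G s v = 0" "quad G s v \<ge> \<epsilon> * (norm v)\<^sup>2"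
proof -
  have "((\<lambda>t. s + t *\<^sub>R v) \<longlongrightarrow> s + 0 *\<^sub>R v) (nhds 0)"
    by (intro tendsto_intros filterlim_ident)
  then have "filterlim (\<lambda>t. s + t *\<^sub>R v) (nhds s) (nhds 0)" by simp
  from eventually_compose_filterlim[OF assms(2) this]
  have "\<forall>\<^sub>F t in nhds 0. poly (line s v G) t \<ge> (\<epsilon> * (norm v)\<^sup>2) * t\<^sup>2"
    by eventually_elim (simp add: poly_line power_mult_distrib mult_ac)
  moreover have "poly (line s v G) 0 = 0" using assms by (simp add: poly_line)
  ultimately show "lin G s v = 0" "quad G s v \<ge> \<epsilon> * (norm v)\<^sup>2"
    unfolding lin_def quad_def by (rule eventually_quadratic_growth_poly[rotated])+
qed

context cube_preordering
begin

text \<open>The Taylor expansion at the only zero has no constant and no linear term. Half of the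
  quadratic growth is set aside to absorb the cubic remainder, the other half keeps the remaining
  form positive definite. The result is a sum of squares with weights positive at s, as
  \<open>weighted_squares_in_T\<close> requires.\<close>

lemma nondegenerate_single_in_T:
  assumes nd: "nondegenerate \<rho> G {s}"
  shows "G \<in> T"
proof -
  obtain \<epsilon> where e: "\<epsilon> > 0" and gr: "\<forall>\<^sub>F x in nhds s. eval_mpoly G x \<ge> \<epsilon> * (norm (x - s))\<^sup>2"
    and G0: "eval_mpoly G s = 0" using nd by (auto simp: nondegenerate_def)
  obtain g H K where G: "G = Const (eval_mpoly G s) + (\<Sum>i\<in>UNIV. shifted s i * Const (g i))
      + (\<Sum>i\<in>UNIV. \<Sum>j\<in>UNIV. shifted s i * shifted s j * Const (H i j))
      + (\<Sum>i\<in>UNIV. \<Sum>j\<in>UNIV. \<Sum>k\<in>UNIV. shifted s i * shifted s j * shifted s k * K i j k)"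
    and lin: "\<And>v. lin G s v = (\<Sum>i\<in>UNIV. g i * v $ i)"
    and quad: "\<And>v. quad G s v = (\<Sum>i\<in>UNIV. \<Sum>j\<in>UNIV. H i j * v $ i * v $ j)"
    by (rule expansion3[of G s]) (rule that; assumption)
  have "g i = 0" for i
  proof -
    have "(\<Sum>j\<in>UNIV. g j * axis i 1 $ j) = (\<Sum>j\<in>UNIV. if j = i then g i else 0)"
      by (rule sum.cong) (auto simp: axis_def)
    then have "lin G s (axis i 1) = g i" by (simp add: lin)
    then show ?thesis using quadratic_growth_lin_quad(1)[OF G0 gr] by simp
  qed
  define Y where "Y = shifted s"
  define R where "R i j = (\<Sum>k\<in>UNIV. Y k * K i j k)" for i j
  have G': "G = (\<Sum>i\<in>UNIV. \<Sum>j\<in>UNIV. Y i * Y j * Const (H i j)) + (\<Sum>i\<in>UNIV. \<Sum>j\<in>UNIV. Y i * Y j * R i j)"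
    by (subst G) (simp add: G0 \<open>\<And>i. g i = 0\<close> Y_def R_def sum_distrib_left mult.assoc)
  define n where "n = real CARD('n)"
  have n: "n > 0" by (simp add: n_def)
  \<comment> \<open>Chosen so that \<open>4 * n * d = \<epsilon> / 2\<close>; 4n is the factor with
    which d enters the diagonal in \<open>two\<close>.\<close>
  define d where "d = \<epsilon> / (8 * n)"
  have d: "d > 0" using e n by (simp add: d_def)
  \<comment> \<open>The symmetrised quadratic part minus the reserve on the diagonal.\<close>
  define w where "w i j = (H i j + H j i) / 2 - (if i = j then 4 * n * d else 0)" for i j
  have diag: "(\<Sum>i\<in>UNIV. \<Sum>j\<in>UNIV. (if i = j then c else 0) * y i * y j) = c * (\<Sum>i\<in>UNIV. y i * y i)"
    for c :: real and y :: "'n \<Rightarrow> real"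
    by (simp add: if_distrib[of "\<lambda>x. x * _"] if_distrib[of "\<lambda>x. _ * x"] sum_distrib_left mult.assoc cong: if_cong)
  have swap: "(\<Sum>i\<in>UNIV. \<Sum>j\<in>UNIV. H j i * y i * y j) = (\<Sum>i\<in>UNIV. \<Sum>j\<in>UNIV. H i j * y i * y j)"
    for y :: "'n \<Rightarrow> real" by (subst sum.swap) (simp add: mult_ac)
  have "\<exists>l :: 'n \<Rightarrow> 'n \<Rightarrow> real. \<forall>i\<in>UNIV. \<forall>j\<in>UNIV. w i j = (\<Sum>k\<in>UNIV. l k i * l k j)"
  proof (rule positive_definite_sum_squares)
    fix y :: "'n \<Rightarrow> real" assume "\<exists>i\<in>UNIV. y i \<noteq> 0"
    then have y: "(\<chi> i. y i) \<noteq> 0" by (auto simp: Finite_Cartesian_Product.vec_eq_iff)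
    have nrm: "(norm (\<chi> i. y i))\<^sup>2 = (\<Sum>i\<in>UNIV. y i * y i)"
      by (simp add: power2_norm_eq_inner inner_vec_def)
    have "(\<Sum>i\<in>UNIV. \<Sum>j\<in>UNIV. w i j * y i * y j) =
       1 / 2 * (\<Sum>i\<in>UNIV. \<Sum>j\<in>UNIV. H i j * y i * y j) + 1 / 2 * (\<Sum>i\<in>UNIV. \<Sum>j\<in>UNIV. H j i * y i * y j)
       - (\<Sum>i\<in>UNIV. \<Sum>j\<in>UNIV. (if i = j then 4 * n * d else 0) * y i * y j)"
    proof -
      have "w i j * y i * y j = 1 / 2 * (H i j * y i * y j) + 1 / 2 * (H j i * y i * y j)
          - (if i = j then 4 * n * d else 0) * y i * y j" for i j
        by (simp add: w_def field_simps)
      then show ?thesis by (simp only: sum.distrib sum_subtractf sum_distrib_left[symmetric])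
    qed
    also have "\<dots> = quad G s (\<chi> i. y i) - 4 * n * d * (norm (\<chi> i. y i))\<^sup>2"
      by (simp only: swap diag quad nrm) simp
    finally have "(\<Sum>i\<in>UNIV. \<Sum>j\<in>UNIV. w i j * y i * y j) = quad G s (\<chi> i. y i) - 4 * n * d * (norm (\<chi> i. y i))\<^sup>2" .
    moreover have "4 * n * d * (norm (\<chi> i. y i))\<^sup>2 = \<epsilon> / 2 * (norm (\<chi> i. y i))\<^sup>2" using n by (simp add: d_def)
    moreover have "\<epsilon> / 2 * (norm (\<chi> i. y i))\<^sup>2 > 0" using e y by simp
    ultimately show "(\<Sum>i\<in>UNIV. \<Sum>j\<in>UNIV. w i j * y i * y j) > 0"
      using quadratic_growth_lin_quad(2)[OF G0 gr, of "\<chi> i. y i"] by linarith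
  qed (auto simp: w_def)
  then obtain l :: "'n \<Rightarrow> 'n \<Rightarrow> real" where l: "\<And>i j. w i j = (\<Sum>k\<in>UNIV. l k i * l k j)" by blast
  \<comment> \<open>The left summand indexes the Cholesky squares, with weight 1. The right one
    serves the remainder through \<open>4 Y_i Y_j = (Y_i + Y_j)^2 - (Y_i - Y_j)^2\<close>; adding d
    to both weights \<plusminus> R_ij / 4 makes them positive at s, where R_ij vanishes.\<close>
  define h where "h = case_sum (\<lambda>k. \<Sum>i\<in>UNIV. Const (l k i) * Y i)
    (\<lambda>(i, j, b). if b then Y i + Y j else Y i - Y j)"
  define P where "P = case_sum (\<lambda>k::'n. 1)
    (\<lambda>(i, j, b). if b then Const d + Const (1/4) * R i j else Const d - Const (1/4) * R i j)"
  have one: "(\<Sum>k\<in>UNIV. (\<Sum>i\<in>UNIV. Const (l k i) * Y i)\<^sup>2) = (\<Sum>i\<in>UNIV. \<Sum>j\<in>UNIV. Const (w i j) * (Y i * Y j))"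
  proof -
    have "(\<Sum>k\<in>UNIV. (\<Sum>i\<in>UNIV. Const (l k i) * Y i)\<^sup>2) =
        (\<Sum>k\<in>UNIV. \<Sum>i\<in>UNIV. \<Sum>j\<in>UNIV. Const (l k i * l k j) * (Y i * Y j))"
      by (simp add: power2_eq_square sum_product Const_mult mult_ac)
    also have "\<dots> = (\<Sum>i\<in>UNIV. \<Sum>k\<in>UNIV. \<Sum>j\<in>UNIV. Const (l k i * l k j) * (Y i * Y j))"
      by (rule sum.swap)
    also have "\<dots> = (\<Sum>i\<in>UNIV. \<Sum>j\<in>UNIV. \<Sum>k\<in>UNIV. Const (l k i * l k j) * (Y i * Y j))"
      by (intro sum.cong refl sum.swap)
    finally show ?thesis by (simp add: l Const_sum sum_distrib_right)
  qed
  have two: "(\<Sum>i\<in>UNIV. \<Sum>j\<in>UNIV. (Y i + Y j)\<^sup>2 * (Const d + Const (1/4) * R i j) + (Y i - Y j)\<^sup>2 * (Const d - Const (1/4) * R i j))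
     = Const (4 * n * d) * (\<Sum>i\<in>UNIV. Y i * Y i) + (\<Sum>i\<in>UNIV. \<Sum>j\<in>UNIV. Y i * Y j * R i j)"
  proof -
    have "(Y i + Y j)\<^sup>2 * (Const d + Const (1/4) * R i j) + (Y i - Y j)\<^sup>2 * (Const d - Const (1/4) * R i j)
       = (Const (2 * d) * (Y i * Y i) + Const (2 * d) * (Y j * Y j)) + Y i * Y j * R i j" for i j
    proof -
      have "(Y i + Y j)\<^sup>2 * (Const d + Const (1/4) * R i j) + (Y i - Y j)\<^sup>2 * (Const d - Const (1/4) * R i j)
       = (Const d + Const d) * (Y i * Y i) + (Const d + Const d) * (Y j * Y j)
          + (Const (1/4) + Const (1/4) + Const (1/4) + Const (1/4)) * (Y i * Y j * R i j)"
        by (simp only: power2_eq_square ring_distribs mult_ac) (simp add: algebra_simps)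
      then show ?thesis by (simp flip: Const_add)
    qed
    moreover have "(\<Sum>i\<in>UNIV. \<Sum>j::'n\<in>UNIV. Const (2 * d) * (Y i * Y i)) = Const (2 * n * d) * (\<Sum>i\<in>UNIV. Y i * Y i)"
    proof -
      have "of_nat m * Const (2 * d) = (Const (2 * real m * d) :: 'n mpoly)" for m
        by (induction m) (auto simp: algebra_simps Const_add[symmetric])
      then have "of_nat CARD('n) * (Const (2 * d) * q) = Const (2 * n * d) * q" for q :: "'n mpoly"
        by (simp only: mult.assoc[symmetric] n_def)
      then show ?thesis by (simp only: sum_constant sum_distrib_left[symmetric])
    qed
    moreover have "(\<Sum>i::'n\<in>UNIV. \<Sum>j\<in>UNIV. Const (2 * d) * (Y j * Y j)) = (\<Sum>i\<in>UNIV. \<Sum>j::'n\<in>UNIV. Const (2 * d) * (Y i * Y i))"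
      by (rule sum.swap)
    ultimately show ?thesis
      by (simp only: sum.distrib distrib_right[symmetric] Const_add[symmetric]) simp
  qed
  have three: "(\<Sum>i\<in>UNIV. \<Sum>j\<in>UNIV. Const (w i j) * (Y i * Y j)) + Const (4 * n * d) * (\<Sum>i\<in>UNIV. Y i * Y i)
     = (\<Sum>i\<in>UNIV. \<Sum>j\<in>UNIV. Y i * Y j * Const (H i j))"
  proof -
    have "Const (w i j) * (Y i * Y j) = Const (1/2) * (Y i * Y j * Const (H i j)) + Const (1/2) * (Y j * Y i * Const (H j i))
      - (if i = j then Const (4 * n * d) * (Y i * Y i) else 0)" for i j
    proof -
      have cw: "Const (w i j) = Const (1/2) * Const (H i j) + Const (1/2) * Const (H j i) - (if i = j then Const (4 * n * d) else 0)"
        by (simp add: w_def add_divide_distrib flip: Const_mult Const_add Const_diff)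
      show ?thesis unfolding cw by (auto simp: algebra_simps)
    qed
    moreover have "(\<Sum>i\<in>UNIV. \<Sum>j\<in>UNIV. Const (1/2) * (Y j * Y i * Const (H j i))) = (\<Sum>i\<in>UNIV. \<Sum>j\<in>UNIV. Const (1/2) * (Y i * Y j * Const (H i j)))"
      by (rule sum.swap)
    moreover have "(\<Sum>i\<in>UNIV. \<Sum>j\<in>UNIV. Const (1/2) * (Y i * Y j * Const (H i j))) + (\<Sum>i\<in>UNIV. \<Sum>j\<in>UNIV. Const (1/2) * (Y i * Y j * Const (H i j)))
      = (\<Sum>i\<in>UNIV. \<Sum>j\<in>UNIV. Y i * Y j * Const (H i j))"
      by (simp only: sum.distrib[symmetric] distrib_right[symmetric] Const_add[symmetric]) simp
    ultimately show ?thesis by (simp add: sum.distrib sum_subtractf sum_distrib_left)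
  qed
  show ?thesis
  proof (rule weighted_squares_in_T)
    show "finite (UNIV :: ('n + 'n \<times> 'n \<times> bool) set)" by simp
    have "(\<Sum>k\<in>UNIV. (h k)\<^sup>2 * P k) = (\<Sum>k\<in>UNIV. (h (Inl k))\<^sup>2 * P (Inl k)) + (\<Sum>k\<in>UNIV. (h (Inr k))\<^sup>2 * P (Inr k))"
      unfolding UNIV_Plus_UNIV[symmetric] by (subst sum.Plus) auto
    also have "(\<Sum>k\<in>UNIV. (h (Inr k))\<^sup>2 * P (Inr k)) = (\<Sum>i\<in>UNIV. \<Sum>j\<in>UNIV. \<Sum>b\<in>UNIV. (h (Inr (i, j, b)))\<^sup>2 * P (Inr (i, j, b)))"
      by (simp add: sum.cartesian_product UNIV_Times_UNIV[symmetric] split_def del: UNIV_Times_UNIV)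
    also have "\<dots> = (\<Sum>i\<in>UNIV. \<Sum>j\<in>UNIV. (Y i + Y j)\<^sup>2 * (Const d + Const (1/4) * R i j) + (Y i - Y j)\<^sup>2 * (Const d - Const (1/4) * R i j))"
      by (simp add: h_def P_def UNIV_bool add.commute)
    also have "(\<Sum>k\<in>UNIV. (h (Inl k))\<^sup>2 * P (Inl k)) = (\<Sum>i\<in>UNIV. \<Sum>j\<in>UNIV. Const (w i j) * (Y i * Y j))"
      by (simp add: h_def P_def one)
    finally show "G = (\<Sum>k\<in>UNIV. (h k)\<^sup>2 * P k)"
      unfolding two by (subst G') (simp only: three[symmetric] add.assoc)
  next
    fix x k assume x: "x \<in> cube \<rho>" and "eval_mpoly G x = 0"
    then have "x = s" using nd by (force simp: nondegenerate_def)
    then have "eval_mpoly (R i j) x = 0" for i j by (simp add: R_def Y_def)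
    then show "eval_mpoly (P k) x > 0"
      using d by (auto simp: P_def split: sum.split)
  next
    show "eval_mpoly G x \<ge> 0" if "x \<in> cube \<rho>" for x
      using nd that by (rule nondegenerate_nonneg)
  qed
qed

end

section \<open>Interpolation and partitions of unity\<close>

lemma lagrange_basis:
  fixes S :: "(real ^ 'n::finite) set"
  assumes "finite S"
  obtains L :: "real ^ 'n \<Rightarrow> 'n mpoly" where
    "\<And>s t. s \<in> S \<Longrightarrow> t \<in> S \<Longrightarrow> eval_mpoly (L s) t = (if s = t then 1 else 0)"
proof -
  \<comment> \<open>For s \<noteq> t an affine function that is 1 at s and 0 at t.\<close>
  define a where "a s t = Const (1 / ((s - t) \<bullet> (s - t))) * (\<Sum>i\<in>UNIV. Const ((s - t) $ i) * shifted t i)" for s t :: "real ^ 'n"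
  have a: "eval_mpoly (a s t) x = (s - t) \<bullet> (x - t) / ((s - t) \<bullet> (s - t))" for s t x
    by (simp add: a_def inner_vec_def)
  show ?thesis
  proof (rule that[of "\<lambda>s. \<Prod>t\<in>S - {s}. a s t"])
    fix s t assume "s \<in> S" "t \<in> S"
    then show "eval_mpoly (\<Prod>t\<in>S - {s}. a s t) t = (if s = t then 1 else 0)"
      using assms by (auto simp: a intro!: bexI[of _ t])
  qed
qed

lemma interpolation:
  fixes S :: "(real ^ 'n::finite) set"
  assumes "finite S"
  obtains p where "\<And>s. s \<in> S \<Longrightarrow> eval_mpoly p s = b s"
proof -
  obtain L :: "real ^ 'n \<Rightarrow> 'n mpoly" where
    "\<And>s t. s \<in> S \<Longrightarrow> t \<in> S \<Longrightarrow> eval_mpoly (L s) t = (if s = t then 1 else 0)"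
    using lagrange_basis[OF assms] by blast
  then have "eval_mpoly (\<Sum>s\<in>S. Const (b s) * L s) t = b t" if "t \<in> S" for t
    using that assms by (simp add: if_distrib[of "\<lambda>x. _ * x"] cong: if_cong)
  then show ?thesis using that by blast
qed

text \<open>Induction replaces one generator at a time by its square; c holds the contribution of
  the generators outside A and is 0 in the application.\<close>

lemma squares_generate_unit_ideal:
  fixes K :: "'i \<Rightarrow> 'a::comm_ring_1"
  assumes "finite A" and "(\<Sum>w\<in>A. K w * b w) + c = 1"
  shows "\<exists>v r. (\<Sum>w\<in>A. (K w)\<^sup>2 * v w) + c * r = 1"
  using assms
proof (induction A arbitrary: c rule: finite_induct)
  case empty
  then show ?case by (intro exI[of _ "\<lambda>_. 0"] exI[of _ 1]) simp
next
  case (insert x A)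
  then have "(\<Sum>w\<in>A. K w * b w) + (K x * b x + c) = 1" by (simp add: add_ac)
  from insert.IH[OF this] obtain v r where vr: "(\<Sum>w\<in>A. (K w)\<^sup>2 * v w) + (K x * b x + c) * r = 1" by blast
  define E where "E = (\<Sum>w\<in>A. (K w)\<^sup>2 * v w)"
  define B where "B = K x * b x * r"
  have one: "E + B + c * r = 1" using vr by (simp add: E_def B_def distrib_right add_ac)
  \<comment> \<open>Multiplying E + c r = 1 - B by 1 + B and adding B^2 gives 1, and B^2 is a
    multiple of \<open>(K x)^2\<close>.\<close>
  define v' where "v' w = (if w = x then (b x * r)\<^sup>2 else v w * (1 + B))" for w
  have "(\<Sum>w\<in>A. (K w)\<^sup>2 * v' w) = E * (1 + B)"
    unfolding E_def sum_distrib_right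
    by (rule sum.cong) (use insert.hyps in \<open>auto simp: v'_def mult.assoc\<close>)
  then have "(\<Sum>w\<in>insert x A. (K w)\<^sup>2 * v' w) + c * (r * (1 + B)) = B\<^sup>2 + (E + c * r) * (1 + B)"
    using insert.hyps by (simp add: v'_def B_def algebra_simps power2_eq_square)
  also have "E + c * r = 1 - B" using one by (simp add: algebra_simps)
  also have "B\<^sup>2 + (1 - B) * (1 + B) = 1" by (simp add: algebra_simps power2_eq_square)
  finally show ?case by blast
qed

section \<open>Perturbation of nondegenerate polynomials\<close>

definition quadratic_order :: "'n::finite mpoly \<Rightarrow> real ^ 'n \<Rightarrow> bool" where
  "quadratic_order p s \<longleftrightarrow> (\<exists>C. \<forall>\<^sub>F x in nhds s. \<bar>eval_mpoly p x\<bar> \<le> C * (norm (x - s))\<^sup>2)"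

lemma quadratic_order_sum:
  assumes "\<And>i. i \<in> A \<Longrightarrow> quadratic_order (p i) s"
  shows "quadratic_order (sum p A) s"
  using assms
proof (induction A rule: infinite_finite_induct)
  case (insert a A)
  then obtain C D where C: "\<forall>\<^sub>F x in nhds s. \<bar>eval_mpoly (p a) x\<bar> \<le> C * (norm (x - s))\<^sup>2"
    and D: "\<forall>\<^sub>F x in nhds s. \<bar>eval_mpoly (sum p A) x\<bar> \<le> D * (norm (x - s))\<^sup>2"
    unfolding quadratic_order_def by blast
  have "\<forall>\<^sub>F x in nhds s. \<bar>eval_mpoly (sum p (insert a A)) x\<bar> \<le> (C + D) * (norm (x - s))\<^sup>2"
    using C D
  proof eventually_elim
    case (elim x)
    have "\<bar>eval_mpoly (sum p (insert a A)) x\<bar> \<le> \<bar>eval_mpoly (p a) x\<bar> + \<bar>eval_mpoly (sum p A) x\<bar>"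
      using insert.hyps by (simp del: eval_sum add: abs_triangle_ineq)
    also have "\<dots> \<le> (C + D) * (norm (x - s))\<^sup>2" using elim unfolding distrib_right by linarith
    finally show ?case .
  qed
  then show ?case unfolding quadratic_order_def by blast
qed (auto simp: quadratic_order_def intro!: exI[of _ 0])

text \<open>By \<open>expansion1\<close> p is O(|x - s|), and y is bounded near s.\<close>

lemma vanishing_square_quadratic_order:
  assumes "eval_mpoly p s = 0"
  shows "quadratic_order (p\<^sup>2 * y) s"
proof -
  obtain g where "p = Const (eval_mpoly p s) + (\<Sum>i\<in>UNIV. shifted s i * g i)"
    using expansion1 by blast
  then have "eval_mpoly p x = eval_mpoly (Const (eval_mpoly p s) + (\<Sum>i\<in>UNIV. shifted s i * g i)) x" for x
    by (rule arg_cong)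
  then have p: "eval_mpoly p x = (\<Sum>i\<in>UNIV. (x $ i - s $ i) * eval_mpoly (g i) x)" for x
    using assms by simp
  have comp: "compact (cball s 1)" by simp
  obtain C where C: "C > 0" "\<And>x. x \<in> cball s 1 \<Longrightarrow> (\<Sum>i\<in>UNIV. \<bar>eval_mpoly (g i) x\<bar>) < C"
    by (rule compact_bounded_above[OF comp, of "\<lambda>x. \<Sum>i\<in>UNIV. \<bar>eval_mpoly (g i) x\<bar>"])
       (auto intro!: continuous_on_sum continuous_on_rabs continuous_on_eval)
  obtain D where D: "D > 0" "\<And>x. x \<in> cball s 1 \<Longrightarrow> \<bar>eval_mpoly y x\<bar> < D"
    by (rule compact_bounded_above[OF comp, of "\<lambda>x. \<bar>eval_mpoly y x\<bar>"])
       (auto intro!: continuous_on_rabs continuous_on_eval)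
  have bound: "\<bar>eval_mpoly (p\<^sup>2 * y) x\<bar> \<le> (C\<^sup>2 * D) * (norm (x - s))\<^sup>2" if x: "x \<in> cball s 1" for x
  proof -
    have "\<bar>eval_mpoly p x\<bar> \<le> (\<Sum>i\<in>UNIV. \<bar>(x $ i - s $ i) * eval_mpoly (g i) x\<bar>)"
      unfolding p by (rule sum_abs)
    also have "\<dots> \<le> (\<Sum>i\<in>UNIV. norm (x - s) * \<bar>eval_mpoly (g i) x\<bar>)"
      using component_le_norm_cart[of "x - s"] by (intro sum_mono) (auto simp: abs_mult intro!: mult_right_mono)
    also have "\<dots> = norm (x - s) * (\<Sum>i\<in>UNIV. \<bar>eval_mpoly (g i) x\<bar>)" by (simp add: sum_distrib_left)
    also have "\<dots> \<le> norm (x - s) * C" using C(2)[OF x] by (intro mult_left_mono) auto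
    finally have "\<bar>eval_mpoly p x\<bar>\<^sup>2 \<le> (norm (x - s) * C)\<^sup>2" by (intro power_mono) auto
    then have "\<bar>eval_mpoly p x\<bar>\<^sup>2 * \<bar>eval_mpoly y x\<bar> \<le> (norm (x - s) * C)\<^sup>2 * D"
      using D(2)[OF x] by (intro mult_mono) auto
    then show ?thesis by (simp add: abs_mult power_mult_distrib mult_ac)
  qed
  have "\<forall>\<^sub>F x in nhds s. x \<in> ball s 1" by (rule eventually_nhds_in_open) auto
  then have "\<forall>\<^sub>F x in nhds s. \<bar>eval_mpoly (p\<^sup>2 * y) x\<bar> \<le> (C\<^sup>2 * D) * (norm (x - s))\<^sup>2"
    by (rule eventually_mono) (intro bound, simp)
  then show ?thesis unfolding quadratic_order_def by blast
qed

text \<open>Near S1 the quadratic growth of aG dominates \<delta>z. Elsewhere \<delta>z can only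
  harm where z \<le> 0, and on that compact set aG is bounded below by a positive constant, because
  z > 0 at the zeros in S - S1. This serves both to remove zeros and, with S1 = S, to subtract
  squares that vanish on S.\<close>

lemma nondegenerate_perturb:
  fixes G :: "'n::finite mpoly"
  assumes nd: "nondegenerate \<rho> G S" and S1: "S1 \<subseteq> S"
    and a: "\<And>x. x \<in> cube \<rho> \<Longrightarrow> eval_mpoly a x > 0"
    and zpos: "\<And>s. s \<in> S - S1 \<Longrightarrow> eval_mpoly z s > 0"
    and zquad: "\<And>s. s \<in> S1 \<Longrightarrow> quadratic_order z s"
  shows "\<forall>\<^sub>F \<delta> in at_right 0. nondegenerate \<rho> (a * G + Const \<delta> * z) S1"
proof -
  have fin: "finite S1" using nd S1 finite_subset by (auto simp: nondegenerate_def)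
  obtain \<eta> where eta: "\<eta> > 0" "\<And>x. x \<in> cube \<rho> \<Longrightarrow> eval_mpoly a x \<ge> \<eta>"
    using compact_pos_bounded_below[OF compact_cube continuous_on_eval a] by blast
  have "\<exists>e C V. e > 0 \<and> C > 0 \<and> open V \<and> s \<in> V \<and> V \<subseteq> cube \<rho> \<and>
      (\<forall>x\<in>V. eval_mpoly (a * G) x \<ge> e * (norm (x - s))\<^sup>2 \<and> \<bar>eval_mpoly z x\<bar> \<le> C * (norm (x - s))\<^sup>2)"
    if s: "s \<in> S1" for s
  proof -
    obtain e where e: "e > 0" "\<forall>\<^sub>F x in nhds s. eval_mpoly G x \<ge> e * (norm (x - s))\<^sup>2"
      and int: "s \<in> interior (cube \<rho>)"
      using nd s S1 unfolding nondegenerate_def by blast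
    obtain C where C: "\<forall>\<^sub>F x in nhds s. \<bar>eval_mpoly z x\<bar> \<le> C * (norm (x - s))\<^sup>2"
      using zquad[OF s] by (auto simp: quadratic_order_def)
    have "\<forall>\<^sub>F x in nhds s. x \<in> interior (cube \<rho>)"
      by (rule eventually_nhds_in_open[OF open_interior int])
    with e(2) C have "\<forall>\<^sub>F x in nhds s. x \<in> cube \<rho> \<and> eval_mpoly (a * G) x \<ge> (\<eta> * e) * (norm (x - s))\<^sup>2
        \<and> \<bar>eval_mpoly z x\<bar> \<le> (\<bar>C\<bar> + 1) * (norm (x - s))\<^sup>2"
    proof eventually_elim
      case (elim x)
      have x: "x \<in> cube \<rho>" using elim interior_subset by blast
      have "eval_mpoly a x * eval_mpoly G x \<ge> \<eta> * (e * (norm (x - s))\<^sup>2)"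
        using eta x elim e by (intro mult_mono) (auto intro: order_trans[of 0 \<eta>] simp: less_imp_le)
      moreover have "C * (norm (x - s))\<^sup>2 \<le> (\<bar>C\<bar> + 1) * (norm (x - s))\<^sup>2"
        by (intro mult_right_mono) auto
      ultimately show ?case using x elim by (auto simp: mult.assoc)
    qed
    then obtain V where "open V" "s \<in> V" "\<forall>x\<in>V. x \<in> cube \<rho> \<and> eval_mpoly (a * G) x \<ge> (\<eta> * e) * (norm (x - s))\<^sup>2
        \<and> \<bar>eval_mpoly z x\<bar> \<le> (\<bar>C\<bar> + 1) * (norm (x - s))\<^sup>2"
      unfolding eventually_nhds by blast
    then show ?thesis using eta e by (intro exI[of _ "\<eta> * e"] exI[of _ "\<bar>C\<bar> + 1"] exI[of _ V]) auto
  qed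
  then obtain e C V where eCV: "\<And>s. s \<in> S1 \<Longrightarrow> e s > 0 \<and> C s > 0 \<and> open (V s) \<and> s \<in> V s \<and> V s \<subseteq> cube \<rho> \<and>
      (\<forall>x\<in>V s. eval_mpoly (a * G) x \<ge> e s * (norm (x - s))\<^sup>2 \<and> \<bar>eval_mpoly z x\<bar> \<le> C s * (norm (x - s))\<^sup>2)"
    by metis
  define Z where "Z = (cube \<rho> - (\<Union>s\<in>S1. V s)) \<inter> {x. eval_mpoly z x \<le> 0}"
  have "compact Z" unfolding Z_def
    by (intro compact_Int_closed compact_diff compact_cube closed_Collect_le continuous_on_eval continuous_on_const)
      (use eCV in auto)
  have aG: "eval_mpoly (a * G) x \<ge> 0" if "x \<in> cube \<rho>" for x
    using a[OF that] nondegenerate_nonneg[OF nd that] by simp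
  have "eval_mpoly (a * G) x > 0" if x: "x \<in> Z" for x
  proof -
    have "x \<notin> S1" using x eCV by (auto simp: Z_def)
    moreover have "x \<notin> S - S1" using x zpos by (force simp: Z_def)
    ultimately have "eval_mpoly G x > 0" using x nd by (auto simp: Z_def nondegenerate_def)
    then show ?thesis using a x by (auto simp: Z_def)
  qed
  then obtain \<mu> where mu: "\<mu> > 0" "\<And>x. x \<in> Z \<Longrightarrow> eval_mpoly (a * G) x \<ge> \<mu>"
    using compact_pos_bounded_below[OF \<open>compact Z\<close> continuous_on_eval] by blast
  obtain M where M: "M > 0" "\<And>x. x \<in> Z \<Longrightarrow> \<bar>eval_mpoly z x\<bar> < M"
    by (rule compact_bounded_above[OF \<open>compact Z\<close>, of "\<lambda>x. \<bar>eval_mpoly z x\<bar>"])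
       (auto intro!: continuous_on_rabs continuous_on_eval)
  have "\<forall>\<^sub>F \<delta> in at_right 0. \<delta> < \<mu> / M"
    using mu M by (intro order_tendstoD tendsto_ident_at) auto
  moreover have "\<forall>\<^sub>F \<delta> in at_right 0. \<forall>s\<in>S1. \<delta> < e s / C s"
    using eCV by (intro eventually_ball_finite fin ballI order_tendstoD tendsto_ident_at) auto
  moreover have "\<forall>\<^sub>F \<delta> in at_right 0. \<delta> > (0::real)" by (rule eventually_at_right_less)
  ultimately show ?thesis
  proof eventually_elim
    case (elim \<delta>)
    let ?H = "a * G + Const \<delta> * z"
    have near: "eval_mpoly ?H x \<ge> (e s - \<delta> * C s) * (norm (x - s))\<^sup>2" if "s \<in> S1" "x \<in> V s" for s x
    proof -
      have "\<bar>eval_mpoly z x\<bar> \<le> C s * (norm (x - s))\<^sup>2" using eCV that by blast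
      then have "\<delta> * \<bar>eval_mpoly z x\<bar> \<le> \<delta> * (C s * (norm (x - s))\<^sup>2)"
        using elim by (intro mult_left_mono) auto
      moreover have "\<bar>\<delta> * eval_mpoly z x\<bar> = \<delta> * \<bar>eval_mpoly z x\<bar>" using elim by (simp add: abs_mult)
      moreover have "eval_mpoly (a * G) x \<ge> e s * (norm (x - s))\<^sup>2" using eCV that by blast
      ultimately show ?thesis unfolding eval_add eval_Const_mult
          left_diff_distrib mult.assoc by linarith
    qed
    have e': "e s - \<delta> * C s > 0" if "s \<in> S1" for s
      using elim that eCV[OF that] pos_less_divide_eq[of "C s" \<delta> "e s"] by auto
    have "eval_mpoly ?H x > 0" if x: "x \<in> cube \<rho> - S1" for x
    proof (cases "\<exists>s\<in>S1. x \<in> V s")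
      case True
      then obtain s where s: "s \<in> S1" "x \<in> V s" by blast
      then have "(e s - \<delta> * C s) * (norm (x - s))\<^sup>2 > 0"
        using x s by (intro mult_pos_pos e') auto
      then show ?thesis using near[OF s] by linarith
    next
      case False
      show ?thesis
      proof (cases "eval_mpoly z x \<le> 0")
        case True
        then have xZ: "x \<in> Z" using False x by (auto simp: Z_def)
        have "\<delta> * \<bar>eval_mpoly z x\<bar> \<le> \<delta> * M" using elim M(2)[OF xZ] by (intro mult_left_mono) auto
        also have "\<dots> < \<mu>" using elim M by (simp add: pos_less_divide_eq)
        finally have "\<bar>\<delta> * eval_mpoly z x\<bar> < \<mu>" using elim by (simp add: abs_mult)
        then show ?thesis using mu(2)[OF xZ] unfolding eval_add eval_Const_mult by linarith
      next
        case False
        then have "\<delta> * eval_mpoly z x > 0" using elim by simp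
        then show ?thesis using aG[of x] x unfolding eval_add eval_Const_mult by auto
      qed
    qed
    moreover have "\<exists>\<epsilon>>0. \<forall>\<^sub>F x in nhds s. eval_mpoly ?H x \<ge> \<epsilon> * (norm (x - s))\<^sup>2" if s: "s \<in> S1" for s
      using e'[OF s] near[OF s] eCV[OF s] unfolding eventually_nhds by blast
    moreover have "s \<in> interior (cube \<rho>)" "eval_mpoly ?H s = 0" if s: "s \<in> S1" for s
    proof -
      have "\<bar>eval_mpoly z s\<bar> \<le> 0" using eCV[OF s] by force
      then show "s \<in> interior (cube \<rho>)" "eval_mpoly ?H s = 0" using nd s S1 by (auto simp: nondegenerate_def)
    qed
    ultimately show ?case using fin unfolding nondegenerate_def by blast
  qed
qed

context cube_preordering
begin

text \<open>The zeros are separated by a partition \<open>\<Sum> K\<^sub>w\<^sup>2 a\<^sub>w = 1\<close> with positive \<open>a\<^sub>w\<close>, where \<open>K (Some s)\<close> is the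
  Lagrange polynomial of \<open>s\<close>.  Adding \<open>\<delta> z\<^sub>w\<close> with \<open>\<Sum> K\<^sub>w\<^sup>2 z\<^sub>w = 0\<close> removes from each summand
  all zeros but one.\<close>

theorem nondegenerate_in_T:
  assumes nd: "nondegenerate \<rho> G S"
  shows "G \<in> T"
proof -
  have fin: "finite S" using nd by (simp add: nondegenerate_def)
  obtain L where L: "\<And>s t. s \<in> S \<Longrightarrow> t \<in> S \<Longrightarrow> eval_mpoly (L s) t = (if s = t then 1 else 0)"
    using lagrange_basis[OF fin] by blast
  \<comment> \<open>The index \<open>None\<close> carries 1 minus the sum of the Lagrange
    polynomials, which completes the partition and vanishes on S.\<close>
  define A where "A = insert None (Some ` S)"
  have finA: "finite A" using fin by (simp add: A_def)
  define K where "K w = (case w of None \<Rightarrow> 1 - sum L S | Some s \<Rightarrow> L s)" for w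
  have sumA: "(\<Sum>w\<in>A. q w) = q None + (\<Sum>s\<in>S. q (Some s))" for q :: "_ \<Rightarrow> 'n mpoly"
    using fin by (simp add: A_def sum.reindex)
  have "(\<Sum>w\<in>A. K w * 1) + 0 = 1" by (simp add: sumA K_def)
  from squares_generate_unit_ideal[OF finA this]
  obtain v r where "(\<Sum>w\<in>A. (K w)\<^sup>2 * v w) + 0 * r = 1"
    by (elim exE)
  then have v: "1 = (\<Sum>w\<in>A. (K w)\<^sup>2 * v w)" by simp
  \<comment> \<open>The polynomial 1 has no zeros, so the weights v may be replaced by weights
    positive on the whole cube.\<close>
  obtain a where a: "1 = (\<Sum>w\<in>A. (K w)\<^sup>2 * a w)" "\<And>x w. x \<in> cube \<rho> \<Longrightarrow> w \<in> A \<Longrightarrow> eval_mpoly (a w) x > 0"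
    by (rule weighted_squares_positive[OF finA v]) (simp, simp, rule that)
  \<comment> \<open>This is |x - s|^2 - |x - t|^2, an affine function because the squares of x
    cancel: antisymmetric in s and t, and positive at t if s \<noteq> t.\<close>
  define ell where "ell s t = (\<Sum>i\<in>UNIV. Const (2 * (t - s) $ i) * Var i) + Const (s \<bullet> s - t \<bullet> t)"
    for s t :: "real ^ 'n"
  have ell_antisym: "ell s t = - ell t s" for s t
  proof -
    have "Const (2 * (s - t) $ i) = - (Const (2 * (t - s) $ i) :: 'n mpoly)" for i
      by (simp flip: Const_uminus)
    moreover have "Const (t \<bullet> t - s \<bullet> s) = - (Const (s \<bullet> s - t \<bullet> t) :: 'n mpoly)"
      by (simp flip: Const_uminus)
    ultimately show ?thesis unfolding ell_def by (simp add: sum_negf)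
  qed
  \<comment> \<open>Antisymmetry makes the double sum of \<open>(K w)^2 (K w')^2 y w w'\<close>
    vanish, while \<open>y w (Some t)\<close> is positive at t whenever
    \<open>w \<noteq> Some t\<close>; this lifts the foreign zeros from summand w.\<close>
  define y where "y w w' = (case (w, w') of (Some s, Some t) \<Rightarrow> ell s t
     | (None, Some t) \<Rightarrow> 1 | (Some s, None) \<Rightarrow> - 1 | (None, None) \<Rightarrow> 0)" for w w' :: "(real ^ 'n) option"
  have antisym: "y w w' = - y w' w" for w w'
  proof (cases w)
    case s: (Some s)
    show ?thesis
    proof (cases w')
      case (Some t)
      show ?thesis unfolding y_def s Some prod.case option.case by (rule ell_antisym)
    qed (simp add: y_def s)
  qed (auto simp: y_def split: option.split)
  define z where "z w = (\<Sum>w'\<in>A. (K w')\<^sup>2 * y w w')" for w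
  have zsum: "(\<Sum>w\<in>A. (K w)\<^sup>2 * z w) = 0"
  proof -
    have "(\<Sum>w\<in>A. (K w)\<^sup>2 * z w) = (\<Sum>w\<in>A. \<Sum>w'\<in>A. (K w)\<^sup>2 * ((K w')\<^sup>2 * y w w'))"
      by (simp add: z_def sum_distrib_left)
    also have "\<dots> = (\<Sum>w'\<in>A. \<Sum>w\<in>A. (K w)\<^sup>2 * ((K w')\<^sup>2 * y w w'))" by (rule sum.swap)
    also have "\<dots> = (\<Sum>w'\<in>A. \<Sum>w\<in>A. - ((K w')\<^sup>2 * ((K w)\<^sup>2 * y w' w)))"
      by (intro sum.cong refl) (subst antisym, simp add: mult_ac)
    also have "\<dots> = - (\<Sum>w\<in>A. (K w)\<^sup>2 * z w)" by (simp add: z_def sum_distrib_left sum_negf)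
    finally have "(\<Sum>w\<in>A. (K w)\<^sup>2 * z w) + (\<Sum>w\<in>A. (K w)\<^sup>2 * z w) = 0" by (simp only: eq_neg_iff_add_eq_0)
    then have "Const (1/2) * ((\<Sum>w\<in>A. (K w)\<^sup>2 * z w) + (\<Sum>w\<in>A. (K w)\<^sup>2 * z w)) = 0" by (simp only: mult_zero_right)
    moreover have "Const (1/2) * (q + q) = (q :: 'n mpoly)" for q
      by (simp only: distrib_left distrib_right[symmetric] Const_add[symmetric]) simp
    ultimately show ?thesis by (simp only:)
  qed
  have K0: "eval_mpoly (K w) s = (if w = Some s then 1 else 0)" if "w \<in> A" "s \<in> S" for w s
    using that L fin by (auto simp: A_def K_def split: if_splits)
  have z_eval: "eval_mpoly (z w) s = eval_mpoly (y w (Some s)) s" if "s \<in> S" for w s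
  proof -
    have "eval_mpoly (z w) s = (\<Sum>w'\<in>A. if w' = Some s then eval_mpoly (y w w') s else 0)"
      unfolding z_def eval_sum by (rule sum.cong) (use K0 that in auto)
    then show ?thesis using that finA by (simp add: A_def)
  qed
  have y_pos: "eval_mpoly (y w (Some t)) t > 0" if "w \<noteq> Some t" for w t
  proof (cases w)
    case (Some s)
    then have "s \<noteq> t" using that by auto
    have "(\<Sum>i\<in>UNIV. 2 * (t - s) $ i * t $ i) = 2 * ((t - s) \<bullet> t)"
      by (simp add: inner_vec_def sum_distrib_left algebra_simps)
    then have "eval_mpoly (y w (Some t)) t = 2 * ((t - s) \<bullet> t) + (s \<bullet> s - t \<bullet> t)"
      by (simp add: y_def ell_def Some)
    also have "\<dots> = (t - s) \<bullet> (t - s)"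
      by (simp add: inner_diff_left inner_diff_right inner_commute)
    finally show ?thesis using \<open>s \<noteq> t\<close> by simp
  qed (simp add: y_def)
  have self: "y w w = 0" for w by (cases w) (auto simp: y_def ell_def)
  define S1 where "S1 w = (case w of None \<Rightarrow> {} | Some s \<Rightarrow> {s})" for w :: "(real ^ 'n) option"
  have "\<forall>\<^sub>F \<delta> in at_right 0. \<forall>w\<in>A. nondegenerate \<rho> (a w * G + Const \<delta> * z w) (S1 w)"
  proof (intro eventually_ball_finite finA ballI nondegenerate_perturb[OF nd])
    fix w assume w: "w \<in> A"
    show "S1 w \<subseteq> S" using w by (auto simp: S1_def A_def)
    show "eval_mpoly (a w) x > 0" if "x \<in> cube \<rho>" for x using a(2) w that by blast
    show "eval_mpoly (z w) s > 0" if "s \<in> S - S1 w" for s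
      using that by (subst z_eval) (auto simp: S1_def intro!: y_pos)
    fix s assume "s \<in> S1 w"
    then have ws: "w = Some s" by (auto simp: S1_def split: option.splits)
    then have s: "s \<in> S" using w by (auto simp: A_def)
    \<comment> \<open>The diagonal term \<open>y w w\<close> is 0, and every other term contains the
      square of some \<open>K w'\<close> that vanishes at s.\<close>
    show "quadratic_order (z w) s" unfolding z_def
    proof (rule quadratic_order_sum)
      fix w' assume w': "w' \<in> A"
      show "quadratic_order ((K w')\<^sup>2 * y w w') s"
      proof (cases "w' = w")
        case True
        then show ?thesis by (auto simp: self quadratic_order_def intro!: exI[of _ 0])
      next
        case False
        then show ?thesis using K0[OF w' s] ws by (intro vanishing_square_quadratic_order) auto
      qed
    qed
  qed
  then obtain \<delta> where d: "\<And>w. w \<in> A \<Longrightarrow> nondegenerate \<rho> (a w * G + Const \<delta> * z w) (S1 w)"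
    using eventually_happens'[OF trivial_limit_at_right_real] by blast
  have "a w * G + Const \<delta> * z w \<in> T" if w: "w \<in> A" for w
  proof (cases w)
    \<comment> \<open>This summand has lost all zeros, so strict positivity on the cube
      applies.\<close>
    case None
    then show ?thesis using d[OF w] by (intro pos_on_cube_in_T) (auto simp: nondegenerate_def S1_def)
  next
    case (Some s)
    then show ?thesis using d[OF w] by (intro nondegenerate_single_in_T[of _ s]) (auto simp: S1_def)
  qed
  then have "(\<Sum>w\<in>A. (K w)\<^sup>2 * (a w * G + Const \<delta> * z w)) \<in> T"
    by (intro T_sum T_mult T_square)
  also have "(\<Sum>w\<in>A. (K w)\<^sup>2 * (a w * G + Const \<delta> * z w)) =
      (\<Sum>w\<in>A. (K w)\<^sup>2 * a w) * G + Const \<delta> * (\<Sum>w\<in>A. (K w)\<^sup>2 * z w)"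
    by (simp only: sum_distrib_left sum_distrib_right sum.distrib distrib_left mult_ac)
  also have "\<dots> = G" by (simp only: zsum a(1)[symmetric]) simp
  finally show ?thesis .
qed

end

section \<open>Gradients and Hessians of polynomials\<close>

lemma GDERIV_unique:
  assumes "GDERIV F x :> a" "GDERIV F x :> b"
  shows "a = b"
proof -
  have "(\<lambda>h. inner h a) = (\<lambda>h. inner h b)"
    using assms unfolding gderiv_def by (rule has_derivative_unique)
  then have "inner (a - b) a = inner (a - b) b" by meson
  then have "inner (a - b) (a - b) = 0" by (simp add: inner_diff_right)
  then show ?thesis by simp
qed

lemma gradient_eqI: "GDERIV F x :> D \<Longrightarrow> gradient F x = D"
  unfolding gradient_def using GDERIV_unique by blast

lemma eval_GDERIV_ex:
  fixes p :: "'n::finite mpoly"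
  shows "\<exists>g. \<forall>x. GDERIV (eval_mpoly p) x :> (\<chi> i. eval_mpoly (g i) x)"
proof (induction p rule: mpoly_induct)
  case (Const a)
  have "GDERIV (\<lambda>x. a) x :> (0 :: real ^ 'n)" for x by (rule GDERIV_const)
  moreover have "eval_mpoly (Const a) = (\<lambda>x :: real ^ 'n. a)" by auto
  moreover have "(\<chi> i. eval_mpoly (0 :: 'n mpoly) x) = (0 :: real ^ 'n)" for x
    by (simp add: Finite_Cartesian_Product.vec_eq_iff)
  ultimately show ?case by (intro exI[of _ "\<lambda>_. 0"]) simp
next
  case (Var i)
  have "((\<lambda>x :: real ^ 'n. x $ i) has_derivative (\<lambda>h. h $ i)) (at x)" for x
    by (rule bounded_linear_imp_has_derivative[OF bounded_linear_vec_nth])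
  moreover have "h $ i = inner h (axis i 1)" for h :: "real ^ 'n" by (simp add: inner_axis)
  ultimately have "GDERIV (\<lambda>x :: real ^ 'n. x $ i) x :> axis i 1" for x by (simp add: gderiv_def)
  moreover have "eval_mpoly (Var i) = (\<lambda>x :: real ^ 'n. x $ i)" by auto
  moreover have "(\<chi> j. eval_mpoly (if j = i then 1 else 0 :: 'n mpoly) x) = axis i 1" for x
    by (auto simp: Finite_Cartesian_Product.vec_eq_iff axis_def)
  ultimately show ?case by (intro exI[of _ "\<lambda>j. if j = i then 1 else 0"]) simp
next
  case (add p q)
  then obtain g h where "\<And>x. GDERIV (eval_mpoly p) x :> (\<chi> i. eval_mpoly (g i) x)"
    "\<And>x. GDERIV (eval_mpoly q) x :> (\<chi> i. eval_mpoly (h i) x)" by blast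
  then have "GDERIV (\<lambda>x. eval_mpoly p x + eval_mpoly q x) x :>
      (\<chi> i. eval_mpoly (g i) x) + (\<chi> i. eval_mpoly (h i) x)" for x
    by (intro GDERIV_add)
  moreover have "eval_mpoly (p + q) = (\<lambda>x. eval_mpoly p x + eval_mpoly q x)" by auto
  moreover have "(\<chi> i. eval_mpoly (g i) x) + (\<chi> i. eval_mpoly (h i) x) = (\<chi> i. eval_mpoly (g i + h i) x)" for x
    by (simp add: Finite_Cartesian_Product.vec_eq_iff)
  ultimately show ?case by (intro exI[of _ "\<lambda>i. g i + h i"]) simp
next
  case (mult p q)
  then obtain g h where "\<And>x. GDERIV (eval_mpoly p) x :> (\<chi> i. eval_mpoly (g i) x)"
    "\<And>x. GDERIV (eval_mpoly q) x :> (\<chi> i. eval_mpoly (h i) x)" by blast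
  then have "GDERIV (\<lambda>x. eval_mpoly p x * eval_mpoly q x) x :>
      eval_mpoly p x *\<^sub>R (\<chi> i. eval_mpoly (h i) x) + eval_mpoly q x *\<^sub>R (\<chi> i. eval_mpoly (g i) x)" for x
    by (intro GDERIV_mult)
  moreover have "eval_mpoly (p * q) = (\<lambda>x. eval_mpoly p x * eval_mpoly q x)" by auto
  moreover have "eval_mpoly p x *\<^sub>R (\<chi> i. eval_mpoly (h i) x) + eval_mpoly q x *\<^sub>R (\<chi> i. eval_mpoly (g i) x)
      = (\<chi> i. eval_mpoly (p * h i + q * g i) x)" for x
    by (simp add: Finite_Cartesian_Product.vec_eq_iff)
  ultimately show ?case by (intro exI[of _ "\<lambda>i. p * h i + q * g i"]) simp
qed

text \<open>A choice among the families provided by \<open>eval_GDERIV_ex\<close>; the analytic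
  gradient thereby has polynomial components that can be differentiated again.\<close>

definition partial :: "'n::finite mpoly \<Rightarrow> 'n \<Rightarrow> 'n mpoly" where
  "partial p = (SOME g. \<forall>x. GDERIV (eval_mpoly p) x :> (\<chi> i. eval_mpoly (g i) x))"

lemma GDERIV_eval: "GDERIV (eval_mpoly p) x :> (\<chi> i. eval_mpoly (partial p i) x)"
  unfolding partial_def using someI_ex[OF eval_GDERIV_ex[of p]] by blast

lemma gradient_eval: "gradient (eval_mpoly p) x = (\<chi> i. eval_mpoly (partial p i) x)"
  by (rule gradient_eqI[OF GDERIV_eval])

lemma GDERIV_eval_gradient: "GDERIV (eval_mpoly p) x :> gradient (eval_mpoly p) x"
  unfolding gradient_eval by (rule GDERIV_eval)

text \<open>The chain rule along a line, stated as an identity of polynomials so that its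
  coefficients can be compared and it can be used twice to reach the Hessian.\<close>

lemma pderiv_line: "pderiv (line s v p) = (\<Sum>i\<in>UNIV. smult (v $ i) (line s v (partial p i)))"
proof -
  have "poly (pderiv (line s v p)) t = poly (\<Sum>i\<in>UNIV. smult (v $ i) (line s v (partial p i))) t" for t
  proof -
    have d: "((\<lambda>t. s + t *\<^sub>R v) has_derivative (\<lambda>h. h *\<^sub>R v)) (at t)"
      by (auto intro!: derivative_eq_intros)
    have g: "(eval_mpoly p has_derivative (\<lambda>h. inner h (gradient (eval_mpoly p) (s + t *\<^sub>R v)))) (at (s + t *\<^sub>R v))"
      using GDERIV_eval_gradient by (simp add: gderiv_def)
    have "((\<lambda>t. eval_mpoly p (s + t *\<^sub>R v)) has_derivative
        (\<lambda>h. inner (h *\<^sub>R v) (gradient (eval_mpoly p) (s + t *\<^sub>R v)))) (at t)"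
      by (rule has_derivative_compose[OF d g])
    then have "(poly (line s v p) has_field_derivative inner v (gradient (eval_mpoly p) (s + t *\<^sub>R v))) (at t)"
      by (simp add: has_field_derivative_def poly_line[abs_def] mult_commute_abs)
    then have "poly (pderiv (line s v p)) t = inner v (gradient (eval_mpoly p) (s + t *\<^sub>R v))"
      using poly_DERIV DERIV_unique by blast
    then show ?thesis
      by (simp add: gradient_eval inner_vec_def poly_sum poly_line)
  qed
  then show ?thesis by (simp add: poly_eq_poly_eq_iff[symmetric] fun_eq_iff)
qed

lemma lin_eq_gradient: "lin p s v = v \<bullet> gradient (eval_mpoly p) s"
proof -
  have "lin p s v = coeff (pderiv (line s v p)) 0" by (simp add: lin_def coeff_pderiv)
  also have "\<dots> = v \<bullet> gradient (eval_mpoly p) s"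
    unfolding pderiv_line by (simp add: coeff_sum coeff_line_0 gradient_eval inner_vec_def)
  finally show ?thesis .
qed

text \<open>The factor 2 is that of the second Taylor coefficient. The Hessian is the Jacobian of
  the gradient map, so that map is first identified with a vector of polynomials and its derivative
  then computed componentwise.\<close>

lemma quad_eq_hessian: "2 * quad p s v = v \<bullet> (hessian (eval_mpoly p) s *v v)"
proof -
  have "2 * quad p s v = coeff (pderiv (line s v p)) 1"
    by (simp add: quad_def coeff_pderiv numeral_2_eq_2)
  also have "\<dots> = (\<Sum>i\<in>UNIV. v $ i * lin (partial p i) s v)"
    unfolding pderiv_line by (simp add: coeff_sum lin_def)
  finally have quad: "2 * quad p s v = (\<Sum>i\<in>UNIV. v $ i * lin (partial p i) s v)" .
  have "((\<lambda>x. \<chi> i. eval_mpoly (partial p i) x) has_derivative (\<lambda>h. \<chi> i. inner h (gradient (eval_mpoly (partial p i)) s))) (at s)"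
    by (rule has_derivative_componentwise_within[THEN iffD2])
      (use GDERIV_eval[unfolded gderiv_def] in \<open>auto simp: Basis_vec_def inner_axis gradient_eval\<close>)
  moreover have "gradient (eval_mpoly p) = (\<lambda>x. \<chi> i. eval_mpoly (partial p i) x)"
    by (rule ext) (rule gradient_eval)
  ultimately have d: "(gradient (eval_mpoly p) has_derivative (\<lambda>h. \<chi> i. inner h (gradient (eval_mpoly (partial p i)) s))) (at s)"
    by simp
  then have "gradient (eval_mpoly p) differentiable (at s)" unfolding differentiable_def by blast
  then have "(gradient (eval_mpoly p) has_derivative (\<lambda>h. hessian (eval_mpoly p) s *v h)) (at s)"
    unfolding hessian_def by (simp add: jacobian_works)
  then have "(\<lambda>h. hessian (eval_mpoly p) s *v h) = (\<lambda>h. \<chi> i. inner h (gradient (eval_mpoly (partial p i)) s))"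
    using d by (rule has_derivative_unique)
  then have "hessian (eval_mpoly p) s *v v = (\<chi> i. inner v (gradient (eval_mpoly (partial p i)) s))" by meson
  then show ?thesis by (simp add: quad inner_vec_def[of v] lin_eq_gradient)
qed

lemma continuous_on_lin [continuous_intros]: "continuous_on A (lin p s)"
  and continuous_on_quad [continuous_intros]: "continuous_on A (quad p s)"
proof -
  obtain g H where "\<And>v. lin p s v = (\<Sum>i\<in>UNIV. g i * v $ i)"
    and "\<And>v. quad p s v = (\<Sum>i\<in>UNIV. \<Sum>j\<in>UNIV. H i j * v $ i * v $ j)"
    by (rule expansion3[of p s]) (rule that; assumption)
  then have "lin p s = (\<lambda>v. \<Sum>i\<in>UNIV. g i * v $ i)" "quad p s = (\<lambda>v. \<Sum>i\<in>UNIV. \<Sum>j\<in>UNIV. H i j * v $ i * v $ j)"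
    by auto
  then show "continuous_on A (lin p s)" "continuous_on A (quad p s)"
    by (auto intro!: continuous_intros)
qed

text \<open>Converse to \<open>quadratic_growth_lin_quad\<close>: the cubic remainder is at most C
  |x - s|^3, which half of \<epsilon> absorbs once |x - s| is below 1 and \<epsilon> / (2C).\<close>

lemma quadratic_growthI:
  fixes G :: "'n::finite mpoly"
  assumes G0: "eval_mpoly G s = 0" and lin0: "\<And>v. lin G s v = 0"
    and q: "\<And>v. norm v = 1 \<Longrightarrow> quad G s v \<ge> \<epsilon>" and e: "\<epsilon> > 0"
  shows "\<forall>\<^sub>F x in nhds s. eval_mpoly G x \<ge> (\<epsilon> / 2) * (norm (x - s))\<^sup>2"
proof -
  obtain g H K where G: "G = Const (eval_mpoly G s) + (\<Sum>i\<in>UNIV. shifted s i * Const (g i))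
      + (\<Sum>i\<in>UNIV. \<Sum>j\<in>UNIV. shifted s i * shifted s j * Const (H i j))
      + (\<Sum>i\<in>UNIV. \<Sum>j\<in>UNIV. \<Sum>k\<in>UNIV. shifted s i * shifted s j * shifted s k * K i j k)"
    and lin: "\<And>v. lin G s v = (\<Sum>i\<in>UNIV. g i * v $ i)"
    and quad: "\<And>v. quad G s v = (\<Sum>i\<in>UNIV. \<Sum>j\<in>UNIV. H i j * v $ i * v $ j)"
    by (rule expansion3[of G s]) (rule that; assumption)
  define R where "R x = (\<Sum>i\<in>UNIV. \<Sum>j\<in>UNIV. \<Sum>k\<in>UNIV. (x $ i - s $ i) * (x $ j - s $ j) * (x $ k - s $ k) * eval_mpoly (K i j k) x)" for x
  have "eval_mpoly G x = eval_mpoly G s + lin G s (x - s) + quad G s (x - s) + R x" for x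
    unfolding lin quad R_def by (subst arg_cong[OF G, of "\<lambda>q. eval_mpoly q x"]) (simp add: mult_ac)
  then have ev: "eval_mpoly G x = quad G s (x - s) + R x" for x by (simp add: G0 lin0)
  have quad_low: "quad G s v \<ge> \<epsilon> * (norm v)\<^sup>2" for v
  proof (cases "v = 0")
    case False
    have "quad G s (r *\<^sub>R v) = r\<^sup>2 * quad G s v" for r
      by (simp add: quad sum_distrib_left power2_eq_square mult_ac)
    from this[of "1 / norm v"] q[of "(1 / norm v) *\<^sub>R v"] False
    have "(1 / norm v)\<^sup>2 * quad G s v \<ge> \<epsilon>" by simp
    then show ?thesis using False by (simp add: power_divide pos_le_divide_eq)
  qed (simp add: quad)
  have comp: "compact (cball s 1)" by simp
  obtain C where C: "C > 0" "\<And>x. x \<in> cball s 1 \<Longrightarrow> (\<Sum>i\<in>UNIV. \<Sum>j\<in>UNIV. \<Sum>k\<in>UNIV. \<bar>eval_mpoly (K i j k) x\<bar>) < C"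
    by (rule compact_bounded_above[OF comp, of "\<lambda>x. \<Sum>i\<in>UNIV. \<Sum>j\<in>UNIV. \<Sum>k\<in>UNIV. \<bar>eval_mpoly (K i j k) x\<bar>"])
       (auto intro!: continuous_on_sum continuous_on_rabs continuous_on_eval)
  have R: "\<bar>R x\<bar> \<le> norm (x - s) ^ 3 * C" if x: "x \<in> cball s 1" for x
  proof -
    have c: "\<bar>x $ i - s $ i\<bar> \<le> norm (x - s)" for i using component_le_norm_cart[of "x - s" i] by simp
    have "\<bar>R x\<bar> \<le> (\<Sum>i\<in>UNIV. \<Sum>j\<in>UNIV. \<Sum>k\<in>UNIV. \<bar>(x $ i - s $ i) * (x $ j - s $ j) * (x $ k - s $ k) * eval_mpoly (K i j k) x\<bar>)"
      unfolding R_def by (intro order_trans[OF sum_abs] sum_mono order_refl)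
    also have "\<dots> \<le> (\<Sum>i\<in>UNIV. \<Sum>j\<in>UNIV. \<Sum>k\<in>UNIV. norm (x - s) ^ 3 * \<bar>eval_mpoly (K i j k) x\<bar>)"
      unfolding abs_mult power3_eq_cube
      by (intro sum_mono mult_right_mono mult_mono c) auto
    also have "\<dots> = norm (x - s) ^ 3 * (\<Sum>i\<in>UNIV. \<Sum>j\<in>UNIV. \<Sum>k\<in>UNIV. \<bar>eval_mpoly (K i j k) x\<bar>)"
      by (simp add: sum_distrib_left)
    also have "\<dots> \<le> norm (x - s) ^ 3 * C" using C(2)[OF x] by (intro mult_left_mono) auto
    finally show ?thesis .
  qed
  have "\<forall>\<^sub>F x in nhds s. x \<in> ball s (min 1 (\<epsilon> / (2 * C)))"
    by (rule eventually_nhds_in_open) (use e C in auto)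
  then show ?thesis
  proof (rule eventually_mono)
    fix x assume "x \<in> ball s (min 1 (\<epsilon> / (2 * C)))"
    then have x: "x \<in> cball s 1" "norm (x - s) < \<epsilon> / (2 * C)"
      by (auto simp: dist_norm norm_minus_commute)
    have "norm (x - s) * C \<le> \<epsilon> / 2" using x(2) C(1) by (simp add: field_simps)
    then have "(norm (x - s))\<^sup>2 * (norm (x - s) * C) \<le> (norm (x - s))\<^sup>2 * (\<epsilon> / 2)"
      by (intro mult_left_mono) auto
    then have "\<bar>R x\<bar> \<le> (\<epsilon> / 2) * (norm (x - s))\<^sup>2"
      using R[OF x(1)] by (simp add: power3_eq_cube power2_eq_square mult_ac)
    then show "eval_mpoly G x \<ge> (\<epsilon> / 2) * (norm (x - s))\<^sup>2"
      using quad_low[of "x - s"] ev[of x] by simp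
  qed
qed

text \<open>Growth with constant 0: s is a global minimum of A.\<close>

lemma nonneg_zero_lin_quad:
  assumes "\<And>x. eval_mpoly A x \<ge> 0" "eval_mpoly A s = 0"
  shows "lin A s v = 0" "quad A s v \<ge> 0"
  using quadratic_growth_lin_quad[of A s 0 v] assms by auto

section \<open>Penalised objective\<close>

text \<open>A Dini argument: at a limit point of counterexamples some \<open>q m\<close> is
  positive, hence positive far along the subsequence, and monotonicity carries this to the larger
  indices of the counterexamples.\<close>

lemma monotone_eventually_positive_on_compact:
  fixes q :: "nat \<Rightarrow> 'a::metric_space \<Rightarrow> real"
  assumes "compact Z" "\<And>m. continuous_on Z (q m)"
    and mono: "\<And>x m m'. x \<in> Z \<Longrightarrow> m \<le> m' \<Longrightarrow> q m x \<le> q m' x"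
    and ex: "\<And>x. x \<in> Z \<Longrightarrow> \<exists>m. q m x > 0"
  obtains m where "\<And>x. x \<in> Z \<Longrightarrow> q m x > 0"
proof (rule ccontr)
  assume "\<not> thesis"
  then have "\<forall>m. \<exists>x\<in>Z. q m x \<le> 0" using that by (meson not_le)
  then obtain y where y: "\<And>m. y m \<in> Z" "\<And>m. q m (y m) \<le> 0" by metis
  obtain l r where l: "l \<in> Z" "strict_mono r" "(y \<circ> r) \<longlonglongrightarrow> l"
    using assms(1) y(1) unfolding compact_eq_seq_compact_metric seq_compact_def by metis
  obtain m where m: "q m l > 0" using ex[OF l(1)] by blast
  have "(\<lambda>k. q m ((y \<circ> r) k)) \<longlonglongrightarrow> q m l"
    using continuous_on_tendsto_compose[OF assms(2) l(3) l(1)] y(1) by simp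
  moreover have "\<forall>\<^sub>F k in sequentially. q m ((y \<circ> r) k) \<le> 0"
  proof (rule eventually_sequentiallyI[of m])
    fix k assume "m \<le> k"
    then have "m \<le> r k" using seq_suble[OF l(2), of k] by simp
    then have "q m (y (r k)) \<le> q (r k) (y (r k))" by (rule mono[OF y(1)])
    then show "q m ((y \<circ> r) k) \<le> 0" using y(2)[of "r k"] by simp
  qed
  ultimately have "q m l \<le> 0" by (intro tendsto_upperbound) auto
  then show False using m by simp
qed

definition penalised ::
  "'n::finite mpoly \<Rightarrow> 'j set \<Rightarrow> 'j set \<Rightarrow> ('j \<Rightarrow> 'n mpoly) \<Rightarrow> ('j \<Rightarrow> 'n mpoly) \<Rightarrow> real \<Rightarrow> nat \<Rightarrow> 'n mpoly"
  where
  "penalised F E I c A \<gamma> m = F - (\<Sum>j\<in>I. c j * (A j * (1 - Const (1 / \<gamma>) * c j) ^ (2 * m)))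
    + (\<Sum>j\<in>E. Const (real m) * (c j * c j) - A j * c j)"

lemma eval_penalised: "eval_mpoly (penalised F E I c A \<gamma> m) x =
  eval_mpoly F x - (\<Sum>j\<in>I. eval_mpoly (c j) x * (eval_mpoly (A j) x * (1 - eval_mpoly (c j) x / \<gamma>) ^ (2 * m)))
    + (\<Sum>j\<in>E. real m * (eval_mpoly (c j) x * eval_mpoly (c j) x) - eval_mpoly (A j) x * eval_mpoly (c j) x)"
  by (simp add: penalised_def)

text \<open>For c \<ge> 0 the base lies in [0, 1] and its powers decrease; for c < 0 it exceeds 1,
  its powers increase, and the factor c reverses the order.\<close>

lemma penalty_power_antimono:
  fixes c \<gamma> :: real
  assumes "\<gamma> > 0" "c \<le> \<gamma>" "m \<le> m'"
  shows "c * (1 - c / \<gamma>) ^ (2 * m') \<le> c * (1 - c / \<gamma>) ^ (2 * m)"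
proof (cases "c \<ge> 0")
  case True
  then have "(1 - c / \<gamma>) ^ (2 * m') \<le> (1 - c / \<gamma>) ^ (2 * m)"
    using assms by (intro power_decreasing) auto
  then show ?thesis using True by (rule mult_left_mono)
next
  case False
  then have "1 \<le> 1 - c / \<gamma>" using assms by (simp add: divide_nonpos_pos)
  then have "(1 - c / \<gamma>) ^ (2 * m) \<le> (1 - c / \<gamma>) ^ (2 * m')"
    using assms by (intro power_increasing) auto
  then show ?thesis using False by (intro mult_left_mono_neg) auto
qed

lemma penalised_mono:
  assumes "\<gamma> > 0" "\<And>j. j \<in> I \<Longrightarrow> eval_mpoly (c j) x \<le> \<gamma>" "\<And>j. j \<in> I \<Longrightarrow> eval_mpoly (A j) x \<ge> 0" "m \<le> m'"
  shows "eval_mpoly (penalised F E I c A \<gamma> m) x \<le> eval_mpoly (penalised F E I c A \<gamma> m') x"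
proof -
  have "(\<Sum>j\<in>I. eval_mpoly (c j) x * (eval_mpoly (A j) x * (1 - eval_mpoly (c j) x / \<gamma>) ^ (2 * m')))
    \<le> (\<Sum>j\<in>I. eval_mpoly (c j) x * (eval_mpoly (A j) x * (1 - eval_mpoly (c j) x / \<gamma>) ^ (2 * m)))"
  proof (rule sum_mono)
    fix j assume j: "j \<in> I"
    have "eval_mpoly (A j) x * (eval_mpoly (c j) x * (1 - eval_mpoly (c j) x / \<gamma>) ^ (2 * m'))
      \<le> eval_mpoly (A j) x * (eval_mpoly (c j) x * (1 - eval_mpoly (c j) x / \<gamma>) ^ (2 * m))"
      by (intro mult_left_mono penalty_power_antimono assms j)
    then show "eval_mpoly (c j) x * (eval_mpoly (A j) x * (1 - eval_mpoly (c j) x / \<gamma>) ^ (2 * m'))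
      \<le> eval_mpoly (c j) x * (eval_mpoly (A j) x * (1 - eval_mpoly (c j) x / \<gamma>) ^ (2 * m))" by (simp add: mult_ac)
  qed
  moreover have "(\<Sum>j\<in>E. real m * (eval_mpoly (c j) x * eval_mpoly (c j) x) - eval_mpoly (A j) x * eval_mpoly (c j) x)
    \<le> (\<Sum>j\<in>E. real m' * (eval_mpoly (c j) x * eval_mpoly (c j) x) - eval_mpoly (A j) x * eval_mpoly (c j) x)"
    using assms(4) by (intro sum_mono diff_right_mono mult_right_mono) auto
  ultimately show ?thesis unfolding eval_penalised by linarith
qed

text \<open>The quadratic part of the penalised objective is \<open>base + m \<cdot> pos\<close> up to a term that tends to \<open>0\<close>;
  \<open>pos\<close> vanishes exactly on the tangent directions, by strict complementarity, and there
  \<open>base\<close> is the quadratic part of the Lagrangian.\<close>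

lemma penalised_growth:
  fixes F :: "'n::finite mpoly"
  assumes fin: "finite E" "finite I" and EI: "E \<inter> I = {}"
    and F0: "eval_mpoly F s = 0"
    and cE: "\<And>j. j \<in> E \<Longrightarrow> eval_mpoly (c j) s = 0"
    and cI: "\<And>j. j \<in> I \<Longrightarrow> eval_mpoly (c j) s \<ge> 0"
    and stat: "\<And>v. lin F s v = (\<Sum>j\<in>E \<union> I. \<mu> j * lin (c j) s v)"
    and comp: "\<And>j. j \<in> I \<Longrightarrow> \<mu> j \<ge> 0 \<and> \<mu> j * eval_mpoly (c j) s = 0 \<and> \<mu> j + eval_mpoly (c j) s > 0"
    and sosc: "\<And>v. v \<noteq> 0 \<Longrightarrow> (\<And>j. j \<in> E \<union> I \<Longrightarrow> eval_mpoly (c j) s = 0 \<Longrightarrow> lin (c j) s v = 0) \<Longrightarrow>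
        quad F s v - (\<Sum>j\<in>E \<union> I. \<mu> j * quad (c j) s v) > 0"
    and A: "\<And>j. j \<in> E \<union> I \<Longrightarrow> eval_mpoly (A j) s = \<mu> j"
    and Ann: "\<And>j x. j \<in> I \<Longrightarrow> eval_mpoly (A j) x \<ge> 0"
    and g: "\<gamma> > 0" "\<And>j. j \<in> I \<Longrightarrow> eval_mpoly (c j) s < \<gamma>"
  shows "eval_mpoly (penalised F E I c A \<gamma> m) s = 0"
    and "\<exists>m. \<exists>\<epsilon>>0. \<forall>\<^sub>F x in nhds s. eval_mpoly (penalised F E I c A \<gamma> m) x \<ge> \<epsilon> * (norm (x - s))\<^sup>2"
proof -
  let ?c = "\<lambda>j. eval_mpoly (c j) s"
  define Act where "Act = {j \<in> I. ?c j = 0}"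
  define Ina where "Ina = {j \<in> I. ?c j \<noteq> 0}"
  have I: "I = Act \<union> Ina" "Act \<inter> Ina = {}" "finite Act" "finite Ina"
    using fin by (auto simp: Act_def Ina_def)
  have mu0: "\<mu> j = 0" if "j \<in> Ina" for j using comp that by (force simp: Ina_def)
  have mupos: "\<mu> j > 0" if "j \<in> Act" for j using comp that by (force simp: Act_def)
  have act0: "?c j = 0" if "j \<in> Act" for j using that by (simp add: Act_def)
  have A0: "eval_mpoly (A j) s = 0" if "j \<in> Ina" for j using A mu0 that by (simp add: Ina_def)
  \<comment> \<open>At an inactive constraint \<open>A j\<close> vanishes at s and is nonnegative
    everywhere, so s is a minimum of it.\<close>
  have linA: "lin (A j) s v = 0" "quad (A j) s v \<ge> 0" if "j \<in> Ina" for j v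
    using nonneg_zero_lin_quad[OF Ann A0] that by (auto simp: Ina_def)
  show ev0: "eval_mpoly (penalised F E I c A \<gamma> m) s = 0" for m
  proof -
    have "(\<Sum>j\<in>I. ?c j * (eval_mpoly (A j) s * (1 - ?c j / \<gamma>) ^ (2 * m))) = 0"
      by (rule sum.neutral) (use comp A in auto)
    then show ?thesis unfolding eval_penalised by (simp add: F0 cE)
  qed
  define B where "B m j = (1 - Const (1 / \<gamma>) * c j) ^ (2 * m)" for m j
  have Bs: "eval_mpoly (B m j) s = 1" "lin (B m j) s v = - (2 * real m / \<gamma>) * lin (c j) s v" if "j \<in> Act" for m j v
  proof -
    show "eval_mpoly (B m j) s = 1" by (simp add: B_def act0[OF that])
    have "lin (1 - Const (1 / \<gamma>) * c j) s v = - (1 / \<gamma>) * lin (c j) s v"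
      using lin_Const[of 1 s v] by (simp add: lin_diff lin_mult)
    then show "lin (B m j) s v = - (2 * real m / \<gamma>) * lin (c j) s v"
      unfolding B_def by (subst lin_power) (auto simp: act0[OF that])
  qed
  have pen: "penalised F E I c A \<gamma> m = F - (\<Sum>j\<in>I. c j * (A j * B m j)) + (\<Sum>j\<in>E. Const (real m) * (c j * c j) - A j * c j)" for m
    by (simp add: penalised_def B_def)
  have sumI: "(\<Sum>j\<in>I. h j) = (\<Sum>j\<in>Act. h j) + (\<Sum>j\<in>Ina. h j)" for h :: "_ \<Rightarrow> real"
    by (subst I(1)) (rule sum.union_disjoint[OF I(3,4,2)])
  have sumEI: "(\<Sum>j\<in>E \<union> I. h j) = (\<Sum>j\<in>E. h j) + (\<Sum>j\<in>I. h j)" for h :: "_ \<Rightarrow> real"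
    by (rule sum.union_disjoint) (use fin EI in auto)
  have lin0: "lin (penalised F E I c A \<gamma> m) s v = 0" for m v
  proof -
    have "lin (c j * (A j * B m j)) s v = \<mu> j * lin (c j) s v" if "j \<in> I" for j
    proof (cases "j \<in> Act")
      case True
      then show ?thesis using that A Bs by (simp add: lin_mult act0)
    next
      case False
      then have "j \<in> Ina" using that I by auto
      then show ?thesis using that by (simp add: lin_mult A0 linA mu0)
    qed
    moreover have "lin (Const (real m) * (c j * c j) - A j * c j) s v = - (\<mu> j * lin (c j) s v)" if "j \<in> E" for j
      using that A by (simp add: lin_diff lin_mult cE)
    ultimately show ?thesis
      unfolding pen by (simp add: lin_add lin_diff lin_sum stat sumEI sum_negf)
  qed
  \<comment> \<open>The products of linear parts come from differentiating \<open>c j\<close> and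
    \<open>A j\<close> once each; they vanish on tangent directions.\<close>
  define base where "base v = quad F s v - (\<Sum>j\<in>E \<union> I. \<mu> j * quad (c j) s v)
    - (\<Sum>j\<in>Act. lin (c j) s v * lin (A j) s v) - (\<Sum>j\<in>E. lin (c j) s v * lin (A j) s v)" for v
  define pos where "pos v = (\<Sum>j\<in>Act. (2 * \<mu> j / \<gamma>) * (lin (c j) s v * lin (c j) s v))
    + (\<Sum>j\<in>E. lin (c j) s v * lin (c j) s v)" for v
  \<comment> \<open>The contribution of inactive constraints: \<open>c j\<close> is positive at s,
    so the curvature of \<open>A j\<close> enters with a minus sign, and the decay of the power in m
    has to remove it.\<close>
  define rem where "rem m v = (\<Sum>j\<in>Ina. ?c j * quad (A j) s v * (1 - ?c j / \<gamma>) ^ (2 * m))" for m v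
  have Q: "quad (penalised F E I c A \<gamma> m) s v = base v + real m * pos v - rem m v" for m v
  proof -
    have 1: "quad (c j * (A j * B m j)) s v = \<mu> j * quad (c j) s v + lin (c j) s v * lin (A j) s v
       - real m * ((2 * \<mu> j / \<gamma>) * (lin (c j) s v * lin (c j) s v))" if "j \<in> Act" for j
      using that A I by (simp add: quad_mult lin_mult act0 Bs algebra_simps)
    have 2: "quad (c j * (A j * B m j)) s v = \<mu> j * quad (c j) s v + ?c j * quad (A j) s v * (1 - ?c j / \<gamma>) ^ (2 * m)"
      if "j \<in> Ina" for j
      using that by (simp add: quad_mult lin_mult A0 linA mu0 B_def)
    have 3: "quad (Const (real m) * (c j * c j) - A j * c j) s v =
       real m * (lin (c j) s v * lin (c j) s v) - (\<mu> j * quad (c j) s v + lin (c j) s v * lin (A j) s v)" if "j \<in> E" for j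
      using that A by (simp add: quad_diff quad_mult lin_mult cE)
    have "quad (penalised F E I c A \<gamma> m) s v = quad F s v
      - ((\<Sum>j\<in>Act. quad (c j * (A j * B m j)) s v) + (\<Sum>j\<in>Ina. quad (c j * (A j * B m j)) s v))
      + (\<Sum>j\<in>E. quad (Const (real m) * (c j * c j) - A j * c j) s v)"
      unfolding pen by (simp add: quad_add quad_diff[of F] quad_diff[of "F - _"] quad_sum sumI)
    also have "(\<Sum>j\<in>Act. quad (c j * (A j * B m j)) s v) = (\<Sum>j\<in>Act. \<mu> j * quad (c j) s v + lin (c j) s v * lin (A j) s v
       - real m * ((2 * \<mu> j / \<gamma>) * (lin (c j) s v * lin (c j) s v)))"
      by (rule sum.cong[OF refl 1])
    also have "(\<Sum>j\<in>Ina. quad (c j * (A j * B m j)) s v) =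
        (\<Sum>j\<in>Ina. \<mu> j * quad (c j) s v + ?c j * quad (A j) s v * (1 - ?c j / \<gamma>) ^ (2 * m))"
      by (rule sum.cong[OF refl 2])
    also have "(\<Sum>j\<in>E. quad (Const (real m) * (c j * c j) - A j * c j) s v) =
       (\<Sum>j\<in>E. real m * (lin (c j) s v * lin (c j) s v) - (\<mu> j * quad (c j) s v + lin (c j) s v * lin (A j) s v))"
      by (rule sum.cong[OF refl 3])
    finally show ?thesis
      by (simp add: base_def pos_def rem_def sum.distrib sum_subtractf sum_distrib_left sumEI sumI distrib_left right_diff_distrib)
  qed
  have th: "\<bar>(1 - ?c j / \<gamma>)\<^sup>2\<bar> < 1" "0 \<le> 1 - ?c j / \<gamma>" "1 - ?c j / \<gamma> \<le> 1" if "j \<in> Ina" for j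
  proof -
    have "?c j > 0" "?c j < \<gamma>" using that cI[of j] g(2)[of j] by (auto simp: Ina_def)
    then have "0 < 1 - ?c j / \<gamma>" "1 - ?c j / \<gamma> < 1" using g(1) by auto
    then show "\<bar>(1 - ?c j / \<gamma>)\<^sup>2\<bar> < 1" "0 \<le> 1 - ?c j / \<gamma>" "1 - ?c j / \<gamma> \<le> 1" by (auto simp: power_less_one_iff abs_square_less_1)
  qed
  have posnn: "pos v \<ge> 0" for v
    unfolding pos_def using mupos g(1) by (intro add_nonneg_nonneg sum_nonneg) (auto simp: less_imp_le)
  have remdec: "rem m' v \<le> rem m v" if "m \<le> m'" for m m' v
    unfolding rem_def
    by (intro sum_mono mult_left_mono power_decreasing th mult_nonneg_nonneg linA(2))
       (use that cI in \<open>auto simp: Ina_def\<close>)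
  have remlim: "(\<lambda>m. rem m v) \<longlonglongrightarrow> 0" for v
  proof -
    have "(\<lambda>m. rem m v) \<longlonglongrightarrow> (\<Sum>j\<in>Ina. ?c j * quad (A j) s v * 0)"
      unfolding rem_def power_mult using th(1)
      by (intro tendsto_sum tendsto_mult tendsto_const LIMSEQ_power_zero) auto
    then show ?thesis by simp
  qed
  have ex: "\<exists>m. base v + real m * pos v - rem m v > 0" if v: "v \<noteq> 0" for v
  proof (cases "pos v = 0")
    case True
    have nn: "(2 * \<mu> j / \<gamma>) * (lin (c j) s v * lin (c j) s v) \<ge> 0" if "j \<in> Act" for j
      using mupos[OF that] g(1) by simp
    have "(\<Sum>j\<in>Act. (2 * \<mu> j / \<gamma>) * (lin (c j) s v * lin (c j) s v)) = 0"
      "(\<Sum>j\<in>E. lin (c j) s v * lin (c j) s v) = 0"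
      using True nn sum_nonneg[of Act, OF nn] sum_nonneg[of E "\<lambda>j. lin (c j) s v * lin (c j) s v"]
      unfolding pos_def by (auto simp: add_nonneg_eq_0_iff)
    then have z: "\<And>j. j \<in> Act \<Longrightarrow> lin (c j) s v = 0" "\<And>j. j \<in> E \<Longrightarrow> lin (c j) s v = 0"
      using nn I fin mupos g(1) by (fastforce simp: sum_nonneg_eq_0_iff)+
    have "quad F s v - (\<Sum>j\<in>E \<union> I. \<mu> j * quad (c j) s v) > 0"
      by (rule sosc[OF v]) (use z in \<open>auto simp: Act_def\<close>)
    then have "base v > 0" by (simp add: base_def z)
    then have "\<forall>\<^sub>F m in sequentially. rem m v < base v" using remlim by (intro order_tendstoD)
    then obtain m where "rem m v < base v" by (auto simp: eventually_sequentially)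
    then show ?thesis using True by (intro exI[of _ m]) simp
  next
    case False
    then have p: "pos v > 0" using posnn[of v] by simp
    \<comment> \<open>\<open>rem\<close> decreases in m, so its value at m = 0 bounds it for all
      m.\<close>
    obtain m :: nat where "real m > (rem 0 v - base v) / pos v" using reals_Archimedean2 by blast
    then have "real m * pos v > rem 0 v - base v" using p by (simp add: pos_divide_less_eq)
    then show ?thesis using remdec[of 0 m v] by (intro exI[of _ m]) simp
  qed
  have cont: "continuous_on Z (\<lambda>v. base v + real m * pos v - rem m v)" for Z m
    unfolding base_def pos_def rem_def by (intro continuous_intros)
  have mono: "base v + real m * pos v - rem m v \<le> base v + real m' * pos v - rem m' v" if "m \<le> m'" for m m' v
    using remdec[OF that, of v] mult_right_mono[OF _ posnn[of v], of "real m" "real m'"] that by simp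
  have ex': "\<exists>m. base v + real m * pos v - rem m v > 0" if "v \<in> sphere 0 1" for v
    by (rule ex) (use that in auto)
  obtain m where m: "\<And>v. v \<in> sphere 0 1 \<Longrightarrow> base v + real m * pos v - rem m v > 0"
    using monotone_eventually_positive_on_compact[of "sphere 0 1" "\<lambda>m v. base v + real m * pos v - rem m v",
        OF compact_sphere cont mono ex'] by blast
  obtain \<epsilon> where e: "\<epsilon> > 0" "\<And>v. v \<in> sphere 0 1 \<Longrightarrow> base v + real m * pos v - rem m v \<ge> \<epsilon>"
    using compact_pos_bounded_below[OF compact_sphere cont m] by blast
  have "\<forall>\<^sub>F x in nhds s. eval_mpoly (penalised F E I c A \<gamma> m) x \<ge> (\<epsilon> / 2) * (norm (x - s))\<^sup>2"
    by (rule quadratic_growthI[OF ev0 lin0 _ e(1)]) (use e(2) Q in auto)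
  then show "\<exists>m. \<exists>\<epsilon>>0. \<forall>\<^sub>F x in nhds s. eval_mpoly (penalised F E I c A \<gamma> m) x \<ge> \<epsilon> * (norm (x - s))\<^sup>2"
    using e(1) by (intro exI[of _ m] exI[of _ "\<epsilon> / 2"]) auto
qed

section \<open>Existence of Lagrange multipliers\<close>

text \<open>Squaring smooths the kink of \<open>min 0\<close>: the linear approximation errs by at
  most h^2. The penalty for inequalities is therefore differentiable, with a derivative of fixed
  sign that becomes the sign of the multiplier.\<close>

lemma DERIV_min_zero_square:
  fixes t :: real
  shows "DERIV (\<lambda>t. (min 0 t)\<^sup>2) t :> 2 * min 0 t"
proof -
  have bound: "\<bar>(min 0 (t + h))\<^sup>2 - (min 0 t)\<^sup>2 - 2 * min 0 t * h\<bar> \<le> h\<^sup>2" for h :: real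
  proof (cases "t \<ge> 0"; cases "t + h \<ge> 0")
    assume "t \<ge> 0" "\<not> t + h \<ge> 0"
    then have "(t + h)\<^sup>2 \<le> h\<^sup>2" by (intro abs_le_square_iff[THEN iffD1]) auto
    then show ?thesis using \<open>t \<ge> 0\<close> \<open>\<not> t + h \<ge> 0\<close> by simp
  next
    assume "\<not> t \<ge> 0" "t + h \<ge> 0"
    then have "(t + h)\<^sup>2 \<le> h\<^sup>2" by (intro abs_le_square_iff[THEN iffD1]) auto
    moreover have "(min 0 (t + h))\<^sup>2 - (min 0 t)\<^sup>2 - 2 * min 0 t * h = h\<^sup>2 - (t + h)\<^sup>2"
      using \<open>\<not> t \<ge> 0\<close> \<open>t + h \<ge> 0\<close> by (simp add: power2_eq_square algebra_simps)
    ultimately show ?thesis using zero_le_power2[of "t + h"] zero_le_power2[of h] by linarith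
  next
    assume "\<not> t \<ge> 0" "\<not> t + h \<ge> 0"
    then have "(min 0 (t + h))\<^sup>2 - (min 0 t)\<^sup>2 - 2 * min 0 t * h = h\<^sup>2"
      by (simp add: power2_eq_square algebra_simps)
    then show ?thesis by simp
  qed auto
  have "((\<lambda>h. ((min 0 (t + h))\<^sup>2 - (min 0 t)\<^sup>2) / h - 2 * min 0 t) \<longlongrightarrow> 0) (at 0)"
  proof (rule Lim_null_comparison)
    show "((\<lambda>h. \<bar>h\<bar>) \<longlongrightarrow> (0::real)) (at 0)" by (intro tendsto_rabs_zero tendsto_ident_at)
    show "\<forall>\<^sub>F h in at 0. norm (((min 0 (t + h))\<^sup>2 - (min 0 t)\<^sup>2) / h - 2 * min 0 t) \<le> \<bar>h\<bar>"
      using eventually_neq_at_within[of 0 0 UNIV]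
    proof eventually_elim
      case (elim h)
      have "((min 0 (t + h))\<^sup>2 - (min 0 t)\<^sup>2) / h - 2 * min 0 t = ((min 0 (t + h))\<^sup>2 - (min 0 t)\<^sup>2 - 2 * min 0 t * h) / h"
        using elim by (simp add: field_simps)
      then show ?case using bound[of h] elim by (simp add: abs_divide divide_le_eq power2_eq_square abs_mult_self_eq)
    qed
  qed
  then show ?thesis unfolding DERIV_def by (simp add: LIM_zero_iff)
qed

lemma GDERIV_sum:
  "(\<And>i. i \<in> A \<Longrightarrow> GDERIV (F i) x :> D i) \<Longrightarrow> GDERIV (\<lambda>x. \<Sum>i\<in>A. F i x) x :> (\<Sum>i\<in>A. D i)"
  unfolding gderiv_def inner_sum_right by (rule has_derivative_sum)

text \<open>Bolzano-Weierstrass for coordinates indexed by a finite set, by successive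
  subsequences.\<close>

lemma bounded_family_convergent_subsequence:
  fixes u :: "nat \<Rightarrow> 'i \<Rightarrow> real"
  assumes "finite A" "\<And>k i. i \<in> A \<Longrightarrow> \<bar>u k i\<bar> \<le> 1"
  shows "\<exists>r l. strict_mono (r :: nat \<Rightarrow> nat) \<and> (\<forall>i\<in>A. (\<lambda>k. u (r k) i) \<longlonglongrightarrow> l i)"
  using assms
proof (induction A rule: finite_induct)
  case empty
  show ?case by (intro exI[of _ id]) (auto simp: strict_mono_def)
next
  case (insert a A)
  have "\<exists>r l. strict_mono (r :: nat \<Rightarrow> nat) \<and> (\<forall>i\<in>A. (\<lambda>k. u (r k) i) \<longlonglongrightarrow> l i)"
    by (rule insert.IH) (use insert.prems in auto)
  then obtain r l where r: "strict_mono (r :: nat \<Rightarrow> nat)" "\<And>i. i \<in> A \<Longrightarrow> (\<lambda>k. u (r k) i) \<longlonglongrightarrow> l i"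
    by blast
  have "\<forall>k. u (r k) a \<in> {-1..1}" using insert.prems by (auto simp: abs_le_iff minus_le_iff)
  moreover have "seq_compact {-1..1::real}" using compact_eq_seq_compact_metric compact_Icc by blast
  ultimately obtain b r' where b: "strict_mono (r' :: nat \<Rightarrow> nat)" "((\<lambda>k. u (r k) a) \<circ> r') \<longlonglongrightarrow> b"
    unfolding seq_compact_def by meson
  have "(\<lambda>k. u ((r \<circ> r') k) i) \<longlonglongrightarrow> (if i = a then b else l i)" if "i \<in> insert a A" for i
  proof (cases "i = a")
    case True
    then show ?thesis using b(2) by (simp add: comp_def)
  next
    case False
    then show ?thesis using LIMSEQ_subseq_LIMSEQ[OF r(2) b(1)] that by (simp add: comp_def)
  qed
  then show ?case
    by (intro exI[of _ "r \<circ> r'"] exI[of _ "\<lambda>i. if i = a then b else l i"] conjI ballI strict_mono_o r(1) b(1))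
qed

text \<open>Injectivity turns coefficients indexed by A into coefficients on the image, where
  independence of a set of vectors applies.\<close>

lemma independent_family_zero:
  assumes "finite A" "inj_on a A" "independent (a ` A)" "(\<Sum>j\<in>A. \<rho> j *\<^sub>R a j) = 0" "j \<in> A"
  shows "\<rho> j = 0"
proof -
  have "(\<Sum>v\<in>a ` A. \<rho> (the_inv_into A a v) *\<^sub>R v) = (\<Sum>j\<in>A. \<rho> j *\<^sub>R a j)"
    using assms(2) by (simp add: sum.reindex the_inv_into_f_f)
  then have "\<rho> (the_inv_into A a (a j)) = 0"
    using assms by (intro independent_explicit_finite_subsets[THEN iffD1, OF assms(3), rule_format, of "a ` A"]) auto
  then show ?thesis using assms by (simp add: the_inv_into_f_f)
qed

lemma tendsto_gradient:
  assumes "(y \<longlongrightarrow> s) F"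
  shows "((\<lambda>k. gradient (eval_mpoly p) (y k)) \<longlongrightarrow> gradient (eval_mpoly p) s) F"
  unfolding gradient_eval by (intro vec_tendstoI) (simp, intro tendsto_eval assms)

text \<open>McShane's penalty argument: minimisers of the penalised problem on a ball converge to \<open>s\<close>, and the
  limit of their normalised stationarity conditions is a Fritz John condition at \<open>s\<close>.\<close>

theorem LICQC_multipliers_exist:
  fixes f :: "'n::finite mpoly"
  assumes fin: "finite E" "finite I" and EI: "E \<inter> I = {}"
    and min: "minimizer f E I c s" and licq: "LICQC E I c s"
  shows "\<exists>\<mu>. multipliers f E I c s \<mu>"
proof -
  let ?J = "active E I c s"
  have finJ: "finite ?J" using fin by (simp add: active_def)
  have feas: "feasible E I c s" and opt: "\<And>y. feasible E I c y \<Longrightarrow> eval_mpoly f s \<le> eval_mpoly f y"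
    using min by (auto simp: minimizer_def is_arg_min_linorder)
  \<comment> \<open>The added |y - s|^2 makes s the unique minimizer of f' on the feasible set,
    which forces the penalty minimizers to converge to s; its gradient vanishes at s.\<close>
  define f' where "f' = f + (\<Sum>i\<in>UNIV. (shifted s i)\<^sup>2)"
  have f': "eval_mpoly f' y = eval_mpoly f y + (norm (y - s))\<^sup>2" for y
  proof -
    have "(norm (y - s))\<^sup>2 = (\<Sum>i\<in>UNIV. (y $ i - s $ i) * (y $ i - s $ i))"
      by (simp only: power2_norm_eq_inner inner_vec_def vector_minus_component inner_real_def)
    then show ?thesis by (simp add: f'_def power2_eq_square)
  qed
  define \<Phi> where "\<Phi> k y = eval_mpoly f' y + (\<Sum>j\<in>E. real k * (eval_mpoly (c j) y)\<^sup>2)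
    + (\<Sum>j\<in>I. real k * (min 0 (eval_mpoly (c j) y))\<^sup>2)" for k y
  have cont: "continuous_on Z (\<Phi> k)" for Z k
    unfolding \<Phi>_def by (intro continuous_intros)
  have ball: "compact (cball s 1)" "cball s 1 \<noteq> {}" by auto
  have "\<exists>y\<in>cball s 1. \<forall>x\<in>cball s 1. \<Phi> k y \<le> \<Phi> k x" for k
    by (rule continuous_attains_inf[OF ball cont])
  then obtain y where y: "\<And>k. y k \<in> cball s 1" "\<And>k x. x \<in> cball s 1 \<Longrightarrow> \<Phi> k (y k) \<le> \<Phi> k x" by metis
  have \<Phi>s: "\<Phi> k s = eval_mpoly f s" for k
    using feas by (simp add: \<Phi>_def f' feasible_def min_absorb1)
  have \<Phi>y: "\<Phi> k (y k) \<le> eval_mpoly f s" for k using y(2)[of s k] \<Phi>s by simp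
  obtain b where b: "\<And>x. x \<in> cball s 1 \<Longrightarrow> eval_mpoly f b \<le> eval_mpoly f x"
    using continuous_attains_inf[OF ball continuous_on_eval] by metis
  obtain l r where l: "l \<in> cball s 1" "strict_mono r" "(y \<circ> r) \<longlonglongrightarrow> l"
    using ball(1) y(1) unfolding compact_eq_seq_compact_metric seq_compact_def by metis
  define z where "z k = y (r k)" for k
  have z: "z \<longlonglongrightarrow> l" using l(3) by (simp add: z_def[abs_def] comp_def)
  have rk: "real (r k) \<ge> real k" for k using seq_suble[OF l(2), of k] by simp
  define B where "B = eval_mpoly f s - eval_mpoly f b"
  have sumnn: "(\<Sum>j\<in>E. real k * (eval_mpoly (c j) x)\<^sup>2) \<ge> 0" "(\<Sum>j\<in>I. real k * (min 0 (eval_mpoly (c j) x))\<^sup>2) \<ge> 0" for k x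
    by (auto intro!: sum_nonneg)
  \<comment> \<open>The value at s bounds the penalised objective at \<open>z k\<close>, hence every
    single penalty term; \<open>r k \<ge> k\<close> allows the factor k in place of
    \<open>r k\<close>.\<close>
  have small: "real k * w \<le> B" if w: "w = (if j \<in> E then (eval_mpoly (c j) (z k))\<^sup>2 else (min 0 (eval_mpoly (c j) (z k)))\<^sup>2)" "j \<in> E \<union> I" for k j w
  proof -
    have "eval_mpoly f b \<le> eval_mpoly f' (z k)" using b[OF y(1)[of "r k"]] by (simp add: f' z_def add_increasing2)
    then have 1: "(\<Sum>j\<in>E. real (r k) * (eval_mpoly (c j) (z k))\<^sup>2) + (\<Sum>j\<in>I. real (r k) * (min 0 (eval_mpoly (c j) (z k)))\<^sup>2) \<le> B"
      using \<Phi>y[of "r k"] by (simp add: \<Phi>_def B_def z_def)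
    have "real (r k) * w \<le> B"
    proof (cases "j \<in> E")
      case True
      then show ?thesis
        using 1 w sumnn(2)[of "r k" "z k"] member_le_sum[OF True, of "\<lambda>j. real (r k) * (eval_mpoly (c j) (z k))\<^sup>2"] fin by simp
    next
      case False
      then have jI: "j \<in> I" using w by simp
      show ?thesis
        using False 1 w sumnn(1)[of "r k" "z k"] member_le_sum[OF jI, of "\<lambda>j. real (r k) * (min 0 (eval_mpoly (c j) (z k)))\<^sup>2"] fin by simp
    qed
    moreover have "real k * w \<le> real (r k) * w" using rk w by (intro mult_right_mono) auto
    ultimately show ?thesis by linarith
  qed
  have lim0: "L \<le> 0" if L: "w \<longlonglongrightarrow> L" "\<And>k. real k * w k \<le> B" for w :: "nat \<Rightarrow> real" and L
  proof (rule ccontr)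
    assume "\<not> L \<le> 0"
    then have "\<forall>\<^sub>F k in sequentially. w k > L / 2" using L by (intro order_tendstoD) auto
    moreover have "\<forall>\<^sub>F k in sequentially. real k * (L / 2) > B"
      using \<open>\<not> L \<le> 0\<close> filterlim_real_sequentially[unfolded filterlim_at_top_dense, rule_format, of "B / (L / 2)"]
      by (simp add: field_simps)
    ultimately have "\<forall>\<^sub>F k in sequentially. False"
    proof eventually_elim
      case (elim k)
      have "real k * (L / 2) \<le> real k * w k" using elim by (intro mult_left_mono) auto
      then show ?case using elim L(2)[of k] by linarith
    qed
    then show False by simp
  qed
  have feasl: "feasible E I c l"
  proof -
    have "eval_mpoly (c j) l = 0" if j: "j \<in> E" for j
    proof -
      have "(eval_mpoly (c j) l)\<^sup>2 \<le> 0"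
        by (rule lim0[of "\<lambda>k. (eval_mpoly (c j) (z k))\<^sup>2"]) (use small[of _ j] j z in \<open>auto intro!: tendsto_intros\<close>)
      then show ?thesis by simp
    qed
    moreover have "eval_mpoly (c j) l \<ge> 0" if j: "j \<in> I" for j
    proof -
      have "j \<notin> E" using j EI by auto
      then have "(min 0 (eval_mpoly (c j) l))\<^sup>2 \<le> 0"
        by (intro lim0[of "\<lambda>k. (min 0 (eval_mpoly (c j) (z k)))\<^sup>2"]) (use small[of _ j] j z in \<open>auto intro!: tendsto_intros\<close>)
      then show ?thesis by simp
    qed
    ultimately show ?thesis by (simp add: feasible_def)
  qed
  have "l = s"
  proof -
    have "eval_mpoly f' (z k) \<le> eval_mpoly f s" for k
      using \<Phi>y[of "r k"] sumnn[of "r k" "z k"] by (simp add: \<Phi>_def z_def)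
    then have "eval_mpoly f' l \<le> eval_mpoly f s"
      using z by (intro tendsto_upperbound[of "\<lambda>k. eval_mpoly f' (z k)" _ sequentially]) (auto intro: tendsto_eval)
    then have "(norm (l - s))\<^sup>2 \<le> 0" using opt[OF feasl] unfolding f' by linarith
    then show ?thesis by simp
  qed
  then have zs: "z \<longlonglongrightarrow> s" using z by simp
  \<comment> \<open>The derivative of the j-th penalty with reversed sign, hence nonnegative for j
    in I.\<close>
  define \<nu> where "\<nu> k j = (if j \<in> E then - (2 * real (r k) * eval_mpoly (c j) (z k))
     else - (2 * real (r k) * min 0 (eval_mpoly (c j) (z k))))" for k j
  have grad\<Phi>: "GDERIV (\<Phi> k) x :> gradient (eval_mpoly f') x + (\<Sum>j\<in>E. (2 * real k * eval_mpoly (c j) x) *\<^sub>R gradient (eval_mpoly (c j)) x)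
     + (\<Sum>j\<in>I. (2 * real k * min 0 (eval_mpoly (c j) x)) *\<^sub>R gradient (eval_mpoly (c j)) x)" for k x
  proof -
    have "DERIV (\<lambda>t::real. real k * t\<^sup>2) t :> 2 * real k * t" for t by (auto intro!: derivative_eq_intros)
    moreover have "DERIV (\<lambda>t::real. real k * (min 0 t)\<^sup>2) t :> 2 * real k * min 0 t" for t
      using DERIV_cmult[OF DERIV_min_zero_square, of "real k" t] by (simp add: mult_ac)
    ultimately show ?thesis
      unfolding \<Phi>_def by (intro GDERIV_add GDERIV_sum GDERIV_eval_gradient
        GDERIV_DERIV_compose[of "eval_mpoly (c _)" x _ "\<lambda>t. real k * t\<^sup>2"]
        GDERIV_DERIV_compose[of "eval_mpoly (c _)" x _ "\<lambda>t. real k * (min 0 t)\<^sup>2"])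
  qed
  have "\<forall>\<^sub>F k in sequentially. \<forall>j\<in>I - ?J. eval_mpoly (c j) (z k) > 0"
    using fin feas zs by (intro eventually_ball_finite ballI order_tendstoD[OF tendsto_eval])
      (auto simp: active_def feasible_def order_le_less)
  moreover have "\<forall>\<^sub>F k in sequentially. z k \<in> ball s 1"
    by (rule topological_tendstoD[OF zs]) auto
  ultimately have stat: "\<forall>\<^sub>F k in sequentially. gradient (eval_mpoly f') (z k) = (\<Sum>j\<in>?J. \<nu> k j *\<^sub>R gradient (eval_mpoly (c j)) (z k))"
  proof eventually_elim
    case (elim k)
    \<comment> \<open>By now \<open>z k\<close> lies in the open ball, so the minimum over the
      closed ball is an interior critical point; inactive inequalities hold strictly at
      \<open>z k\<close>, so only active indices contribute.\<close>
    define D where "D = gradient (eval_mpoly f') (z k) + (\<Sum>j\<in>E. (2 * real (r k) * eval_mpoly (c j) (z k)) *\<^sub>R gradient (eval_mpoly (c j)) (z k))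
     + (\<Sum>j\<in>I. (2 * real (r k) * min 0 (eval_mpoly (c j) (z k))) *\<^sub>R gradient (eval_mpoly (c j)) (z k))"
    have "(\<Phi> (r k) has_derivative (\<lambda>h. inner h D)) (at (z k))"
      using grad\<Phi>[of "r k" "z k"] by (simp add: gderiv_def D_def)
    then have "(\<lambda>h. inner h D) = (\<lambda>h. 0)"
      by (rule differential_zero_maxmin[OF elim(2) open_ball]) (use y(2)[of _ "r k"] in \<open>auto simp: z_def\<close>)
    then have "inner D D = 0" by (rule fun_cong)
    then have "D = 0" by (simp only: inner_eq_zero_iff)
    moreover have "(\<Sum>j\<in>E. (2 * real (r k) * eval_mpoly (c j) (z k)) *\<^sub>R gradient (eval_mpoly (c j)) (z k))
        = - (\<Sum>j\<in>E. \<nu> k j *\<^sub>R gradient (eval_mpoly (c j)) (z k))"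
      by (simp add: \<nu>_def sum_negf[symmetric])
    moreover have "(\<Sum>j\<in>I. (2 * real (r k) * min 0 (eval_mpoly (c j) (z k))) *\<^sub>R gradient (eval_mpoly (c j)) (z k))
        = - (\<Sum>j\<in>I. \<nu> k j *\<^sub>R gradient (eval_mpoly (c j)) (z k))"
      unfolding sum_negf[symmetric] by (rule sum.cong) (use EI in \<open>auto simp: \<nu>_def\<close>)
    moreover have "(\<Sum>j\<in>E \<union> I. \<nu> k j *\<^sub>R gradient (eval_mpoly (c j)) (z k)) =
      (\<Sum>j\<in>E. \<nu> k j *\<^sub>R gradient (eval_mpoly (c j)) (z k)) + (\<Sum>j\<in>I. \<nu> k j *\<^sub>R gradient (eval_mpoly (c j)) (z k))"
      by (rule sum.union_disjoint[OF fin EI])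
    moreover have "(\<Sum>j\<in>E \<union> I. \<nu> k j *\<^sub>R gradient (eval_mpoly (c j)) (z k)) = (\<Sum>j\<in>?J. \<nu> k j *\<^sub>R gradient (eval_mpoly (c j)) (z k))"
    proof (rule sum.mono_neutral_right)
      show "\<forall>j\<in>E \<union> I - ?J. \<nu> k j *\<^sub>R gradient (eval_mpoly (c j)) (z k) = 0"
      proof
        fix j assume j: "j \<in> E \<union> I - ?J"
        then have "j \<in> I - ?J" "j \<notin> E" using feas by (auto simp: active_def feasible_def)
        then have "eval_mpoly (c j) (z k) > 0" using elim(1) by blast
        then have "min 0 (eval_mpoly (c j) (z k)) = 0" by simp
        then show "\<nu> k j *\<^sub>R gradient (eval_mpoly (c j)) (z k) = 0" using \<open>j \<notin> E\<close> by (simp add: \<nu>_def)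
      qed
    qed (use fin in \<open>auto simp: active_def\<close>)
    ultimately show ?case unfolding D_def by (simp add: algebra_simps)
  qed
  \<comment> \<open>Dividing by the total size of the multipliers, with 1 for the objective, keeps
    them in [-1, 1]; the index \<open>None\<close> of u stands for the objective.\<close>
  define N where "N k = 1 + (\<Sum>j\<in>?J. \<bar>\<nu> k j\<bar>)" for k
  have N: "N k \<ge> 1" for k unfolding N_def by (simp add: sum_nonneg)
  define u where "u k j = (case j of None \<Rightarrow> 1 / N k | Some j \<Rightarrow> \<nu> k j / N k)" for k j
  have ub: "\<bar>u k j\<bar> \<le> 1" if "j \<in> insert None (Some ` ?J)" for k j
  proof (cases j)
    case (Some i)
    then have "i \<in> ?J" using that by auto
    then have "\<bar>\<nu> k i\<bar> \<le> N k" unfolding N_def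
      using member_le_sum[of i ?J "\<lambda>j. \<bar>\<nu> k j\<bar>"] finJ by simp
    then show ?thesis using N[of k] Some by (simp add: u_def abs_divide)
  qed (use N[of k] in \<open>simp add: u_def\<close>)
  have "finite (insert None (Some ` ?J))" using finJ by simp
  from bounded_family_convergent_subsequence[of _ u, OF this ub]
  obtain r' L where r': "strict_mono (r' :: nat \<Rightarrow> nat)"
    and L: "\<And>j. j \<in> insert None (Some ` ?J) \<Longrightarrow> (\<lambda>k. u (r' k) j) \<longlonglongrightarrow> L j"
    by blast
  have zr: "(\<lambda>k. z (r' k)) \<longlonglongrightarrow> s"
    using LIMSEQ_subseq_LIMSEQ[OF zs r'] by (simp add: comp_def)
  have FJ: "L None *\<^sub>R gradient (eval_mpoly f') s = (\<Sum>j\<in>?J. L (Some j) *\<^sub>R gradient (eval_mpoly (c j)) s)"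
  proof (rule LIMSEQ_unique)
    show "(\<lambda>k. u (r' k) None *\<^sub>R gradient (eval_mpoly f') (z (r' k))) \<longlonglongrightarrow> L None *\<^sub>R gradient (eval_mpoly f') s"
      by (intro tendsto_scaleR tendsto_gradient zr L) auto
    have "(\<lambda>k. \<Sum>j\<in>?J. u (r' k) (Some j) *\<^sub>R gradient (eval_mpoly (c j)) (z (r' k)))
        \<longlonglongrightarrow> (\<Sum>j\<in>?J. L (Some j) *\<^sub>R gradient (eval_mpoly (c j)) s)"
      by (intro tendsto_sum tendsto_scaleR tendsto_gradient zr L) auto
    moreover have "\<forall>\<^sub>F k in sequentially. (\<Sum>j\<in>?J. u (r' k) (Some j) *\<^sub>R gradient (eval_mpoly (c j)) (z (r' k)))
       = u (r' k) None *\<^sub>R gradient (eval_mpoly f') (z (r' k))"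
      using eventually_subseq[OF r' stat]
    proof eventually_elim
      case (elim k)
      show ?case unfolding elim by (simp add: u_def scaleR_sum_right)
    qed
    ultimately show "(\<lambda>k. u (r' k) None *\<^sub>R gradient (eval_mpoly f') (z (r' k)))
        \<longlonglongrightarrow> (\<Sum>j\<in>?J. L (Some j) *\<^sub>R gradient (eval_mpoly (c j)) s)"
      by (rule Lim_transform_eventually)
  qed
  have norm1: "L None + (\<Sum>j\<in>?J. \<bar>L (Some j)\<bar>) = 1"
  proof (rule LIMSEQ_unique)
    show "(\<lambda>k. u (r' k) None + (\<Sum>j\<in>?J. \<bar>u (r' k) (Some j)\<bar>)) \<longlonglongrightarrow> L None + (\<Sum>j\<in>?J. \<bar>L (Some j)\<bar>)"
      by (intro tendsto_add tendsto_sum tendsto_rabs L) auto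
    have "u k None + (\<Sum>j\<in>?J. \<bar>u k (Some j)\<bar>) = N k / N k" for k
      using N[of k] by (simp add: u_def abs_divide sum_divide_distrib[symmetric] add_divide_distrib[symmetric]) (simp add: N_def)
    then have "u k None + (\<Sum>j\<in>?J. \<bar>u k (Some j)\<bar>) = 1" for k using N[of k] by simp
    then show "(\<lambda>k. u (r' k) None + (\<Sum>j\<in>?J. \<bar>u (r' k) (Some j)\<bar>)) \<longlonglongrightarrow> 1" by simp
  qed
  have L0: "L None \<ge> 0"
    by (rule tendsto_lowerbound[OF L[of None]]) (use N in \<open>auto simp: u_def intro!: always_eventually divide_nonneg_nonneg order_trans[OF _ N]\<close>)
  have LI: "L (Some j) \<ge> 0" if "j \<in> I \<inter> ?J" for j
  proof (rule tendsto_lowerbound[OF L[of "Some j"]])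
    have "\<nu> k j \<ge> 0" for k using that EI by (auto simp: \<nu>_def mult_nonneg_nonpos)
    then show "\<forall>\<^sub>F k in sequentially. 0 \<le> u (r' k) (Some j)"
      using N by (auto simp: u_def intro!: always_eventually divide_nonneg_nonneg order_trans[OF _ N])
  qed (use that in auto)
  \<comment> \<open>The abnormal case, a vanishing multiplier of the objective, contradicts LICQC
    because the limit multipliers have total size 1.\<close>
  have Lpos: "L None > 0"
  proof (rule ccontr)
    assume "\<not> L None > 0"
    then have "L None = 0" using L0 by simp
    then have "(\<Sum>j\<in>?J. L (Some j) *\<^sub>R gradient (eval_mpoly (c j)) s) = 0" using FJ by simp
    then have "L (Some j) = 0" if "j \<in> ?J" for j
      using independent_family_zero[OF finJ, of "\<lambda>j. gradient (eval_mpoly (c j)) s" "\<lambda>j. L (Some j)"] licq that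
      unfolding LICQC_def by blast
    then show False using norm1 \<open>L None = 0\<close> by simp
  qed
  have "lin f' s v = lin f s v" for v
  proof -
    have "lin (\<Sum>i\<in>UNIV. (shifted s i)\<^sup>2) s v = 0"
      by (simp add: lin_sum power2_eq_square lin_mult)
    then show ?thesis by (simp add: f'_def lin_add)
  qed
  then have "\<forall>v. v \<bullet> gradient (eval_mpoly f') s = v \<bullet> gradient (eval_mpoly f) s"
    unfolding lin_eq_gradient by blast
  then have gf: "gradient (eval_mpoly f') s = gradient (eval_mpoly f) s"
    by (rule vector_eq_ldot[THEN iffD1])
  define \<mu> where "\<mu> j = (if j \<in> ?J then L (Some j) / L None else 0)" for j
  have "gradient (eval_mpoly f) s = (1 / L None) *\<^sub>R (L None *\<^sub>R gradient (eval_mpoly f) s)" using Lpos by simp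
  also have "\<dots> = (\<Sum>j\<in>?J. \<mu> j *\<^sub>R gradient (eval_mpoly (c j)) s)"
    unfolding gf[symmetric] FJ scaleR_sum_right by (rule sum.cong) (auto simp: \<mu>_def)
  also have "\<dots> = (\<Sum>j\<in>E \<union> I. \<mu> j *\<^sub>R gradient (eval_mpoly (c j)) s)"
    by (rule sum.mono_neutral_left) (use fin in \<open>auto simp: active_def \<mu>_def\<close>)
  finally have "multipliers f E I c s \<mu>"
    using LI Lpos unfolding multipliers_def by (auto simp: \<mu>_def active_def)
  then show ?thesis by blast
qed

section \<open>The quadratic module of the constraints\<close>

lemma SOS_square: "p\<^sup>2 \<in> SOS"
  unfolding SOS_def by (intro CollectI exI[of _ "1::nat"] exI[of _ "\<lambda>_. p"]) simp

lemma SOS_0: "0 \<in> SOS"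
  using SOS_square[of 0] by simp

lemma SOS_add:
  assumes "p \<in> SOS" "q \<in> SOS"
  shows "p + q \<in> SOS"
proof -
  obtain m :: nat and a where p: "p = (\<Sum>i<m. (a i)\<^sup>2)" using assms(1) by (auto simp: SOS_def)
  obtain k :: nat and b where q: "q = (\<Sum>i<k. (b i)\<^sup>2)" using assms(2) by (auto simp: SOS_def)
  have "(\<Sum>i<m + k. (if i < m then a i else b (i - m))\<^sup>2) = p + q"
  proof -
    have "(\<Sum>i<m + n. (if i < m then a i else b (i - m))\<^sup>2) = p + (\<Sum>i<n. (b i)\<^sup>2)" for n
      by (induction n) (auto simp: p add.assoc)
    then show ?thesis by (simp add: q)
  qed
  then show ?thesis unfolding SOS_def
    by (intro CollectI exI[of _ "m + k"] exI[of _ "\<lambda>i. if i < m then a i else b (i - m)"]) simp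
qed

lemma SOS_sum: "(\<And>i. i \<in> A \<Longrightarrow> p i \<in> SOS) \<Longrightarrow> sum p A \<in> SOS"
  by (induction A rule: infinite_finite_induct) (auto intro: SOS_add SOS_0)

lemma SOS_mult:
  assumes "p \<in> SOS" "q \<in> SOS"
  shows "p * q \<in> SOS"
proof -
  obtain m :: nat and a where p: "p = (\<Sum>i<m. (a i)\<^sup>2)" using assms(1) by (auto simp: SOS_def)
  obtain k :: nat and b where q: "q = (\<Sum>i<k. (b i)\<^sup>2)" using assms(2) by (auto simp: SOS_def)
  have "p * q = (\<Sum>i<m. \<Sum>j<k. (a i * b j)\<^sup>2)"
    by (simp add: p q sum_product power_mult_distrib)
  then show ?thesis by (simp add: SOS_sum SOS_square)
qed

lemma SOS_Const: "a \<ge> 0 \<Longrightarrow> Const a \<in> SOS"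
  using SOS_square[of "Const (sqrt a)"] by (simp flip: Const_power)

lemma SOS_even_power: "p ^ (2 * m) \<in> SOS"
  using SOS_square[of "p ^ m"] by (simp add: power_mult[symmetric] mult.commute)

lemma SOS_nonneg: "p \<in> SOS \<Longrightarrow> eval_mpoly p x \<ge> 0"
  by (auto simp: SOS_def intro!: sum_nonneg)

definition constraint_module :: "'j set \<Rightarrow> 'j set \<Rightarrow> ('j \<Rightarrow> 'n mpoly) \<Rightarrow> 'n mpoly set" where
  "constraint_module E I c = {a + b | a b. a \<in> Ideal E c \<and> b \<in> QM I c}"

lemma constraint_moduleI:
  assumes "p = (\<Sum>j\<in>E. c j * h j) + (s0 + (\<Sum>j\<in>I. c j * s j))" "s0 \<in> SOS" "\<And>j. j \<in> I \<Longrightarrow> s j \<in> SOS"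
  shows "p \<in> constraint_module E I c"
  unfolding constraint_module_def Ideal_def QM_def using assms by blast

lemma constraint_moduleE:
  assumes "p \<in> constraint_module E I c"
  obtains h s0 s where "p = (\<Sum>j\<in>E. c j * h j) + (s0 + (\<Sum>j\<in>I. c j * s j))" "s0 \<in> SOS" "\<And>j. j \<in> I \<Longrightarrow> s j \<in> SOS"
proof -
  obtain a b where p: "p = a + b" and a: "a \<in> Ideal E c" and b: "b \<in> QM I c"
    using assms unfolding constraint_module_def by auto
  obtain h where h: "a = (\<Sum>j\<in>E. c j * h j)" using a unfolding Ideal_def by auto
  obtain s0 s where s: "b = s0 + (\<Sum>j\<in>I. c j * s j)" "s0 \<in> SOS" "\<forall>j\<in>I. s j \<in> SOS"
    using b unfolding QM_def by auto
  show ?thesis by (rule that[of h s0 s]) (use s in \<open>simp_all add: p h\<close>)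
qed

lemma constraint_module_add:
  assumes "p \<in> constraint_module E I c" "q \<in> constraint_module E I c"
  shows "p + q \<in> constraint_module E I c"
proof -
  obtain h s0 s where p: "p = (\<Sum>j\<in>E. c j * h j) + (s0 + (\<Sum>j\<in>I. c j * s j))" "s0 \<in> SOS" "\<And>j. j \<in> I \<Longrightarrow> s j \<in> SOS"
    by (rule constraint_moduleE[OF assms(1)]) (rule that; assumption)
  obtain k t0 t where q: "q = (\<Sum>j\<in>E. c j * k j) + (t0 + (\<Sum>j\<in>I. c j * t j))" "t0 \<in> SOS" "\<And>j. j \<in> I \<Longrightarrow> t j \<in> SOS"
    by (rule constraint_moduleE[OF assms(2)]) (rule that; assumption)
  show ?thesis
    by (rule constraint_moduleI[where h = "\<lambda>j. h j + k j" and ?s0.0 = "s0 + t0" and s = "\<lambda>j. s j + t j"])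
      (use p(2,3) q(2,3) in \<open>auto simp: p(1) q(1) distrib_left sum.distrib intro: SOS_add\<close>)
qed

lemma constraint_module_SOS_mult:
  assumes "q \<in> SOS" "p \<in> constraint_module E I c"
  shows "q * p \<in> constraint_module E I c"
proof -
  obtain h s0 s where p: "p = (\<Sum>j\<in>E. c j * h j) + (s0 + (\<Sum>j\<in>I. c j * s j))" "s0 \<in> SOS" "\<And>j. j \<in> I \<Longrightarrow> s j \<in> SOS"
    by (rule constraint_moduleE[OF assms(2)]) (rule that; assumption)
  show ?thesis
    by (rule constraint_moduleI[where h = "\<lambda>j. q * h j" and ?s0.0 = "q * s0" and s = "\<lambda>j. q * s j"])
      (use p(2,3) assms(1) in \<open>auto simp: p(1) distrib_left sum_distrib_left mult.left_commute intro: SOS_mult\<close>)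
qed

lemma SOS_subset_constraint_module: "p \<in> SOS \<Longrightarrow> p \<in> constraint_module E I c"
  by (rule constraint_moduleI[where h = "\<lambda>_. 0" and ?s0.0 = p and s = "\<lambda>_. 0"]) (auto intro: SOS_0)

lemma constraint_module_nonneg:
  assumes "p \<in> constraint_module E I c" "feasible E I c x"
  shows "eval_mpoly p x \<ge> 0"
proof -
  obtain h s0 s where p: "p = (\<Sum>j\<in>E. c j * h j) + (s0 + (\<Sum>j\<in>I. c j * s j))" "s0 \<in> SOS" "\<And>j. j \<in> I \<Longrightarrow> s j \<in> SOS"
    by (rule constraint_moduleE[OF assms(1)]) (rule that; assumption)
  have "eval_mpoly p x = eval_mpoly s0 x + (\<Sum>j\<in>I. eval_mpoly (c j) x * eval_mpoly (s j) x)"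
    using assms(2) by (simp add: p(1) feasible_def)
  also have "\<dots> \<ge> 0"
    using p(2,3) assms(2) by (auto simp: feasible_def SOS_nonneg intro!: add_nonneg_nonneg sum_nonneg mult_nonneg_nonneg)
  finally show ?thesis .
qed

section \<open>The preordering of a ball\<close>

definition ball_poly :: "real \<Rightarrow> 'n::finite mpoly" where
  "ball_poly R = Const R - (\<Sum>i\<in>UNIV. (Var i)\<^sup>2)"

text \<open>With a single generator g the product of two members keeps this form, since g^2 is a
  square. This makes products available although the module of all constraints need not be closed
  under them.\<close>

definition ball_preordering :: "real \<Rightarrow> 'n::finite mpoly set" where
  "ball_preordering R = {a + ball_poly R * b | a b. a \<in> SOS \<and> b \<in> SOS}"

text \<open>For e = 1 or e = -1, adding \<open>(x_i + e)^2\<close> and the squares of the other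
  variables to the ball polynomial leaves \<open>R + 1 + 2 e x_i\<close>, which gives the box of
  size (R + 1) / 2. The further 1 makes feasible points interior to the cube, also for R =
  1.\<close>

lemma cube_preordering_ball:
  assumes "R > 0"
  shows "cube_preordering (ball_preordering R :: 'n::finite mpoly set) ((R + 1) / 2 + 1)"
proof
  let ?T = "ball_preordering R :: 'n mpoly set"
  let ?g = "ball_poly R :: 'n mpoly"
  show "0 < (R + 1) / 2 + 1"
    using assms by (intro add_pos_pos divide_pos_pos) auto
  fix p q :: "'n mpoly"
  have sos: "s \<in> ?T" if "s \<in> SOS" for s
    unfolding ball_preordering_def using that SOS_0 by (intro CollectI exI[of _ s] exI[of _ 0]) auto
  then show "p\<^sup>2 \<in> ?T" by (simp add: SOS_square)
  have add: "p + q \<in> ?T" if "p \<in> ?T" "q \<in> ?T" for p q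
  proof -
    obtain a b a' b' where "p = a + ?g * b" "q = a' + ?g * b'" "a \<in> SOS" "b \<in> SOS" "a' \<in> SOS" "b' \<in> SOS"
      using \<open>p \<in> ?T\<close> \<open>q \<in> ?T\<close> unfolding ball_preordering_def by blast
    moreover have "(a + ?g * b) + (a' + ?g * b') = (a + a') + ?g * (b + b')" by (simp add: algebra_simps)
    ultimately show ?thesis unfolding ball_preordering_def using SOS_add by blast
  qed
  then show "p \<in> ?T \<Longrightarrow> q \<in> ?T \<Longrightarrow> p + q \<in> ?T" .
  show "p * q \<in> ?T" if "p \<in> ?T" "q \<in> ?T"
  proof -
    obtain a b a' b' where pq: "p = a + ?g * b" "q = a' + ?g * b'" "a \<in> SOS" "b \<in> SOS" "a' \<in> SOS" "b' \<in> SOS"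
      using \<open>p \<in> ?T\<close> \<open>q \<in> ?T\<close> unfolding ball_preordering_def by blast
    have "p * q = (a * a' + ?g\<^sup>2 * (b * b')) + ?g * (a * b' + b * a')"
      by (simp add: pq power2_eq_square algebra_simps)
    moreover have "a * a' + ?g\<^sup>2 * (b * b') \<in> SOS" "a * b' + b * a' \<in> SOS"
      using pq by (auto intro!: SOS_add SOS_mult SOS_square)
    ultimately show ?thesis unfolding ball_preordering_def by blast
  qed
  have gT: "?g \<in> ?T"
    unfolding ball_preordering_def using SOS_0 SOS_square[of 1] by (intro CollectI exI[of _ 0] exI[of _ 1]) auto
  have lin: "Const ((R + 1) / 2 + 1) + Const e * Var i \<in> ?T" if e: "e * e = 1" for e and i :: 'n
  proof -
    let ?s = "(\<Sum>j\<in>UNIV - {i}. (Var j)\<^sup>2) + (Var i + Const e)\<^sup>2 :: 'n mpoly"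
    have "(\<Sum>j\<in>UNIV. (Var j)\<^sup>2) = (Var i)\<^sup>2 + (\<Sum>j\<in>UNIV - {i}. (Var j)\<^sup>2 :: 'n mpoly)"
      by (rule sum.remove) auto
    then have "?g + ?s = Const R + Const e * Const e + (Const e + Const e) * Var i"
      by (simp add: ball_poly_def power2_eq_square algebra_simps)
    also have "\<dots> = Const (R + 1) + Const (2 * e) * Var i"
    proof -
      have "Const e * Const e = (1 :: 'n mpoly)" by (simp add: e flip: Const_mult)
      moreover have "Const e + Const e = (Const (2 * e) :: 'n mpoly)" by (simp flip: Const_add)
      ultimately show ?thesis by (simp add: Const_add)
    qed
    finally have half: "Const (1 / 2) * (?g + ?s) = Const (1 / 2) * (Const (R + 1) + Const (2 * e) * Var i)"
      by (simp only:)
    have "Const ((R + 1) / 2 + 1) = Const (1 / 2 * (R + 1) + 1)" by simp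
    also have "\<dots> = Const (1 / 2) * Const (R + 1) + Const 1" by (subst Const_add) (simp only: Const_mult)
    finally have c1: "Const ((R + 1) / 2 + 1) = Const (1 / 2) * Const (R + 1) + (1 :: 'n mpoly)" by simp
    have c2: "Const e = Const (1 / 2) * (Const (2 * e) :: 'n mpoly)" by (simp flip: Const_mult)
    have "Const ((R + 1) / 2 + 1) + Const e * Var i = Const (1 / 2) * (Const (R + 1) + Const (2 * e) * Var i) + 1"
      by (subst c1, subst c2) (simp only: distrib_left mult.assoc add_ac)
    also have "\<dots> = (Const (1 / 2) * ?g + Const (1 / 2) * ?s) + 1"
      unfolding half[symmetric] distrib_left[of "Const (1 / 2)" ?g ?s] ..
    finally have eq: "Const ((R + 1) / 2 + 1) + Const e * Var i = (Const (1 / 2) * ?g + Const (1 / 2) * ?s) + 1" .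
    have "Const (1 / 2) * ?g \<in> ?T"
      unfolding ball_preordering_def using SOS_0 SOS_Const[of "1/2"]
      by (intro CollectI exI[of _ 0] exI[of _ "Const (1 / 2)"]) (auto simp: mult.commute)
    moreover have "Const (1 / 2) * ?s \<in> ?T" "1 \<in> ?T"
      using SOS_square[of 1] by (auto intro!: sos SOS_mult SOS_add SOS_sum SOS_square SOS_Const)
    ultimately show ?thesis unfolding eq by (intro add)
  qed
  show "Const ((R + 1) / 2 + 1) - Var i \<in> ?T" "Const ((R + 1) / 2 + 1) + Var i \<in> ?T" for i
    using lin[of "-1" i] lin[of 1 i] by (simp_all add: Const_uminus)
qed

lemma ball_preordering_subset:
  assumes "ball_poly R \<in> constraint_module E I c" "p \<in> ball_preordering R"
  shows "p \<in> constraint_module E I c"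
proof -
  obtain a b where p: "p = a + b * ball_poly R" and ab: "a \<in> SOS" "b \<in> SOS"
    using assms(2) unfolding ball_preordering_def by (auto simp: mult.commute)
  show ?thesis unfolding p
    by (intro constraint_module_add constraint_module_SOS_mult assms(1) ab SOS_subset_constraint_module[OF ab(1)])
qed

lemma strict_cube_interior: "(\<And>i. \<bar>x $ i\<bar> < \<rho>) \<Longrightarrow> x \<in> interior (cube \<rho> :: (real ^ 'n::finite) set)"
proof (rule interiorI)
  show "open (\<Inter>i\<in>UNIV. {x :: real ^ 'n. \<bar>x $ i\<bar> < \<rho>})"
    by (intro open_INT ballI open_Collect_less continuous_intros) auto
qed (auto simp: cube_def less_imp_le)

lemma feasible_interior_cube:
  assumes "ball_poly R \<in> constraint_module E I c" "R > 0" "feasible E I c x"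
  shows "x \<in> interior (cube ((R + 1) / 2 + 1))"
proof (rule strict_cube_interior)
  fix i
  have "(\<Sum>j\<in>UNIV. (x $ j)\<^sup>2) \<le> R"
    using constraint_module_nonneg[OF assms(1,3)] by (simp add: ball_poly_def)
  moreover have "(x $ i)\<^sup>2 \<le> (\<Sum>j\<in>UNIV. (x $ j)\<^sup>2)" by (rule member_le_sum) auto
  moreover have "R < ((R + 1) / 2 + 1)\<^sup>2"
  proof -
    have "((R + 1) / 2 + 1)\<^sup>2 - R = ((R - 1) / 2)\<^sup>2 + (R + 1) + 1" by (simp add: power2_eq_square field_simps)
    then show ?thesis using assms(2) zero_le_power2[of "(R - 1) / 2"] by linarith
  qed
  ultimately have "(x $ i)\<^sup>2 < ((R + 1) / 2 + 1)\<^sup>2" by linarith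
  then show "\<bar>x $ i\<bar> < (R + 1) / 2 + 1"
    using assms(2) by (simp add: abs_square_less_1 power2_less_imp_less[of "\<bar>x $ i\<bar>"])
qed

section \<open>Nondegenerate minorants\<close>

text \<open>The multiplier rule, strict complementarity and the second order condition in terms of
  Taylor coefficients; the factor 2 between \<open>quad\<close> and the Hessian form does not change
  signs.\<close>

definition second_order_data ::
  "'n::finite mpoly \<Rightarrow> 'j set \<Rightarrow> 'j set \<Rightarrow> ('j \<Rightarrow> 'n mpoly) \<Rightarrow> real ^ 'n \<Rightarrow> ('j \<Rightarrow> real) \<Rightarrow> bool" where
  "second_order_data F E I c s \<mu> \<longleftrightarrow>
    (\<forall>v. lin F s v = (\<Sum>j\<in>E \<union> I. \<mu> j * lin (c j) s v)) \<and>
    (\<forall>j\<in>I. \<mu> j \<ge> 0 \<and> \<mu> j * eval_mpoly (c j) s = 0 \<and> \<mu> j + eval_mpoly (c j) s > 0) \<and>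
    (\<forall>v. v \<noteq> 0 \<longrightarrow> (\<forall>j\<in>E \<union> I. eval_mpoly (c j) s = 0 \<longrightarrow> lin (c j) s v = 0) \<longrightarrow>
        quad F s v - (\<Sum>j\<in>E \<union> I. \<mu> j * quad (c j) s v) > 0)"

lemma second_order_growth:
  fixes F :: "'n::finite mpoly"
  assumes fin: "finite E" "finite I" and EI: "E \<inter> I = {}"
    and feas: "feasible E I c s" and F0: "eval_mpoly F s = 0"
    and dat: "second_order_data F E I c s \<mu>"
    and A: "\<And>j. j \<in> E \<union> I \<Longrightarrow> eval_mpoly (A j) s = \<mu> j"
    and Ann: "\<And>j x. j \<in> I \<Longrightarrow> eval_mpoly (A j) x \<ge> 0"
    and g: "\<gamma> > 0" "\<And>j. j \<in> I \<Longrightarrow> eval_mpoly (c j) s < \<gamma>"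
  shows "eval_mpoly (penalised F E I c A \<gamma> m) s = 0"
    and "\<exists>m. \<exists>\<epsilon>>0. \<forall>\<^sub>F x in nhds s. eval_mpoly (penalised F E I c A \<gamma> m) x \<ge> \<epsilon> * (norm (x - s))\<^sup>2"
proof -
  have *: "\<And>j. j \<in> E \<Longrightarrow> eval_mpoly (c j) s = 0" "\<And>j. j \<in> I \<Longrightarrow> eval_mpoly (c j) s \<ge> 0"
    "\<And>v. lin F s v = (\<Sum>j\<in>E \<union> I. \<mu> j * lin (c j) s v)"
    "\<And>j. j \<in> I \<Longrightarrow> \<mu> j \<ge> 0 \<and> \<mu> j * eval_mpoly (c j) s = 0 \<and> \<mu> j + eval_mpoly (c j) s > 0"
    "\<And>v. v \<noteq> 0 \<Longrightarrow> (\<And>j. j \<in> E \<union> I \<Longrightarrow> eval_mpoly (c j) s = 0 \<Longrightarrow> lin (c j) s v = 0) \<Longrightarrow>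
        quad F s v - (\<Sum>j\<in>E \<union> I. \<mu> j * quad (c j) s v) > 0"
    using feas dat unfolding feasible_def second_order_data_def by blast+
  note growth = penalised_growth[OF fin EI F0 *(1,2,3,4,5) A Ann g]
  show "eval_mpoly (penalised F E I c A \<gamma> m) s = 0" by (rule growth(1))
  show "\<exists>m. \<exists>\<epsilon>>0. \<forall>\<^sub>F x in nhds s. eval_mpoly (penalised F E I c A \<gamma> m) x \<ge> \<epsilon> * (norm (x - s))\<^sup>2"
    by (rule growth(2))
qed

text \<open>An even power times \<open>A j\<close> is a sum of squares, and the equality terms lie
  in the ideal whatever their sign.\<close>

lemma penalised_diff_in_module:
  assumes "\<And>j. j \<in> I \<Longrightarrow> A j \<in> SOS"
  shows "F - penalised F E I c A \<gamma> m \<in> constraint_module E I c"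
proof (rule constraint_moduleI)
  show "F - penalised F E I c A \<gamma> m = (\<Sum>j\<in>E. c j * (A j - Const (real m) * c j))
     + (0 + (\<Sum>j\<in>I. c j * (A j * (1 - Const (1 / \<gamma>) * c j) ^ (2 * m))))"
    by (simp add: penalised_def right_diff_distrib sum_subtractf mult_ac)
  show "0 \<in> SOS" by (rule SOS_0)
  show "A j * (1 - Const (1 / \<gamma>) * c j) ^ (2 * m) \<in> SOS" if "j \<in> I" for j
    using assms[OF that] by (intro SOS_mult SOS_even_power)
qed

text \<open>Each penalty term is nondecreasing in m, so one divergent term decides: a violated
  inequality contributes exponentially in m, a violated equality linearly. At a feasible point all
  penalty terms tend to 0 and F > 0 remains.\<close>

lemma penalised_eventually_positive:
  fixes F :: "'n::finite mpoly"
  assumes fin: "finite E" "finite I"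
    and g: "\<gamma> > 0" "\<And>j. j \<in> I \<Longrightarrow> eval_mpoly (c j) x < \<gamma>"
    and Apos: "\<And>j. j \<in> I \<Longrightarrow> eval_mpoly (A j) x > 0"
    and F: "feasible E I c x \<Longrightarrow> eval_mpoly F x > 0"
  shows "\<exists>m. eval_mpoly (penalised F E I c A \<gamma> m) x > 0"
proof -
  let ?c = "\<lambda>j. eval_mpoly (c j) x" and ?A = "\<lambda>j. eval_mpoly (A j) x"
  define a where "a m j = - (?c j * (?A j * (1 - ?c j / \<gamma>) ^ (2 * m)))" for m j
  define b where "b m j = real m * (?c j * ?c j) - ?A j * ?c j" for m j
  have pen: "eval_mpoly (penalised F E I c A \<gamma> m) x = eval_mpoly F x + (\<Sum>j\<in>I. a m j) + (\<Sum>j\<in>E. b m j)" for m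
    by (simp add: eval_penalised a_def b_def sum_negf)
  have amono: "a 0 j \<le> a m j" if "j \<in> I" for j m
  proof -
    have "?A j * (?c j * (1 - ?c j / \<gamma>) ^ (2 * m)) \<le> ?A j * (?c j * (1 - ?c j / \<gamma>) ^ (2 * 0))"
      using that g(2) Apos by (intro mult_left_mono penalty_power_antimono g(1)) (auto simp: less_imp_le)
    then show ?thesis by (simp add: a_def mult_ac)
  qed
  have bmono: "b 0 j \<le> b m j" for j m by (simp add: b_def)
  define L where "L = eval_mpoly F x + (\<Sum>j\<in>I. a 0 j) + (\<Sum>j\<in>E. b 0 j)"
  have la: "eval_mpoly (penalised F E I c A \<gamma> m) x \<ge> L + (a m j - a 0 j)" if j: "j \<in> I" for m j
  proof -
    have "a m j - a 0 j \<le> (\<Sum>j\<in>I. a m j - a 0 j)"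
      using j fin amono by (intro member_le_sum) auto
    moreover have "(\<Sum>j\<in>E. b 0 j) \<le> (\<Sum>j\<in>E. b m j)" by (intro sum_mono bmono)
    ultimately show ?thesis unfolding pen L_def by (simp add: sum_subtractf)
  qed
  have lb: "eval_mpoly (penalised F E I c A \<gamma> m) x \<ge> L + (b m j - b 0 j)" if j: "j \<in> E" for m j
  proof -
    have "b m j - b 0 j \<le> (\<Sum>j\<in>E. b m j - b 0 j)"
      using j fin bmono by (intro member_le_sum) auto
    moreover have "(\<Sum>j\<in>I. a 0 j) \<le> (\<Sum>j\<in>I. a m j)" by (intro sum_mono amono)
    ultimately show ?thesis unfolding pen L_def by (simp add: sum_subtractf)
  qed
  consider (feas) "feasible E I c x" | (I) j where "j \<in> I" "?c j < 0" | (E) j where "j \<in> E" "?c j \<noteq> 0"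
    unfolding feasible_def by force
  then show ?thesis
  proof cases
    case feas
    have "(\<lambda>m. eval_mpoly F x + (\<Sum>j\<in>I. a m j) + (\<Sum>j\<in>E. b m j)) \<longlonglongrightarrow> eval_mpoly F x + (\<Sum>j\<in>I. 0) + (\<Sum>j\<in>E. 0)"
    proof (intro tendsto_add tendsto_const tendsto_sum)
      fix j assume j: "j \<in> I"
      show "(\<lambda>m. a m j) \<longlonglongrightarrow> 0"
      proof (cases "?c j = 0")
        case False
        then have "0 < ?c j" "?c j < \<gamma>" using feas g(2)[OF j] j by (auto simp: feasible_def order_le_less)
        then have "0 < 1 - ?c j / \<gamma>" "1 - ?c j / \<gamma> < 1" using g(1) by auto
        then have "\<bar>(1 - ?c j / \<gamma>)\<^sup>2\<bar> < 1" by (auto simp: abs_square_less_1)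
        then have "(\<lambda>m. - (?c j * (?A j * ((1 - ?c j / \<gamma>)\<^sup>2) ^ m))) \<longlonglongrightarrow> - (?c j * (?A j * 0))"
          by (intro tendsto_minus tendsto_mult tendsto_const LIMSEQ_power_zero) auto
        then show ?thesis by (simp add: a_def power_mult)
      qed (simp add: a_def)
    next
      fix j assume "j \<in> E"
      then show "(\<lambda>m. b m j) \<longlonglongrightarrow> 0" using feas by (simp add: b_def feasible_def)
    qed
    then have "\<forall>\<^sub>F m in sequentially. eval_mpoly (penalised F E I c A \<gamma> m) x > 0"
      using F[OF feas] unfolding pen by (intro order_tendstoD) auto
    then show ?thesis by (auto simp: eventually_sequentially)
  next
    case I
    define q where "q = (1 - ?c j / \<gamma>)\<^sup>2"
    have "1 - ?c j / \<gamma> > 1" using I g(1) by (simp add: divide_neg_pos)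
    then have q: "q > 1" unfolding q_def by simp
    define k where "k = - (?c j * ?A j)"
    have k: "k > 0" using I Apos[OF I(1)] by (simp add: k_def mult_neg_pos)
    have am: "a m j = k * q ^ m" for m by (simp add: a_def k_def q_def power_mult)
    obtain m where "q ^ m > (k - L) / k" using real_arch_pow[OF q] by blast
    then have "k * q ^ m > k - L" using k by (simp add: pos_divide_less_eq mult.commute)
    then show ?thesis using la[OF I(1), of m] by (intro exI[of _ m]) (simp add: am)
  next
    case E
    have sq: "?c j * ?c j > 0" using E by (simp add: zero_less_mult_iff) linarith
    obtain m :: nat where "real m > - L / (?c j * ?c j)" using reals_Archimedean2 by blast
    then have "real m * (?c j * ?c j) > - L" unfolding pos_divide_less_eq[OF sq] .
    then show ?thesis using lb[OF E(1), of m] by (intro exI[of _ m]) (simp add: b_def)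
  qed
qed

text \<open>Growth near S and positivity away from S are each reached for some m, and monotonicity
  in m on the cube allows one common m. The case of empty S is used for infeasible problems.\<close>

lemma nondegenerate_minorant:
  fixes F :: "'n::finite mpoly"
  assumes fin: "finite E" "finite I" and EI: "E \<inter> I = {}" and finS: "finite S"
    and S: "\<And>s. s \<in> S \<Longrightarrow> feasible E I c s \<and> eval_mpoly F s = 0 \<and> (\<exists>\<mu>. second_order_data F E I c s \<mu>)"
    and F: "\<And>x. feasible E I c x \<Longrightarrow> x \<notin> S \<Longrightarrow> eval_mpoly F x > 0"
    and int: "\<And>s. s \<in> S \<Longrightarrow> s \<in> interior (cube \<rho>)"
  obtains G where "nondegenerate \<rho> G S" "F - G \<in> constraint_module E I c"
proof -
  obtain \<mu> where mu: "\<And>s. s \<in> S \<Longrightarrow> second_order_data F E I c s (\<mu> s)" using S by metis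
  have munn: "\<mu> s j \<ge> 0" if "s \<in> S" "j \<in> I" for s j
    using mu[OF that(1)] that(2) by (simp add: second_order_data_def)
  have "\<exists>C>0. \<forall>x\<in>cube \<rho>. eval_mpoly (c j) x < C" for j
    by (rule compact_bounded_above[OF compact_cube continuous_on_eval]) blast
  then obtain C where C: "\<And>j. C j > 0" "\<And>j x. x \<in> cube \<rho> \<Longrightarrow> eval_mpoly (c j) x < C j" by metis
  \<comment> \<open>Exceeds every inequality constraint on the cube, so the base 1 - c_j / \<gamma>
    is positive there.\<close>
  define \<gamma> where "\<gamma> = 1 + (\<Sum>j\<in>I. C j)"
  have g0: "\<gamma> > 0" unfolding \<gamma>_def using C(1) by (intro add_pos_nonneg sum_nonneg) (auto simp: less_imp_le)
  have g: "eval_mpoly (c j) x < \<gamma>" if "j \<in> I" "x \<in> cube \<rho>" for j x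
    using C(2)[OF that(2), of j] member_le_sum[OF that(1), of C] C(1) fin by (auto simp: \<gamma>_def less_imp_le)
  define q where "q = (\<Prod>s\<in>S. \<Sum>i\<in>UNIV. (shifted s i)\<^sup>2)"
  have q: "eval_mpoly q x = 0 \<longleftrightarrow> x \<in> S" for x
  proof -
    have "(\<Sum>i\<in>UNIV. (x $ i - s $ i)\<^sup>2) = 0 \<longleftrightarrow> x = s" for s
      by (auto simp: sum_nonneg_eq_0_iff Finite_Cartesian_Product.vec_eq_iff)
    then show ?thesis using finS by (auto simp: q_def)
  qed
  have "\<exists>p. \<forall>s\<in>S. eval_mpoly p s = (if j \<in> I then sqrt (\<mu> s j) else \<mu> s j)" for j
    by (rule interpolation[OF finS, of "\<lambda>s. if j \<in> I then sqrt (\<mu> s j) else \<mu> s j"]) blast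
  then obtain p where p: "\<And>j s. s \<in> S \<Longrightarrow> eval_mpoly (p j) s = (if j \<in> I then sqrt (\<mu> s j) else \<mu> s j)" by metis
  \<comment> \<open>The square of an interpolant of the roots of the multipliers makes
    \<open>A j\<close> a sum of squares; adding q^2, which vanishes exactly on S, makes it positive
    off S without changing it on S. Equality multipliers have no sign and are interpolated
    directly.\<close>
  define A where "A j = (if j \<in> I then (p j)\<^sup>2 + q\<^sup>2 else p j)" for j
  have Amu: "eval_mpoly (A j) s = \<mu> s j" if "s \<in> S" for s j
    using that p munn q[of s] by (simp add: A_def)
  have ASOS: "A j \<in> SOS" if "j \<in> I" for j
    using that by (simp add: A_def SOS_add SOS_square)
  have Apos: "eval_mpoly (A j) x > 0" if "j \<in> I" "x \<notin> S" for j x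
    using that q[of x] by (simp add: A_def add_nonneg_pos)
  let ?G = "\<lambda>m. penalised F E I c A \<gamma> m"
  have mono: "eval_mpoly (?G m) x \<le> eval_mpoly (?G m') x" if "x \<in> cube \<rho>" "m \<le> m'" for m m' x
    by (rule penalised_mono[OF g0]) (use that g ASOS in \<open>auto intro: SOS_nonneg simp: less_imp_le\<close>)
  have intc: "s \<in> cube \<rho>" if "s \<in> S" for s using int[OF that] interior_subset by blast
  have G0: "eval_mpoly (?G m) s = 0"
    and ex_growth: "\<exists>m. \<exists>\<epsilon>>0. \<forall>\<^sub>F x in nhds s. eval_mpoly (?G m) x \<ge> \<epsilon> * (norm (x - s))\<^sup>2" if s: "s \<in> S" for s m
    using second_order_growth[OF fin EI _ _ mu[OF s] Amu[OF s] SOS_nonneg[OF ASOS] g0 g[OF _ intc[OF s]]] S[OF s] by blast+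
  have "\<forall>s\<in>S. \<exists>w. snd w > 0 \<and> (\<forall>\<^sub>F x in nhds s. eval_mpoly (?G (fst w)) x \<ge> snd w * (norm (x - s))\<^sup>2)"
  proof
    fix s assume "s \<in> S"
    from ex_growth[OF this] obtain m e where "e > 0" "\<forall>\<^sub>F x in nhds s. eval_mpoly (?G m) x \<ge> e * (norm (x - s))\<^sup>2"
      by (elim exE conjE)
    then show "\<exists>w. snd w > 0 \<and> (\<forall>\<^sub>F x in nhds s. eval_mpoly (?G (fst w)) x \<ge> snd w * (norm (x - s))\<^sup>2)"
      by (intro exI[of _ "(m, e)"]) simp
  qed
  from bchoice[OF this] obtain w where w: "\<forall>s\<in>S. snd (w s) > 0 \<and> (\<forall>\<^sub>F x in nhds s. eval_mpoly (?G (fst (w s))) x \<ge> snd (w s) * (norm (x - s))\<^sup>2)"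
    by (elim exE)
  define ms where "ms s = fst (w s)" for s
  define \<epsilon> where "\<epsilon> s = snd (w s)" for s
  have growth: "\<epsilon> s > 0 \<and> (\<forall>\<^sub>F x in nhds s. eval_mpoly (?G (ms s)) x \<ge> \<epsilon> s * (norm (x - s))\<^sup>2)" if "s \<in> S" for s
    using w[rule_format, OF that] by (simp only: ms_def \<epsilon>_def)
  define m1 where "m1 = Max (insert 0 (ms ` S))"
  have m1: "ms s \<le> m1" if "s \<in> S" for s unfolding m1_def using that finS by (intro Max_ge) auto
  have ex_V: "\<exists>V. open V \<and> s \<in> V \<and> V \<subseteq> cube \<rho> \<and> (\<forall>x\<in>V. eval_mpoly (?G (ms s)) x \<ge> \<epsilon> s * (norm (x - s))\<^sup>2)" if s: "s \<in> S" for s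
  proof -
    have "\<forall>\<^sub>F x in nhds s. x \<in> interior (cube \<rho>) \<and> eval_mpoly (?G (ms s)) x \<ge> \<epsilon> s * (norm (x - s))\<^sup>2"
      using growth[OF s] eventually_nhds_in_open[OF open_interior int[OF s]] by (simp add: eventually_conj_iff)
    then obtain V where "open V" "s \<in> V" "\<forall>x\<in>V. x \<in> interior (cube \<rho>) \<and> eval_mpoly (?G (ms s)) x \<ge> \<epsilon> s * (norm (x - s))\<^sup>2"
      unfolding eventually_nhds by blast
    then show ?thesis using interior_subset by blast
  qed
  have "\<forall>s\<in>S. \<exists>V. open V \<and> s \<in> V \<and> V \<subseteq> cube \<rho> \<and> (\<forall>x\<in>V. eval_mpoly (?G (ms s)) x \<ge> \<epsilon> s * (norm (x - s))\<^sup>2)"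
    by (intro ballI ex_V)
  from bchoice[OF this] obtain V where V': "\<forall>s\<in>S. open (V s) \<and> s \<in> V s \<and> V s \<subseteq> cube \<rho> \<and> (\<forall>x\<in>V s. eval_mpoly (?G (ms s)) x \<ge> \<epsilon> s * (norm (x - s))\<^sup>2)"
    by (elim exE)
  note V = V'[rule_format]
  define Z where "Z = cube \<rho> - (\<Union>s\<in>S. V s)"
  have Z: "compact Z" unfolding Z_def by (intro compact_diff compact_cube open_UN) (use V in auto)
  have ZS: "x \<in> cube \<rho>" "x \<notin> S" if "x \<in> Z" for x using that V by (auto simp: Z_def)
  have ex: "\<exists>m. eval_mpoly (?G m) x > 0" if "x \<in> Z" for x
    by (rule penalised_eventually_positive[OF fin g0]) (use ZS[OF that] g Apos F in auto)
  obtain m2 where m2: "\<And>x. x \<in> Z \<Longrightarrow> eval_mpoly (?G m2) x > 0"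
    using monotone_eventually_positive_on_compact[of Z "\<lambda>m. eval_mpoly (?G m)", OF Z continuous_on_eval mono ex] ZS by blast
  define m where "m = max m1 m2"
  have near: "eval_mpoly (?G m) x \<ge> \<epsilon> s * (norm (x - s))\<^sup>2" if "s \<in> S" "x \<in> V s" for s x
  proof -
    have "ms s \<le> m" using m1[OF that(1)] by (simp add: m_def)
    moreover have "x \<in> cube \<rho>" using V that by blast
    ultimately show ?thesis using mono V that by (meson order_trans)
  qed
  have "eval_mpoly (?G m) x > 0" if x: "x \<in> cube \<rho> - S" for x
  proof (cases "x \<in> Z")
    case True
    then show ?thesis using m2[OF True] mono[of x m2 m] x by (auto simp: m_def)
  next
    case False
    then obtain s where s: "s \<in> S" "x \<in> V s" using x by (auto simp: Z_def)
    then have "x - s \<noteq> 0" using x by auto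
    then have "\<epsilon> s * (norm (x - s))\<^sup>2 > 0" using growth[OF s(1)] by simp
    then show ?thesis using near[OF s] by linarith
  qed
  moreover have "\<exists>\<epsilon>>0. \<forall>\<^sub>F x in nhds s. eval_mpoly (?G m) x \<ge> \<epsilon> * (norm (x - s))\<^sup>2" if s: "s \<in> S" for s
    using growth[OF s] near[OF s] V[OF s] unfolding eventually_nhds by blast
  ultimately have "nondegenerate \<rho> (?G m) S"
    using finS int G0 unfolding nondegenerate_def by blast
  then show ?thesis by (rule that) (rule penalised_diff_in_module[OF ASOS])
qed

section \<open>The minimizers\<close>

lemma second_order_data_minimizer:
  fixes f :: "'n::finite mpoly"
  assumes fin: "finite E" "finite I" and EI: "E \<inter> I = {}" and min: "minimizer f E I c s"
    and oc: "LICQC E I c s" "SCC f E I c s" "SOSC f E I c s"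
  shows "\<exists>\<mu>. second_order_data (f - Const a) E I c s \<mu>"
proof -
  obtain \<mu> where mu: "multipliers f E I c s \<mu>"
    using LICQC_multipliers_exist[OF fin EI min oc(1)] by blast
  have "lin (f - Const a) s v = (\<Sum>j\<in>E \<union> I. \<mu> j * lin (c j) s v)" for v
  proof -
    have "lin (f - Const a) s v = lin f s v" by (simp add: lin_diff)
    then show ?thesis using mu by (simp add: multipliers_def lin_eq_gradient inner_sum_right)
  qed
  moreover have "quad (f - Const a) s v - (\<Sum>j\<in>E \<union> I. \<mu> j * quad (c j) s v) > 0"
    if v: "v \<noteq> 0" "\<forall>j\<in>E \<union> I. eval_mpoly (c j) s = 0 \<longrightarrow> lin (c j) s v = 0" for v
  proof -
    define P where "P = f - (\<Sum>j\<in>E \<union> I. Const (\<mu> j) * c j)"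
    have "lagrangian f E I c \<mu> = eval_mpoly P"
      by (rule ext) (simp add: lagrangian_def P_def)
    then have "v \<bullet> (hessian (eval_mpoly P) s *v v) > 0"
      using oc(3) mu v by (auto simp: SOSC_def active_def lin_eq_gradient)
    then have "quad P s v > 0" unfolding quad_eq_hessian[symmetric] by simp
    then show ?thesis by (simp add: P_def quad_diff quad_sum quad_mult)
  qed
  ultimately show ?thesis
    using mu oc(2) unfolding second_order_data_def SCC_def multipliers_def by blast
qed

text \<open>An accumulation point l of minimizers is itself a minimizer. Some penalised objective
  grows quadratically at l, yet is at most 0 at every minimizer, a contradiction.\<close>

lemma finite_minimizers:
  fixes f :: "'n::finite mpoly"
  assumes fin: "finite E" "finite I" and EI: "E \<inter> I = {}"
    and feas: "\<And>x. feasible E I c x \<Longrightarrow> x \<in> cube \<rho>"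
    and oc: "\<And>x. minimizer f E I c x \<Longrightarrow> LICQC E I c x \<and> SCC f E I c x \<and> SOSC f E I c x"
  shows "finite {x. minimizer f E I c x}"
proof (rule ccontr)
  let ?S = "{x. minimizer f E I c x}"
  assume inf: "infinite ?S"
  then obtain s where s: "minimizer f E I c s" by (metis finite.emptyI empty_iff mem_Collect_eq subsetI finite_subset)
  define a where "a = eval_mpoly f s"
  have min_iff: "minimizer f E I c x \<longleftrightarrow> feasible E I c x \<and> eval_mpoly f x = a" for x
    using s by (fastforce simp: minimizer_def is_arg_min_linorder a_def)
  have "?S \<subseteq> cube \<rho>" using feas min_iff by auto
  then obtain l where l: "l islimpt ?S"
    using inf compact_cube compact_eq_Bolzano_Weierstrass by metis
  have "closed ?S"
  proof -
    have "?S = (\<Inter>j\<in>E. {x. eval_mpoly (c j) x = 0}) \<inter> (\<Inter>j\<in>I. {x. eval_mpoly (c j) x \<ge> 0}) \<inter> {x. eval_mpoly f x = a}"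
      by (auto simp: min_iff feasible_def)
    then show ?thesis
      by (auto intro!: closed_Int closed_INT closed_Collect_eq closed_Collect_le continuous_on_eval)
  qed
  then have lS: "minimizer f E I c l" using l by (auto simp: closed_limpt)
  obtain \<mu> where mu: "second_order_data (f - Const a) E I c l \<mu>"
    using second_order_data_minimizer[OF fin EI lS] oc[OF lS] by blast
  have munn: "\<mu> j \<ge> 0" if "j \<in> I" for j using mu that by (simp add: second_order_data_def)
  define \<gamma> where "\<gamma> = 1 + (\<Sum>j\<in>I. \<bar>eval_mpoly (c j) l\<bar>)"
  have g: "\<gamma> > 0" "\<And>j. j \<in> I \<Longrightarrow> eval_mpoly (c j) l < \<gamma>"
  proof -
    show "\<gamma> > 0" unfolding \<gamma>_def by (simp add: add_pos_nonneg sum_nonneg)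
    fix j assume "j \<in> I"
    then show "eval_mpoly (c j) l < \<gamma>"
      using member_le_sum[of j I "\<lambda>j. \<bar>eval_mpoly (c j) l\<bar>"] fin by (simp add: \<gamma>_def)
  qed
  \<comment> \<open>Constant \<open>A j\<close> are enough at the single point l and avoid
    interpolation on the set whose finiteness is at stake.\<close>
  let ?G = "\<lambda>m. penalised (f - Const a) E I c (\<lambda>j. Const (\<mu> j)) \<gamma> m"
  obtain m \<epsilon> where e: "\<epsilon> > 0" "\<forall>\<^sub>F x in nhds l. eval_mpoly (?G m) x \<ge> \<epsilon> * (norm (x - l))\<^sup>2"
    using second_order_growth(2)[OF fin EI _ _ mu _ _ g, of "\<lambda>j. Const (\<mu> j)"] lS munn min_iff by auto
  have "eval_mpoly (?G m) x \<le> 0" if "x \<in> ?S" for x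
    using that munn unfolding eval_penalised min_iff by (auto simp: min_iff feasible_def intro!: sum_nonneg)
  then have "\<forall>\<^sub>F x in nhds l. x \<in> ?S \<longrightarrow> x = l"
    using e(2)
  proof (elim eventually_mono, intro impI)
    fix x assume "\<epsilon> * (norm (x - l))\<^sup>2 \<le> eval_mpoly (?G m) x" "x \<in> ?S" "\<And>x. x \<in> ?S \<Longrightarrow> eval_mpoly (?G m) x \<le> 0"
    then have "\<epsilon> * (norm (x - l))\<^sup>2 \<le> 0" by force
    then show "x = l" using e(1) by (simp add: mult_le_0_iff)
  qed
  then show False using l unfolding islimpt_def eventually_nhds by blast
qed

section \<open>Rank of a matrix indexed by a finite set\<close>

text \<open>Independence of columns as an indexed family: exponents themselves can index rows and
  columns, and repeated columns count as dependent.\<close>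

definition indep_columns :: "('i \<Rightarrow> 'k \<Rightarrow> real) \<Rightarrow> 'i set \<Rightarrow> 'k set \<Rightarrow> bool" where
  "indep_columns m R J \<longleftrightarrow> (\<forall>a. (\<forall>i\<in>R. (\<Sum>j\<in>J. a j * m i j) = 0) \<longrightarrow> (\<forall>j\<in>J. a j = 0))"

lemma lin_indpt_iff_indep_columns:
  fixes A :: "real Matrix.mat"
  assumes A: "A \<in> carrier_mat n nc" and J: "J \<subseteq> {..<nc}"
  shows "inj_on (Matrix.col A) J \<and> \<not> module.lin_dep class_ring (module_vec TYPE(real) n) (Matrix.col A ` J)
    \<longleftrightarrow> indep_columns (\<lambda>i j. A $$ (i, j)) {..<n} J"
proof -
  interpret vec_space "TYPE(real)" n .
  have fin: "finite J" using J finite_subset by blast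
  have carr: "Matrix.col A ` J \<subseteq> carrier_vec n" using A by auto
  have entry: "Matrix.vec_index (Matrix.col A j) i = A $$ (i, j)" if "i < n" "j \<in> J" for i j
    using that A J by (auto simp: Matrix.col_def)
  have comb: "Matrix.vec_index (lincomb b (Matrix.col A ` J)) i = (\<Sum>j\<in>J. b (Matrix.col A j) * A $$ (i, j))"
    if "inj_on (Matrix.col A) J" "i < n" for b i
    using that entry by (simp add: lincomb_index[OF _ carr] sum.reindex)
  show ?thesis
  proof (intro iffI conjI)
    assume h: "inj_on (Matrix.col A) J \<and> lin_indpt (Matrix.col A ` J)"
    show "indep_columns (\<lambda>i j. A $$ (i, j)) {..<n} J"
      unfolding indep_columns_def
    proof (intro allI impI ballI)
      fix a j assume a: "\<forall>i\<in>{..<n}. (\<Sum>j\<in>J. a j * A $$ (i, j)) = 0" and j: "j \<in> J"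
      define b where "b v = a (the_inv_into J (Matrix.col A) v)" for v
      have b: "b (Matrix.col A j) = a j" if "j \<in> J" for j
        using h that by (simp add: b_def the_inv_into_f_f)
      have "lincomb b (Matrix.col A ` J) = 0\<^sub>v n"
      proof (rule eq_vecI)
        fix i assume "i < dim_vec (0\<^sub>v n :: real Matrix.vec)"
        then have i: "i < n" by simp
        have "Matrix.vec_index (lincomb b (Matrix.col A ` J)) i = (\<Sum>j\<in>J. a j * A $$ (i, j))"
          using h b by (simp add: comb[OF _ i])
        then show "Matrix.vec_index (lincomb b (Matrix.col A ` J)) i = Matrix.vec_index (0\<^sub>v n) i"
          using a i by simp
      qed (use lincomb_dim fin carr in simp)
      then have "b \<in> Matrix.col A ` J \<rightarrow> {0}"
        using h fin by (intro not_lindepD[of "Matrix.col A ` J"]) auto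
      then show "a j = 0" using b[OF j] j by (metis Pi_mem imageI singletonD)
    qed
  next
    assume h: "indep_columns (\<lambda>i j. A $$ (i, j)) {..<n} J"
    show inj: "inj_on (Matrix.col A) J"
    proof (rule inj_onI, rule ccontr)
      fix j k assume jk: "j \<in> J" "k \<in> J" "Matrix.col A j = Matrix.col A k" "j \<noteq> k"
      define a where "a l = (if l = j then 1 else if l = k then -1 else 0 :: real)" for l
      have "(\<Sum>l\<in>J. a l * A $$ (i, l)) = 0" if i: "i < n" for i
      proof -
        have "(\<Sum>l\<in>J. a l * A $$ (i, l)) = (\<Sum>l\<in>{j, k}. a l * A $$ (i, l))"
          by (rule sum.mono_neutral_right) (use fin jk in \<open>auto simp: a_def\<close>)
        also have "\<dots> = A $$ (i, j) - A $$ (i, k)" using jk by (simp add: a_def)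
        also have "\<dots> = 0" using entry[OF i jk(1)] entry[OF i jk(2)] jk(3) by simp
        finally show ?thesis .
      qed
      then have "a j = 0" using h jk(1) unfolding indep_columns_def by blast
      then show False by (simp add: a_def)
    qed
    show "lin_indpt (Matrix.col A ` J)"
    proof (rule finite_lin_indpt2)
      fix b assume b: "lincomb b (Matrix.col A ` J) = 0\<^sub>v n"
      have "(\<Sum>j\<in>J. b (Matrix.col A j) * A $$ (i, j)) = 0" if "i < n" for i
        using comb[OF inj that, of b] that by (simp add: b)
      then have "\<forall>j\<in>J. b (Matrix.col A j) = 0"
        using h unfolding indep_columns_def by (auto dest: spec[of _ "\<lambda>j. b (Matrix.col A j)"])
      then show "\<forall>v\<in>Matrix.col A ` J. b v = 0" by blast
    qed (use fin carr in auto)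
  qed
qed

lemma rank_eq_card_indep_columns:
  fixes A :: "real Matrix.mat"
  assumes A: "A \<in> carrier_mat n nc" and J: "J \<subseteq> {..<nc}"
    and ind: "indep_columns (\<lambda>i j. A $$ (i, j)) {..<n} J"
    and max: "\<And>k. k < nc \<Longrightarrow> k \<notin> J \<Longrightarrow> \<not> indep_columns (\<lambda>i j. A $$ (i, j)) {..<n} (insert k J)"
  shows "vec_space.rank n A = card J"
proof -
  interpret vec_space "TYPE(real)" n .
  have li: "inj_on (Matrix.col A) J" "lin_indpt (Matrix.col A ` J)"
    using lin_indpt_iff_indep_columns[OF A J] ind by auto
  have cols: "set (cols A) = Matrix.col A ` {..<nc}" using A by (auto simp: cols_def)
  have "maximal (Matrix.col A ` J) (\<lambda>T. T \<subseteq> set (cols A) \<and> lin_indpt T)"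
    unfolding maximal_def
  proof (intro conjI allI impI)
    show "Matrix.col A ` J \<subseteq> set (cols A)" using J cols by auto
    show "lin_indpt (Matrix.col A ` J)" by (rule li(2))
    fix T assume T: "Matrix.col A ` J \<subseteq> T \<and> T \<subseteq> set (cols A) \<and> lin_indpt T"
    show "T = Matrix.col A ` J"
    proof (rule ccontr)
      assume "T \<noteq> Matrix.col A ` J"
      then obtain v where v: "v \<in> T" "v \<notin> Matrix.col A ` J" using T by auto
      then have "v \<in> Matrix.col A ` {..<nc}" using T unfolding cols by auto
      then obtain k where k: "k < nc" "Matrix.col A k \<in> T" "Matrix.col A k \<notin> Matrix.col A ` J"
        using v by auto
      have "lin_indpt (Matrix.col A ` insert k J)"
        by (rule subset_li_is_li[of T]) (use T k in auto)
      moreover have "inj_on (Matrix.col A) (insert k J)" using li(1) k by auto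
      ultimately have "indep_columns (\<lambda>i j. A $$ (i, j)) {..<n} (insert k J)"
        using lin_indpt_iff_indep_columns[OF A, of "insert k J"] J k by auto
      moreover have "k \<notin> J" using k by auto
      ultimately show False using max k by blast
    qed
  qed
  then have "rank A = card (Matrix.col A ` J)" by (rule rank_card_indpt[OF A])
  then show ?thesis using li(1) by (simp add: card_image)
qed

definition indexed_mat :: "('a \<Rightarrow> 'a \<Rightarrow> real) \<Rightarrow> 'a set \<Rightarrow> real Matrix.mat" where
  "indexed_mat m R = Matrix.mat (card R) (card R) (\<lambda>(i, j). m (from_nat_into R i) (from_nat_into R j))"

lemma mat_rank_indexed_mat:
  assumes fin: "finite R" and J: "J \<subseteq> R" and ind: "indep_columns m R J"
    and max: "\<And>k. k \<in> R \<Longrightarrow> k \<notin> J \<Longrightarrow> \<not> indep_columns m R (insert k J)"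
  shows "mat_rank (indexed_mat m R) = card J"
proof -
  let ?A = "indexed_mat m R" and ?e = "from_nat_into R" and ?n = "card R"
  have A: "?A \<in> carrier_mat ?n ?n" by (simp add: indexed_mat_def)
  have bij: "bij_betw ?e {..<?n} R" by (rule bij_betw_from_nat_into_finite[OF fin])
  have trans: "indep_columns (\<lambda>i j. ?A $$ (i, j)) {..<?n} N \<longleftrightarrow> indep_columns m R (?e ` N)" if N: "N \<subseteq> {..<?n}" for N
  proof -
    have inj: "inj_on ?e N" using bij N by (auto simp: bij_betw_def intro: inj_on_subset)
    have R: "R = ?e ` {..<?n}" using bij by (simp add: bij_betw_def)
    have s: "(\<Sum>j\<in>?e ` N. a j * m (?e i) j) = (\<Sum>j\<in>N. a (?e j) * ?A $$ (i, j))" if "i < ?n" for a i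
      using that N by (auto simp: sum.reindex[OF inj] indexed_mat_def intro!: sum.cong)
    show ?thesis
    proof
      assume h: "indep_columns (\<lambda>i j. ?A $$ (i, j)) {..<?n} N"
      show "indep_columns m R (?e ` N)" unfolding indep_columns_def
      proof (intro allI impI)
        fix a assume "\<forall>i\<in>R. (\<Sum>j\<in>?e ` N. a j * m i j) = 0"
        then have "\<forall>i\<in>{..<?n}. (\<Sum>j\<in>N. a (?e j) * ?A $$ (i, j)) = 0" by (subst (asm) R) (auto simp: s)
        then have "\<forall>j\<in>N. a (?e j) = 0" using h unfolding indep_columns_def by (auto dest: spec[of _ "\<lambda>j. a (?e j)"])
        then show "\<forall>j\<in>?e ` N. a j = 0" by blast
      qed
    next
      assume h: "indep_columns m R (?e ` N)"
      show "indep_columns (\<lambda>i j. ?A $$ (i, j)) {..<?n} N" unfolding indep_columns_def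
      proof (intro allI impI)
        fix a assume a: "\<forall>i\<in>{..<?n}. (\<Sum>j\<in>N. a j * ?A $$ (i, j)) = 0"
        define b where "b v = a (the_inv_into N ?e v)" for v
        have b: "b (?e j) = a j" if "j \<in> N" for j using inj that by (simp add: b_def the_inv_into_f_f)
        have "\<forall>i\<in>R. (\<Sum>j\<in>?e ` N. b j * m i j) = 0" by (subst R) (use a b in \<open>auto simp: s\<close>)
        then have "\<forall>j\<in>?e ` N. b j = 0" using h unfolding indep_columns_def by blast
        then show "\<forall>j\<in>N. a j = 0" using b by auto
      qed
    qed
  qed
  define N where "N = {i. i < ?n \<and> ?e i \<in> J}"
  have N: "N \<subseteq> {..<?n}" by (auto simp: N_def)
  have eN: "?e ` N = J" using J bij by (force simp: N_def bij_betw_def)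
  have "vec_space.rank ?n ?A = card N"
  proof (rule rank_eq_card_indep_columns[OF A N])
    show "indep_columns (\<lambda>i j. ?A $$ (i, j)) {..<?n} N" using trans[OF N] ind eN by simp
    fix k assume k: "k < ?n" "k \<notin> N"
    then have "?e k \<in> R" "?e k \<notin> J" using bij by (auto simp: N_def bij_betw_def)
    then have "\<not> indep_columns m R (insert (?e k) J)" by (rule max)
    then show "\<not> indep_columns (\<lambda>i j. ?A $$ (i, j)) {..<?n} (insert k N)"
      using trans[of "insert k N"] N k by (simp add: eN)
  qed
  moreover have "card N = card J"
    unfolding eN[symmetric] using bij N by (intro card_image[symmetric]) (auto simp: bij_betw_def intro: inj_on_subset)
  ultimately show ?thesis using A by (simp add: mat_rank_def)
qed

lemma not_indep_columns_insertD:
  assumes "finite J" "k \<notin> J" "indep_columns m R J" "\<not> indep_columns m R (insert k J)"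
  obtains b where "\<And>i. i \<in> R \<Longrightarrow> m i k = (\<Sum>j\<in>J. b j * m i j)"
proof -
  obtain a l where a: "\<forall>i\<in>R. (\<Sum>j\<in>insert k J. a j * m i j) = 0" and l: "l \<in> insert k J" "a l \<noteq> 0"
    using assms(4) unfolding indep_columns_def by blast
  have a': "a k * m i k = - (\<Sum>j\<in>J. a j * m i j)" if "i \<in> R" for i
    using a that assms(1,2) by (simp add: eq_neg_iff_add_eq_0)
  have "a k \<noteq> 0"
  proof
    assume k0: "a k = 0"
    then have "\<forall>i\<in>R. (\<Sum>j\<in>J. a j * m i j) = 0" using a' by simp
    then have "\<forall>j\<in>J. a j = 0" using assms(3) unfolding indep_columns_def by blast
    then show False using l k0 by auto
  qed
  show ?thesis
  proof (rule that[of "\<lambda>j. - a j / a k"])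
    fix i assume i: "i \<in> R"
    have "(\<Sum>j\<in>J. - a j / a k * m i j) = - (\<Sum>j\<in>J. a j * m i j) / a k"
      by (simp add: sum_divide_distrib sum_negf)
    also have "\<dots> = m i k" using a'[OF i] \<open>a k \<noteq> 0\<close> by (simp add: field_simps)
    finally show "m i k = (\<Sum>j\<in>J. - a j / a k * m i j)" by simp
  qed
qed

lemma indep_columns_antimono: "R \<subseteq> R' \<Longrightarrow> indep_columns m R J \<Longrightarrow> indep_columns m R' J"
  unfolding indep_columns_def by blast

text \<open>All rows are combinations of those in A, and by symmetry so are all columns. Hence a
  maximal independent set J of columns from A spans all columns, and a relation among them on the
  rows of A extends to the rows of B; both ranks are the size of J.\<close>

lemma mat_rank_reduction:
  assumes fin: "finite B" and AB: "A \<subseteq> B" and sym: "\<And>i j. m i j = m j i"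
    and red: "\<And>i j. i \<in> B \<Longrightarrow> j \<in> B \<Longrightarrow> m i j = (\<Sum>\<gamma>\<in>A. P \<gamma> i * m \<gamma> j)"
  shows "mat_rank (indexed_mat m A) = mat_rank (indexed_mat m B)"
proof -
  have finA: "finite A" using fin AB finite_subset by blast
  \<comment> \<open>Columns from A, but tested against the rows of B.\<close>
  define Js where "Js = {J. J \<subseteq> A \<and> indep_columns m B J}"
  have finJs: "finite Js" using finA by (simp add: Js_def)
  have "{} \<in> Js" by (simp add: Js_def indep_columns_def)
  then have "Max (card ` Js) \<in> card ` Js" using finJs by (intro Max_in) auto
  then obtain J where J: "J \<in> Js" "card J = Max (card ` Js)" by auto
  have Jmax: "card J' \<le> card J" if "J' \<in> Js" for J'
    unfolding J(2) using that finJs by (intro Max_ge) auto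
  have JA: "J \<subseteq> A" and ind: "indep_columns m B J" using J(1) by (auto simp: Js_def)
  have finJ: "finite J" using JA finA finite_subset by blast
  have maxA: "\<not> indep_columns m B (insert k J)" if k: "k \<in> A" "k \<notin> J" for k
  proof
    assume "indep_columns m B (insert k J)"
    then have "insert k J \<in> Js" using k JA by (simp add: Js_def)
    then show False using Jmax[of "insert k J"] finJ k by simp
  qed
  have ex_b: "\<exists>b. \<forall>i\<in>B. m i k = (\<Sum>j\<in>J. b j * m i j)" if k: "k \<in> A" for k
  proof (cases "k \<in> J")
    case True
    have "m i k = (\<Sum>j\<in>J. (if j = k then 1 else 0) * m i j)" for i
      using True finJ by (simp add: if_distrib[of "\<lambda>x. x * _"] cong: if_cong)
    then show ?thesis by (intro exI[of _ "\<lambda>j. if j = k then 1 else 0"] ballI)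
  next
    case False
    obtain b where "\<And>i. i \<in> B \<Longrightarrow> m i k = (\<Sum>j\<in>J. b j * m i j)"
      by (rule not_indep_columns_insertD[OF finJ False ind maxA[OF k False]]) (rule that)
    then show ?thesis by (intro exI[of _ b] ballI)
  qed
  have "\<forall>k\<in>A. \<exists>b. \<forall>i\<in>B. m i k = (\<Sum>j\<in>J. b j * m i j)" by (intro ballI ex_b)
  from bchoice[OF this] obtain b where b': "\<forall>k\<in>A. \<forall>i\<in>B. m i k = (\<Sum>j\<in>J. b k j * m i j)" by (elim exE)
  note b = b'[rule_format]
  have "mat_rank (indexed_mat m B) = card J"
  proof (rule mat_rank_indexed_mat[OF fin _ ind])
    show "J \<subseteq> B" using JA AB by blast
    fix k assume k: "k \<in> B" "k \<notin> J"
    \<comment> \<open>Column k is a combination of columns in A, and these are combinations of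
      columns in J; the value -1 at k records the resulting relation.\<close>
    define a where "a j = (if j = k then - 1 else (\<Sum>\<gamma>\<in>A. P \<gamma> k * b \<gamma> j))" for j
    have "(\<Sum>j\<in>insert k J. a j * m i j) = 0" if i: "i \<in> B" for i
    proof -
      have "m i k = (\<Sum>\<gamma>\<in>A. P \<gamma> k * m \<gamma> i)" unfolding sym[of i k] by (rule red[OF k(1) i])
      also have "\<dots> = (\<Sum>\<gamma>\<in>A. P \<gamma> k * (\<Sum>j\<in>J. b \<gamma> j * m i j))"
        unfolding sym[of _ i] by (intro sum.cong refl arg_cong[where f = "(*) _"] b i)
      also have "\<dots> = (\<Sum>\<gamma>\<in>A. \<Sum>j\<in>J. P \<gamma> k * b \<gamma> j * m i j)" by (simp add: sum_distrib_left mult.assoc)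
      also have "\<dots> = (\<Sum>j\<in>J. \<Sum>\<gamma>\<in>A. P \<gamma> k * b \<gamma> j * m i j)" by (rule sum.swap)
      also have "\<dots> = (\<Sum>j\<in>J. a j * m i j)"
        by (rule sum.cong) (use k in \<open>auto simp: a_def sum_distrib_right\<close>)
      finally show ?thesis using finJ k by (simp add: a_def)
    qed
    moreover have "a k \<noteq> 0" by (simp add: a_def)
    ultimately show "\<not> indep_columns m B (insert k J)" unfolding indep_columns_def by blast
  qed
  moreover have "mat_rank (indexed_mat m A) = card J"
  proof (rule mat_rank_indexed_mat[OF finA JA])
    show "indep_columns m A J" unfolding indep_columns_def
    proof (intro allI impI)
      fix a assume a: "\<forall>i\<in>A. (\<Sum>j\<in>J. a j * m i j) = 0"
      have "(\<Sum>j\<in>J. a j * m i j) = 0" if i: "i \<in> B" for i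
      proof -
        have "(\<Sum>j\<in>J. a j * m i j) = (\<Sum>j\<in>J. a j * (\<Sum>\<gamma>\<in>A. P \<gamma> i * m \<gamma> j))"
          by (rule sum.cong[OF refl]) (use red[OF i] JA AB in auto)
        also have "\<dots> = (\<Sum>j\<in>J. \<Sum>\<gamma>\<in>A. P \<gamma> i * (a j * m \<gamma> j))" by (simp add: sum_distrib_left mult_ac)
        also have "\<dots> = (\<Sum>\<gamma>\<in>A. \<Sum>j\<in>J. P \<gamma> i * (a j * m \<gamma> j))" by (rule sum.swap)
        also have "\<dots> = 0" using a by (simp add: sum_distrib_left[symmetric])
        finally show ?thesis .
      qed
      then show "\<forall>j\<in>J. a j = 0" using ind unfolding indep_columns_def by blast
    qed
    show "\<not> indep_columns m A (insert k J)" if "k \<in> A" "k \<notin> J" for k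
      using maxA[OF that] indep_columns_antimono[OF AB] by blast
  qed
  ultimately show ?thesis by simp
qed

section \<open>Certificates\<close>

text \<open>All \<open>p \<alpha>\<close> vanish on S, so their squares are of quadratic order there
  and G minus a small multiple of their sum stays nondegenerate. Treating the whole family at once
  gives one \<epsilon> and one representation.\<close>

lemma minimizer_certificate:
  fixes f :: "'n::finite mpoly"
  assumes fin: "finite E" "finite I" and EI: "E \<inter> I = {}"
    and arch: "ball_poly R \<in> constraint_module E I c" "R > 0"
    and oc: "\<And>x. minimizer f E I c x \<Longrightarrow> LICQC E I c x \<and> SCC f E I c x \<and> SOSC f E I c x"
    and s0: "minimizer f E I c s0"
    and p: "\<And>\<alpha> s. \<alpha> \<in> B \<Longrightarrow> minimizer f E I c s \<Longrightarrow> eval_mpoly (p \<alpha>) s = 0"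
  shows "\<exists>\<epsilon>>0. f - Const (eval_mpoly f s0) - Const \<epsilon> * (\<Sum>\<alpha>\<in>B. (p \<alpha>)\<^sup>2) \<in> constraint_module E I c"
proof -
  define \<rho> where "\<rho> = (R + 1) / 2 + 1"
  interpret cube_preordering "ball_preordering R :: 'n mpoly set" \<rho>
    unfolding \<rho>_def by (rule cube_preordering_ball[OF arch(2)])
  have int: "x \<in> interior (cube \<rho>)" if "feasible E I c x" for x
    unfolding \<rho>_def by (rule feasible_interior_cube[OF arch that])
  define S where "S = {x. minimizer f E I c x}"
  define a where "a = eval_mpoly f s0"
  have S_iff: "x \<in> S \<longleftrightarrow> feasible E I c x \<and> eval_mpoly f x = a" for x
    using s0 by (fastforce simp: S_def minimizer_def is_arg_min_linorder a_def)
  have lower: "eval_mpoly f x \<ge> a" if "feasible E I c x" for x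
    using s0 that by (auto simp: minimizer_def is_arg_min_linorder a_def)
  have finS: "finite S" unfolding S_def
    by (rule finite_minimizers[OF fin EI _ oc, of \<rho>]) (use int interior_subset in blast)
  obtain G where nd: "nondegenerate \<rho> G S" and FG: "(f - Const a) - G \<in> constraint_module E I c"
  proof (rule nondegenerate_minorant[OF fin EI finS])
    fix s assume s: "s \<in> S"
    then have "minimizer f E I c s" by (simp add: S_def)
    then show "feasible E I c s \<and> eval_mpoly (f - Const a) s = 0 \<and> (\<exists>\<mu>. second_order_data (f - Const a) E I c s \<mu>)"
      using second_order_data_minimizer[OF fin EI, of f c s a] oc s S_iff by auto
    show "s \<in> interior (cube \<rho>)" using int s S_iff by blast
  next
    fix x assume "feasible E I c x" "x \<notin> S"
    then show "eval_mpoly (f - Const a) x > 0" using lower[of x] S_iff[of x] by auto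
  qed
  have "\<forall>\<^sub>F \<delta> in at_right 0. nondegenerate \<rho> (1 * G + Const \<delta> * (- (\<Sum>\<alpha>\<in>B. (p \<alpha>)\<^sup>2))) S"
  proof (rule nondegenerate_perturb[OF nd order_refl])
    fix s assume "s \<in> S"
    then have "quadratic_order (\<Sum>\<alpha>\<in>B. (p \<alpha>)\<^sup>2 * (- 1)) s"
      using p by (intro quadratic_order_sum vanishing_square_quadratic_order) (auto simp: S_def)
    then show "quadratic_order (- (\<Sum>\<alpha>\<in>B. (p \<alpha>)\<^sup>2)) s" by (simp add: sum_negf)
  qed auto
  then have "\<forall>\<^sub>F \<delta> in at_right 0. nondegenerate \<rho> (1 * G + Const \<delta> * (- (\<Sum>\<alpha>\<in>B. (p \<alpha>)\<^sup>2))) S \<and> \<delta> > 0"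
    using eventually_at_right_less[of "0::real"] by (rule eventually_conj)
  then obtain \<delta> where d: "nondegenerate \<rho> (1 * G + Const \<delta> * (- (\<Sum>\<alpha>\<in>B. (p \<alpha>)\<^sup>2))) S" "\<delta> > 0"
    using eventually_happens'[OF trivial_limit_at_right_real] by blast
  have "1 * G + Const \<delta> * (- (\<Sum>\<alpha>\<in>B. (p \<alpha>)\<^sup>2)) \<in> constraint_module E I c"
    by (rule ball_preordering_subset[OF arch(1) nondegenerate_in_T[OF d(1)]])
  from constraint_module_add[OF FG this]
  have "f - Const a - Const \<delta> * (\<Sum>\<alpha>\<in>B. (p \<alpha>)\<^sup>2) \<in> constraint_module E I c"
    by (simp add: algebra_simps)
  then show ?thesis using d(2) unfolding a_def by blast
qed

text \<open>With S empty and F = -1 the conditions on S and on feasible points are vacuous, and G is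
  positive on the whole cube.\<close>

lemma infeasible_certificate:
  fixes c :: "'j \<Rightarrow> 'n::finite mpoly"
  assumes fin: "finite E" "finite I" and EI: "E \<inter> I = {}"
    and arch: "ball_poly R \<in> constraint_module E I c" "R > 0"
    and inf: "\<And>x. \<not> feasible E I c x"
  shows "- 1 \<in> constraint_module E I c"
proof -
  interpret cube_preordering "ball_preordering R :: 'n mpoly set" "(R + 1) / 2 + 1"
    by (rule cube_preordering_ball[OF arch(2)])
  obtain G where nd: "nondegenerate ((R + 1) / 2 + 1) G {}" and FG: "- 1 - G \<in> constraint_module E I c"
    by (rule nondegenerate_minorant[OF fin EI, where S = "{}" and F = "- 1"]) (use inf in auto)
  from constraint_module_add[OF FG ball_preordering_subset[OF arch(1) nondegenerate_in_T[OF nd]]]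
  show ?thesis by simp
qed

lemma minimizer_exists:
  fixes f :: "'n::finite mpoly"
  assumes "\<And>x. feasible E I c x \<Longrightarrow> x \<in> cube \<rho>" "feasible E I c x0"
  shows "\<exists>s. minimizer f E I c s"
proof -
  define K where "K = {x. feasible E I c x}"
  have "K = cube \<rho> \<inter> ((\<Inter>j\<in>E. {x. eval_mpoly (c j) x = 0}) \<inter> (\<Inter>j\<in>I. {x. eval_mpoly (c j) x \<ge> 0}))"
    using assms(1) by (auto simp: K_def feasible_def)
  also have "compact \<dots>"
    by (intro compact_Int_closed compact_cube closed_Int closed_INT ballI closed_Collect_eq closed_Collect_le
        continuous_on_eval continuous_on_const)
  finally have K: "compact K" .
  have "K \<noteq> {}" using assms(2) by (auto simp: K_def)
  then obtain s where "s \<in> K" "\<forall>x\<in>K. eval_mpoly f s \<le> eval_mpoly f x"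
    using continuous_attains_inf[OF K _ continuous_on_eval] by blast
  then show ?thesis by (auto simp: minimizer_def is_arg_min_linorder K_def)
qed

section \<open>Truncated moment functionals\<close>

lemma riesz_diff: "riesz (p - q) w = riesz p w - riesz q w"
  using riesz_add[of "p - q" q w] by simp

lemma riesz_monomial: "riesz (monomial \<alpha>) w = w \<alpha>"
  by (simp add: riesz_def monomial_def)

lemma lookup_Const_mult: "Poly_Mapping.lookup (Const a * p) \<alpha> = a * Poly_Mapping.lookup p \<alpha>"
  by (simp add: Const_def mult_map_scale_conv_mult[symmetric] map.rep_eq when_def)

lemma mdeg_leI:
  assumes "\<And>\<beta>. d < expo_deg \<beta> \<Longrightarrow> Poly_Mapping.lookup p \<beta> = 0"
  shows "mdeg p \<le> d"
proof -
  have "expo_deg \<beta> \<le> d" if "\<beta> \<in> Poly_Mapping.keys p" for \<beta>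
    using assms[of \<beta>] that by (auto simp: in_keys_iff not_less[symmetric])
  then show ?thesis unfolding mdeg_def by (subst Max_le_iff) auto
qed

lemma lookup_eq_0_mdeg: "mdeg p < expo_deg \<beta> \<Longrightarrow> Poly_Mapping.lookup p \<beta> = 0"
  using expo_deg_le_mdeg[of \<beta> p] by (auto simp: in_keys_iff)

lemma psd_loc_mat_nonneg:
  assumes "psd (loc_mat k q w)" "2 * mdeg p + mdeg q \<le> 2 * k"
  shows "riesz (q * p\<^sup>2) w \<ge> 0"
proof -
  have "coeff_vec (loc_expos k q) p \<in> carrier_vec (dim_row (loc_mat k q w))"
    by (simp add: coeff_vec_def loc_mat_def Let_def)
  then have "Matrix.scalar_prod (coeff_vec (loc_expos k q) p)
      (mult_mat_vec (loc_mat k q w) (coeff_vec (loc_expos k q) p)) \<ge> 0"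
    using assms(1) unfolding psd_def by blast
  then show ?thesis by (simp only: loc_mat_quadratic_form[OF assms(2)])
qed

lemma mdeg_1 [simp]: "mdeg (1 :: 'n::finite mpoly) = 0"
  by (simp add: mdeg_def expo_deg_def)

lemma psd_moment_mat_nonneg:
  assumes "psd (moment_mat k w)" "mdeg p \<le> k"
  shows "riesz (p\<^sup>2) w \<ge> 0"
  using psd_loc_mat_nonneg[of k 1 w p] assms by (simp add: moment_mat_def)

lemma loc_vec_zero:
  assumes "loc_vec d q w = 0\<^sub>v (card (loc_vec_expos d q))" "mdeg p + mdeg q \<le> d"
  shows "riesz (q * p) w = 0"
proof -
  have "riesz (q * p) w = Matrix.scalar_prod (0\<^sub>v (card (loc_vec_expos d q))) (coeff_vec (loc_vec_expos d q) p)"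
    using loc_vec_linear_form[OF assms(2), of w] assms(1) by simp
  also have "\<dots> = 0" by (simp add: coeff_vec_def)
  finally show ?thesis .
qed

text \<open>Cauchy-Schwarz for the semidefinite form that sends p and r to
  \<open>riesz (p * r) w\<close>: an element of length zero is orthogonal to all others.\<close>

lemma psd_moment_mat_kernel:
  assumes psd: "psd (moment_mat k w)" and p: "mdeg p \<le> k" "riesz (p\<^sup>2) w = 0" and r: "mdeg r \<le> k"
  shows "riesz (p * r) w = 0"
proof (rule ccontr)
  define b where "b = riesz (p * r) w"
  define d where "d = riesz (r\<^sup>2) w"
  assume "riesz (p * r) w \<noteq> 0"
  then have b: "b \<noteq> 0" by (simp add: b_def)
  have d: "d \<ge> 0" unfolding d_def by (rule psd_moment_mat_nonneg[OF psd r])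
  \<comment> \<open>With this t the square of p + t r would get a negative value; the denominator d
    + 1 avoids a case distinction at d = 0.\<close>
  define t where "t = - b / (d + 1)"
  have "mdeg (p + Const t * r) \<le> k"
    by (rule mdeg_leI) (use p(1) r in \<open>simp add: lookup_add lookup_Const_mult lookup_eq_0_mdeg\<close>)
  then have "riesz ((p + Const t * r)\<^sup>2) w \<ge> 0" by (rule psd_moment_mat_nonneg[OF psd])
  moreover have "(p + Const t * r)\<^sup>2 = p\<^sup>2 + (Const (2 * t) * (p * r) + Const (t\<^sup>2) * r\<^sup>2)"
  proof -
    have c2: "Const (2 * t) = Const t + (Const t :: 'a mpoly)" by (simp flip: Const_add)
    show ?thesis unfolding c2 by (simp add: Const_mult power2_eq_square algebra_simps)
  qed
  ultimately have quad: "2 * t * b + t\<^sup>2 * d \<ge> 0"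
    by (simp add: riesz_add riesz_Const_mult p(2) b_def d_def)
  have bt: "b = - (t * (d + 1))" using d by (simp add: t_def)
  have "2 * t * b + t\<^sup>2 * d = - (t\<^sup>2 * (d + 2))"
    unfolding bt by (simp add: power2_eq_square algebra_simps)
  moreover have "t\<^sup>2 * (d + 2) > 0" using b d bt by (intro mult_pos_pos) auto
  ultimately show False using quad by linarith
qed

text \<open>One representation is fixed, and once k exceeds all degrees in it the constraints of the
  relaxation apply term by term. The bound \<open>k0\<close> is a crude sum of these degrees and
  does not depend on w.\<close>

lemma constraint_module_riesz_nonneg:
  fixes c :: "'j \<Rightarrow> 'n::finite mpoly"
  assumes fin: "finite E" "finite I" and p: "p \<in> constraint_module E I c"
  shows "\<exists>k0. \<forall>k\<ge>k0. \<forall>w. moment_feasible k E I c w \<longrightarrow> riesz p w \<ge> 0"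
proof -
  obtain h s0 s where pe: "p = (\<Sum>j\<in>E. c j * h j) + (s0 + (\<Sum>j\<in>I. c j * s j))"
    and s0: "s0 \<in> SOS" and s: "\<And>j. j \<in> I \<Longrightarrow> s j \<in> SOS"
    by (rule constraint_moduleE[OF p]) (rule that; assumption)
  obtain m0 :: nat and a0 where a0: "s0 = (\<Sum>i<m0. (a0 i)\<^sup>2)" using s0 by (auto simp: SOS_def)
  have "\<exists>z :: nat \<times> (nat \<Rightarrow> 'n mpoly). s j = (\<Sum>i<fst z. (snd z i)\<^sup>2)" if j: "j \<in> I" for j
  proof -
    obtain m :: nat and a where "s j = (\<Sum>i<m. (a i)\<^sup>2)" using s[OF j] by (auto simp: SOS_def)
    then show ?thesis by (intro exI[of _ "(m, a)"]) simp
  qed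
  then have "\<forall>j\<in>I. \<exists>z :: nat \<times> (nat \<Rightarrow> 'n mpoly). s j = (\<Sum>i<fst z. (snd z i)\<^sup>2)" by (intro ballI)
  from bchoice[OF this] obtain z :: "'j \<Rightarrow> nat \<times> (nat \<Rightarrow> 'n mpoly)" where z: "\<forall>j\<in>I. s j = (\<Sum>i<fst (z j). (snd (z j) i)\<^sup>2)" by (elim exE)
  define k0 where "k0 = (\<Sum>j\<in>E. mdeg (h j) + mdeg (c j)) + (\<Sum>i<m0. mdeg (a0 i))
    + (\<Sum>j\<in>I. \<Sum>i<fst (z j). mdeg (snd (z j) i) + mdeg (c j))"
  show ?thesis
  proof (intro exI[of _ k0] allI impI)
    fix k w assume k: "k \<ge> k0" and w: "moment_feasible k E I c w"
    have "riesz (c j * h j) w = 0" if j: "j \<in> E" for j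
    proof (rule loc_vec_zero)
      show "loc_vec (2 * k) (c j) w = 0\<^sub>v (card (loc_vec_expos (2 * k) (c j)))"
        using w j by (simp add: moment_feasible_def)
      have "mdeg (h j) + mdeg (c j) \<le> (\<Sum>j\<in>E. mdeg (h j) + mdeg (c j))"
        using fin j by (intro member_le_sum) auto
      then show "mdeg (h j) + mdeg (c j) \<le> 2 * k" using k unfolding k0_def by linarith
    qed
    then have 1: "riesz (\<Sum>j\<in>E. c j * h j) w = 0" by (simp add: riesz_sum)
    have "riesz ((a0 i)\<^sup>2) w \<ge> 0" if i: "i < m0" for i
    proof (rule psd_moment_mat_nonneg)
      show "psd (moment_mat k w)" using w by (simp add: moment_feasible_def)
      have "mdeg (a0 i) \<le> (\<Sum>i<m0. mdeg (a0 i))" using i by (intro member_le_sum) auto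
      then show "mdeg (a0 i) \<le> k" using k unfolding k0_def by linarith
    qed
    then have 2: "riesz s0 w \<ge> 0" unfolding a0 riesz_sum by (intro sum_nonneg) auto
    have "riesz (c j * s j) w \<ge> 0" if j: "j \<in> I" for j
    proof -
      have "riesz (c j * (snd (z j) i)\<^sup>2) w \<ge> 0" if i: "i < fst (z j)" for i
      proof (rule psd_loc_mat_nonneg)
        show "psd (loc_mat k (c j) w)" using w j by (simp add: moment_feasible_def)
        have "mdeg (snd (z j) i) + mdeg (c j) \<le> (\<Sum>i<fst (z j). mdeg (snd (z j) i) + mdeg (c j))"
          using i by (intro member_le_sum) auto
        also have "\<dots> \<le> (\<Sum>j\<in>I. \<Sum>i<fst (z j). mdeg (snd (z j) i) + mdeg (c j))"
          using fin j by (intro member_le_sum[of j I "\<lambda>j. \<Sum>i<fst (z j). mdeg (snd (z j) i) + mdeg (c j)"]) auto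
        finally show "2 * mdeg (snd (z j) i) + mdeg (c j) \<le> 2 * k" using k unfolding k0_def by linarith
      qed
      then show ?thesis
        unfolding z[rule_format, OF j] sum_distrib_left riesz_sum by (intro sum_nonneg) auto
    qed
    then have 3: "riesz (\<Sum>j\<in>I. c j * s j) w \<ge> 0" unfolding riesz_sum by (intro sum_nonneg) auto
    show "riesz p w \<ge> 0" unfolding pe riesz_add using 1 2 3 by simp
  qed
qed

section \<open>Moment sequences of feasible points\<close>

definition point_moments :: "nat \<Rightarrow> real ^ 'n::finite \<Rightarrow> 'n expo \<Rightarrow> real" where
  "point_moments d x = restrict (\<lambda>\<alpha>. mon_val \<alpha> x) (expos d)"

lemma riesz_restrict:
  assumes "Poly_Mapping.keys p \<subseteq> A"
  shows "riesz p (restrict w A) = riesz p w"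
  unfolding riesz_def by (rule sum.cong) (use assms in auto)

lemma riesz_point_moments:
  assumes "mdeg p \<le> d"
  shows "riesz p (point_moments d x) = eval_mpoly p x"
  unfolding point_moments_def eval_eq_riesz
  by (rule riesz_restrict) (use assms expo_deg_le_mdeg[of _ p] in \<open>fastforce simp: expos_def\<close>)

lemma expo_deg_add: "expo_deg (\<alpha> + \<beta>) = expo_deg \<alpha> + expo_deg \<beta>"
  by (simp add: expo_deg_def lookup_add sum.distrib)

lemma riesz_point_moments_mult_monomial:
  assumes "mdeg q + expo_deg \<alpha> \<le> d"
  shows "riesz (q * monomial \<alpha>) (point_moments d x) = eval_mpoly q x * mon_val \<alpha> x"
proof -
  have "Poly_Mapping.keys (q * monomial \<alpha>) \<subseteq> {a + b | a b. a \<in> Poly_Mapping.keys q \<and> b \<in> Poly_Mapping.keys (monomial \<alpha>)}"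
    by (rule keys_mult)
  also have "\<dots> \<subseteq> expos d"
    using expo_deg_le_mdeg[of _ q] assms by (fastforce simp: monomial_def expos_def expo_deg_add)
  finally have "riesz (q * monomial \<alpha>) (point_moments d x) = eval_mpoly (q * monomial \<alpha>) x"
    unfolding point_moments_def eval_eq_riesz by (rule riesz_restrict)
  then show ?thesis by simp
qed

text \<open>The localizing matrix is q(x) times the rank one matrix of the monomial vector at
  x.\<close>

lemma psd_loc_mat_point_moments:
  assumes q: "eval_mpoly q x \<ge> 0"
  shows "psd (loc_mat k q (point_moments (2 * k) x))"
  unfolding psd_def
proof (intro conjI ballI)
  let ?A = "loc_expos k q" let ?M = "loc_mat k q (point_moments (2 * k) x)"
  let ?e = "\<lambda>i. mon_val (from_nat_into ?A i) x"
  fix v :: "real Matrix.vec" assume v: "v \<in> carrier_vec (dim_row ?M)"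
  have mem: "from_nat_into ?A i \<in> ?A" if "i < card ?A" for i
    by (rule from_nat_into) (use that in auto)
  have entry: "?M $$ (i, j) = eval_mpoly q x * ?e i * ?e j" if "i < card ?A" "j < card ?A" for i j
  proof -
    have "mdeg q + expo_deg (from_nat_into ?A i + from_nat_into ?A j) \<le> 2 * k"
      using mem[OF that(1)] mem[OF that(2)] by (simp add: loc_expos_def expo_deg_add)
    then show ?thesis
      using that by (simp add: loc_mat_def Let_def riesz_point_moments_mult_monomial mon_val_add)
  qed
  have dim: "dim_row ?M = card ?A" "dim_col ?M = card ?A" "dim_vec v = card ?A"
    using v by (auto simp: loc_mat_def Let_def)
  have "Matrix.scalar_prod v (mult_mat_vec ?M v) =
     (\<Sum>i = 0..<card ?A. Matrix.vec_index v i * (\<Sum>j = 0..<card ?A. ?M $$ (i, j) * Matrix.vec_index v j))"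
    using dim by (simp add: Matrix.scalar_prod_def)
  also have "\<dots> = (\<Sum>i = 0..<card ?A. \<Sum>j = 0..<card ?A. eval_mpoly q x * ((Matrix.vec_index v i * ?e i) * (Matrix.vec_index v j * ?e j)))"
    unfolding sum_distrib_left by (intro sum.cong refl) (simp add: entry)
  also have "\<dots> = eval_mpoly q x * (\<Sum>i = 0..<card ?A. Matrix.vec_index v i * ?e i)\<^sup>2"
    by (simp only: power2_eq_square sum_product) (simp only: sum_distrib_left)
  also have "\<dots> \<ge> 0" using q by simp
  finally show "Matrix.scalar_prod v (mult_mat_vec ?M v) \<ge> 0" .
qed (rule loc_mat_symmetric)

lemma point_moments_feasible:
  assumes "feasible E I c x"
  shows "moment_feasible k E I c (point_moments (2 * k) x)"
  unfolding moment_feasible_def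
proof (intro conjI ballI)
  show "point_moments (2 * k) x \<in> tms (2 * k)" by (simp add: tms_def point_moments_def)
  show "riesz 1 (point_moments (2 * k) x) = 1" by (simp add: riesz_point_moments)
  show "psd (loc_mat k (c j) (point_moments (2 * k) x))" if "j \<in> I" for j
    using assms that by (intro psd_loc_mat_point_moments) (simp add: feasible_def)
  show "psd (moment_mat k (point_moments (2 * k) x))"
    unfolding moment_mat_def by (rule psd_loc_mat_point_moments) simp
  fix j assume j: "j \<in> E"
  let ?A = "loc_vec_expos (2 * k) (c j)"
  show "loc_vec (2 * k) (c j) (point_moments (2 * k) x) = 0\<^sub>v (card ?A)"
  proof (rule eq_vecI)
    fix i assume "i < dim_vec (0\<^sub>v (card ?A) :: real Matrix.vec)"
    then have i: "i < card ?A" by simp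
    have "from_nat_into ?A i \<in> ?A" by (rule from_nat_into) (use i in auto)
    then have "riesz (c j * monomial (from_nat_into ?A i)) (point_moments (2 * k) x) = 0"
      using assms j by (subst riesz_point_moments_mult_monomial) (auto simp: loc_vec_expos_def feasible_def)
    then show "Matrix.vec_index (loc_vec (2 * k) (c j) (point_moments (2 * k) x)) i = Matrix.vec_index (0\<^sub>v (card ?A)) i"
      using i by (simp add: loc_vec_def Let_def)
  qed (simp add: loc_vec_def Let_def)
qed

lemma moment_mat_indexed:
  "moment_mat k w = indexed_mat (\<lambda>\<alpha> \<beta>. riesz (monomial (\<alpha> + \<beta>)) w) (expos k)"
proof -
  have "loc_expos k (1 :: 'a mpoly) = expos k" by (simp add: loc_expos_def expos_def)
  then show ?thesis by (simp add: moment_mat_def loc_mat_def Let_def indexed_mat_def)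
qed

theorem theorem3p3:
  fixes f :: "'n::finite mpoly"
    and c :: "'j \<Rightarrow> 'n mpoly"
    and E I :: "'j set"
  assumes "finite E" and "finite I" and "E \<inter> I = {}"
    and "archimedean E I c"
    and "\<And>x. minimizer f E I c x \<Longrightarrow> LICQC E I c x \<and> SCC f E I c x \<and> SOSC f E I c x"
  shows "\<exists>k0 \<ge> d_0 f E I c. \<forall>k \<ge> k0. \<forall>w.
    moment_minimizer k f E I c w \<longrightarrow> flat_truncation k f E I c w"
proof -
  note fin = assms(1,2) and EI = assms(3) and oc = assms(5)
  obtain R where R: "ball_poly R \<in> constraint_module E I c" "R > 0"
    using assms(4) unfolding archimedean_def constraint_module_def ball_poly_def by blast
  show ?thesis
  proof (cases "\<exists>x. feasible E I c x")
    case False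
    \<comment> \<open>Every feasible w gives -1 the value -1, which contradicts nonnegativity on the
      module; relaxations of high order are thus infeasible and the claim holds vacuously.\<close>
    then have "- 1 \<in> constraint_module E I c" by (intro infeasible_certificate[OF fin EI R]) auto
    from constraint_module_riesz_nonneg[OF fin this]
    obtain k1 where k1: "\<forall>k\<ge>k1. \<forall>w. moment_feasible k E I c w \<longrightarrow> riesz (- 1) w \<ge> 0" by (elim exE)
    have "\<not> moment_minimizer k f E I c w" if "k \<ge> k1" for k w
    proof
      assume "moment_minimizer k f E I c w"
      then have w: "moment_feasible k E I c w" by (simp add: moment_minimizer_def is_arg_min_def)
      then have "riesz (0 - 1) w \<ge> 0" using k1 that by simp
      moreover have "riesz 1 w = 1" using w by (simp add: moment_feasible_def)
      moreover have "riesz 0 w = 0" by (simp add: riesz_def)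
      ultimately show False by (simp only: riesz_diff)
    qed
    then show ?thesis by (intro exI[of _ "max (d_0 f E I c) k1"]) auto
  next
    case True
    then obtain x0 where x0: "feasible E I c x0" by blast
    define \<rho> where "\<rho> = (R + 1) / 2 + 1"
    have cube: "x \<in> cube \<rho>" if "feasible E I c x" for x
      using feasible_interior_cube[OF R that] interior_subset unfolding \<rho>_def by blast
    obtain s0 where s0: "minimizer f E I c s0" using minimizer_exists[OF cube x0] by blast
    define S where "S = {x. minimizer f E I c x}"
    have finS: "finite S" unfolding S_def by (rule finite_minimizers[OF fin EI cube oc])
    obtain L :: "real ^ 'n \<Rightarrow> 'n mpoly"
      where L: "\<And>s t. s \<in> S \<Longrightarrow> t \<in> S \<Longrightarrow> eval_mpoly (L s) t = (if s = t then 1 else 0)"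
      using lagrange_basis[OF finS] by blast
    \<comment> \<open>D bounds the degrees of all Lagrange polynomials and is at least
      \<open>d_0\<close>; then D + d_K is an admissible truncation order, and lowering it by d_K
      gives D back.\<close>
    define D where "D = d_0 f E I c + (\<Sum>s\<in>S. mdeg (L s))"
    define t where "t = D + d_K E I c"
    have degL: "mdeg (L s) \<le> D" if "s \<in> S" for s
      using member_le_sum[OF that, of "\<lambda>s. mdeg (L s)"] finS by (simp add: D_def)
    define p where "p \<alpha> = monomial \<alpha> - (\<Sum>s\<in>S. Const (mon_val \<alpha> s) * L s)" for \<alpha>
    have p0: "eval_mpoly (p \<alpha>) s = 0" if "minimizer f E I c s" for \<alpha> s
    proof -
      have s: "s \<in> S" using that by (simp add: S_def)
      have "eval_mpoly (p \<alpha>) s = mon_val \<alpha> s - (\<Sum>u\<in>S. if u = s then mon_val \<alpha> u else 0)"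
        unfolding p_def eval_diff eval_sum eval_Const_mult eval_monomial
        by (intro arg_cong2[where f = "(-)"] refl sum.cong) (use L s in auto)
      then show ?thesis using s finS by simp
    qed
    have degp: "mdeg (p \<alpha>) \<le> t" if "\<alpha> \<in> expos t" for \<alpha>
    proof (rule mdeg_leI)
      fix \<beta> :: "'n expo" assume \<beta>: "t < expo_deg \<beta>"
      then have "\<alpha> \<noteq> \<beta>" using that by (auto simp: expos_def)
      moreover have "Poly_Mapping.lookup (L s) \<beta> = 0" if "s \<in> S" for s
        using degL[OF that] \<beta> by (intro lookup_eq_0_mdeg) (simp add: t_def)
      ultimately show "Poly_Mapping.lookup (p \<alpha>) \<beta> = 0"
        by (simp add: p_def lookup_minus lookup_sum lookup_Const_mult monomial_def lookup_single)
    qed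
    from minimizer_certificate[OF fin EI R oc s0, of "expos t" p, OF _ p0]
    obtain \<epsilon> where e: "\<epsilon> > 0"
      and cert: "f - Const (eval_mpoly f s0) - Const \<epsilon> * (\<Sum>\<alpha>\<in>expos t. (p \<alpha>)\<^sup>2) \<in> constraint_module E I c"
      by blast
    from constraint_module_riesz_nonneg[OF fin cert]
    obtain k1 where k1: "\<forall>k\<ge>k1. \<forall>w. moment_feasible k E I c w \<longrightarrow>
        riesz (f - Const (eval_mpoly f s0) - Const \<epsilon> * (\<Sum>\<alpha>\<in>expos t. (p \<alpha>)\<^sup>2)) w \<ge> 0" by (elim exE)
    have "flat_truncation k f E I c w" if k: "k \<ge> max t k1" and w: "moment_minimizer k f E I c w" for k w
    proof -
      have feas: "moment_feasible k E I c w"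
        and opt: "\<And>y. moment_feasible k E I c y \<Longrightarrow> riesz f w \<le> riesz f y"
        using w by (auto simp: moment_minimizer_def is_arg_min_linorder)
      have psd: "psd (moment_mat k w)" and one: "riesz 1 w = 1"
        using feas by (auto simp: moment_feasible_def)
      \<comment> \<open>Ensures that the truncated moments of s0 give f the value f(s0), an upper
        bound of the optimum.\<close>
      have "mdeg f \<le> 2 * k"
      proof -
        have "half_deg f \<le> d_0 f E I c" by (simp add: d_0_def)
        also have "\<dots> \<le> t" by (simp add: t_def D_def)
        also have "t \<le> k" using k by simp
        finally have "half_deg f \<le> k" .
        then have "real (mdeg f) / 2 \<le> real k" unfolding half_deg_def by linarith
        then show ?thesis by linarith
      qed
      then have "riesz f w \<le> eval_mpoly f s0"
        using opt[OF point_moments_feasible[of E I c s0 k]] s0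
        by (simp add: riesz_point_moments minimizer_def is_arg_min_def)
      moreover have "riesz (f - Const (eval_mpoly f s0) - Const \<epsilon> * (\<Sum>\<alpha>\<in>expos t. (p \<alpha>)\<^sup>2)) w \<ge> 0"
        by (rule k1[rule_format, OF _ feas]) (use k in simp)
      moreover have "riesz (Const (eval_mpoly f s0)) w = eval_mpoly f s0"
        using riesz_Const_mult[of "eval_mpoly f s0" 1 w] one by simp
      \<comment> \<open>The certificate bounds the optimum from below by f(s0) plus this term, while
        the moments of s0 bound it from above by f(s0).\<close>
      ultimately have "\<epsilon> * (\<Sum>\<alpha>\<in>expos t. riesz ((p \<alpha>)\<^sup>2) w) \<le> 0"
        by (simp add: riesz_diff riesz_Const_mult riesz_sum)
      then have le: "(\<Sum>\<alpha>\<in>expos t. riesz ((p \<alpha>)\<^sup>2) w) \<le> 0" using e by (simp add: mult_le_0_iff)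
      have nn: "riesz ((p \<alpha>)\<^sup>2) w \<ge> 0" if "\<alpha> \<in> expos t" for \<alpha>
        using degp[OF that] k by (intro psd_moment_mat_nonneg[OF psd]) simp
      have sq0: "riesz ((p \<alpha>)\<^sup>2) w = 0" if "\<alpha> \<in> expos t" for \<alpha>
      proof -
        have "riesz ((p \<alpha>)\<^sup>2) w \<le> (\<Sum>\<alpha>\<in>expos t. riesz ((p \<alpha>)\<^sup>2) w)"
          by (rule member_le_sum[OF that _ finite_expos]) (rule nn, simp)
        then show ?thesis using le nn[OF that] by linarith
      qed
      \<comment> \<open>The kernel property turns <p_\<alpha> x^\<beta>, w> = 0 into a relation
        between rows of the moment matrix: row \<alpha> is a combination of rows of degree at most
        D, with coefficients that do not depend on \<beta>.\<close>
      have red: "riesz (monomial (\<alpha> + \<beta>)) w = (\<Sum>\<gamma>\<in>expos D. (\<Sum>s\<in>S. mon_val \<alpha> s * Poly_Mapping.lookup (L s) \<gamma>) * riesz (monomial (\<gamma> + \<beta>)) w)"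
        if \<alpha>: "\<alpha> \<in> expos t" and \<beta>: "\<beta> \<in> expos t" for \<alpha> \<beta>
      proof -
        have "mdeg (monomial \<beta>) \<le> k"
          using \<beta> k by (intro mdeg_leI) (auto simp: monomial_def lookup_single when_def expos_def)
        then have "riesz (p \<alpha> * monomial \<beta>) w = 0"
          using degp[OF \<alpha>] k by (intro psd_moment_mat_kernel[OF psd _ sq0[OF \<alpha>]]) auto
        moreover have "p \<alpha> * monomial \<beta> = monomial (\<alpha> + \<beta>) - (\<Sum>s\<in>S. Const (mon_val \<alpha> s) * (monomial \<beta> * L s))"
          unfolding p_def left_diff_distrib monomial_add sum_distrib_right by (simp add: mult_ac)
        ultimately have "riesz (monomial (\<alpha> + \<beta>)) w = (\<Sum>s\<in>S. mon_val \<alpha> s * riesz (monomial \<beta> * L s) w)"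
          by (simp add: riesz_diff riesz_sum riesz_Const_mult)
        also have "\<dots> = (\<Sum>s\<in>S. mon_val \<alpha> s * (\<Sum>\<gamma>\<in>expos D. Poly_Mapping.lookup (L s) \<gamma> * riesz (monomial (\<gamma> + \<beta>)) w))"
        proof (intro sum.cong refl arg_cong[where f = "(*) _"])
          fix s assume s: "s \<in> S"
          have "Poly_Mapping.keys (L s) \<subseteq> expos D"
            using degL[OF s] expo_deg_le_mdeg[of _ "L s"] by (fastforce simp: expos_def)
          then show "riesz (monomial \<beta> * L s) w = (\<Sum>\<gamma>\<in>expos D. Poly_Mapping.lookup (L s) \<gamma> * riesz (monomial (\<gamma> + \<beta>)) w)"
            by (subst riesz_mult_expand[OF finite_expos]) (simp_all add: monomial_add mult.commute)
        qed
        also have "\<dots> = (\<Sum>s\<in>S. \<Sum>\<gamma>\<in>expos D. mon_val \<alpha> s * Poly_Mapping.lookup (L s) \<gamma> * riesz (monomial (\<gamma> + \<beta>)) w)"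
          by (simp add: sum_distrib_left mult.assoc)
        also have "\<dots> = (\<Sum>\<gamma>\<in>expos D. \<Sum>s\<in>S. mon_val \<alpha> s * Poly_Mapping.lookup (L s) \<gamma> * riesz (monomial (\<gamma> + \<beta>)) w)"
          by (rule sum.swap)
        finally show ?thesis by (simp add: sum_distrib_right)
      qed
      \<comment> \<open>Flat truncation refers to the restriction to degree 2t, which still contains
        every \<alpha> + \<beta> occurring in \<open>red\<close>.\<close>
      define w' where "w' = restrict w (expos (2 * t))"
      have w': "riesz (monomial (\<alpha> + \<beta>)) w' = riesz (monomial (\<alpha> + \<beta>)) w" if "\<alpha> \<in> expos t" "\<beta> \<in> expos t" for \<alpha> \<beta>
        using that by (simp add: riesz_monomial w'_def expos_def expo_deg_add)
      have sub: "expos D \<subseteq> (expos t :: 'n expo set)" by (auto simp: expos_def t_def)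
      have "mat_rank (moment_mat D w') = mat_rank (moment_mat t w')"
        unfolding moment_mat_indexed
      proof (rule mat_rank_reduction[OF finite_expos sub])
        show "riesz (monomial (\<alpha> + \<beta>)) w' = riesz (monomial (\<beta> + \<alpha>)) w'" for \<alpha> \<beta> by (simp add: add.commute)
        fix \<alpha> \<beta> :: "'n expo" assume ab: "\<alpha> \<in> expos t" "\<beta> \<in> expos t"
        show "riesz (monomial (\<alpha> + \<beta>)) w' = (\<Sum>\<gamma>\<in>expos D. (\<Sum>s\<in>S. mon_val \<alpha> s * Poly_Mapping.lookup (L s) \<gamma>) * riesz (monomial (\<gamma> + \<beta>)) w')"
          unfolding w'[OF ab] red[OF ab] by (intro sum.cong refl arg_cong[where f = "(*) _"] w'[symmetric]) (use ab sub in auto)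
      qed
      moreover have "t \<in> {d_0 f E I c..k}" using k by (simp add: t_def D_def)
      moreover have "t - d_K E I c = D" by (simp add: t_def)
      ultimately show ?thesis unfolding flat_truncation_def w'_def by (intro bexI[of _ t]) auto
    qed
    moreover have "max t k1 \<ge> d_0 f E I c" by (simp add: t_def D_def)
    ultimately show ?thesis by blast
  qed
qed

end
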